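(* Let $P\to M$ and $P_S\to S$ be right principal $\mathcal O$-bundles, where $S\subset M$ is a submanifold endowed with a volume form ${\rm d}^ks$, and let $\mathcal A$ be a principal connection on $P$. Let $\mathbf J_L:T^*Q_{KK}\to\mathfrak{aut}(P)^*$ be the momentum map associated to the cotangent lift of the left action of $\mathcal{A}ut(P)$ on $Q_{KK}$ by composition $\mathcal Q\mapsto\varphi\circ\mathcal Q$. Under the identification $\mathfrak{aut}(P)\simeq\mathfrak X(M)\times\Gamma(\operatorname{Ad}P)$ provided by $\mathcal A$, one has, for $\mathcal P_{\mathcal Q}\in T^*_{\mathcal Q}Q_{KK}$, $$\mathbf J_L(\mathcal P_{\mathcal Q})=\left(\int_S\mathbf P^{\mathcal A}_{\mathbf Q}(s)\,\delta(x-\mathbf Q(s))\,{\rm d}^ks,\ \int_S\widetilde{\mathcal Q}(\bar\zeta(s))\,\delta(x-\mathbf Q(s))\,{\rm d}^ks\right)\in\mathfrak X(M)^*\times\Gamma(\operatorname{Ad}P)^*,$$ that is, for all $(\mathbf u,\tilde\omega)\in\mathfrak X(M)\times\Gamma(\operatorname{Ad}P)$, $$\langle\mathbf J_L(\mathcal P_{\mathcal Q}),(\mathbf u,\tilde\omega)\rangle=\int_S\left(\mathbf P^{\mathcal A}_{\mathbf Q}(s)\cdot\mathbf u(\mathbf Q(s))+\widetilde{\mathcal Q}(\bar\zeta(s))\cdot\tilde\omega(\mathbf Q(s))\right){\rm d}^ks.$$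
   Context: $\mathcal O$ is a Lie group with Lie algebra $\mathfrak o$; $\Phi_g$ denotes the right $\mathcal O$-action on $P$ or $P_S$, and $\xi_P$ the infinitesimal generator of $\xi\in\mathfrak o$; $\pi$ denotes the bundle projections. $\mathcal{A}ut(P)$ is the group of $\mathcal O$-equivariant diffeomorphisms of $P$, with Lie algebra $\mathfrak{aut}(P)$ of equivariant vector fields. A principal connection is $\mathcal A\in\Omega^1(P,\mathfrak o)$ with $\Phi_g^*\mathcal A=\operatorname{Ad}_{g^{-1}}\mathcal A$, $\mathcal A(\xi_P)=\xi$. It gives the isomorphism $U\mapsto([U],\widetilde{\mathcal A(U)})$ from $\mathfrak{aut}(P)$ to $\mathfrak X(M)\times\Gamma(\operatorname{Ad}P)$, where $T\pi\circ U=[U]\circ\pi$, $\operatorname{Ad}P=(P\times\mathfrak o)/\mathcal O$ for the action $(p,\xi)\mapsto(\Phi_g(p),\operatorname{Ad}_{g^{-1}}\xi)$, and $\tilde\omega(\pi(p))=[p,\omega(p)]_{\mathcal O}$ for an equivariant function $\omega:P\to\mathfrak o$. Similarly $\operatorname{Ad}^*P=(P\times\mathfrak o^* )/\mathcal O$ for $(p,\mu)\mapsto(\Phi_g(p),\operatorname{Ad}^*_g\mu)$, with $\langle\operatorname{Ad}^*_g\mu,\xi\rangle=\langle\mu,\operatorname{Ad}_g\xi\rangle$; same for $P_S$. $Q_{KK}$ is the set of equivariant (smooth) maps $\mathcal Q:P_S\to P$ ($\mathcal Q\circ\Phi_g=\Phi_g\circ\mathcal Q$) whose induced map $\mathbf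 Q:S\to M$, $\pi\circ\mathcal Q=\mathbf Q\circ\pi$, is an embedding. $T_{\mathcal Q}Q_{KK}$ consists of equivariant vector fields $\mathcal V_{\mathcal Q}:P_S\to TP$ along $\mathcal Q$; $T^*_{\mathcal Q}Q_{KK}$ is identified with equivariant one-forms $\mathcal P_{\mathcal Q}:P_S\to T^*P$ along $\mathcal Q$, with pairing $\langle\mathcal P_{\mathcal Q},\mathcal V_{\mathcal Q}\rangle=\int_S(\mathcal P_{\mathcal Q}\cdot\mathcal V_{\mathcal Q})\,{\rm d}^ks$ (the contraction is $\mathcal O$-invariant, hence a function on $S$; integrals are assumed to converge). For $\mathcal P_{\mathcal Q}\in T^*_{\mathcal Q}Q_{KK}$: $\zeta=\mathbb J\circ\mathcal P_{\mathcal Q}:P_S\to\mathfrak o^*$, with $\mathbb J:T^*P\to\mathfrak o^*$, $\langle\mathbb J(\alpha_p),\xi\rangle=\langle\alpha_p,\xi_P(p)\rangle$; $\bar\zeta\in\Gamma(\operatorname{Ad}^*P_S)$ is the corresponding section $\bar\zeta(\pi(p_s))=[p_s,\zeta(p_s)]_{\mathcal O}$; and $\mathbf P^{\mathcal A}_{\mathbf Q}=(\operatorname{Hor}^{\mathcal A}_{\mathcal Q})^*\mathcal P_{\mathcal Q}$ is the one-form along $\mathbf Q$ given by $\mathbf P^{\mathcal A}_{\mathbf Q}(s)\cdot v=\mathcal P_{\mathcal Q}(p_s)\cdot\operatorname{Hor}^{\mathcal A}_{\mathcal Q(p_s)}(v)$, $v\in T_{\mathbf Q(s)}M$, $\pi(p_s)=s$,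 with $\operatorname{Hor}^{\mathcal A}$ the horizontal lift. The map $\widetilde{\mathcal Q}:\operatorname{Ad}^*P_S\to\operatorname{Ad}^*P$ is $[p_s,\mu]_{\mathcal O}\mapsto[\mathcal Q(p_s),\mu]_{\mathcal O}$. The momentum map of a cotangent-lifted action of a group with Lie algebra $\mathfrak g$ on a manifold $Q$ is $\langle\mathbf J(\alpha_q),\xi\rangle=\langle\alpha_q,\xi_Q(q)\rangle$, $\xi\in\mathfrak g$, $\xi_Q$ the infinitesimal generator. *)

theory Defs
  imports "HOL-Analysis.Analysis" "HOL-Algebra.Group"
begin

section \<open>Model spaces and smooth functions between them\<close>

text \<open>
  The model spaces of manifolds are finite-dimensional real vector spaces; the inner product only
  serves to provide the topology. Unlike the class \<open>euclidean_space\<close>, this class admits the zero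
  space, so that discrete structure groups and zero-dimensional submanifolds are included.
\<close>

class fin_dim = real_inner +
  assumes finite_dim: "\<exists>B. finite B \<and> (\<forall>x. \<exists>c. x = (\<Sum>b\<in>B. c b *\<^sub>R b))"

instance euclidean_space \<subseteq> fin_dim
proof
  have "x = (\<Sum>b\<in>Basis. (x \<bullet> b) *\<^sub>R b)" for x :: 'a
    by (simp add: euclidean_representation)
  then show "\<exists>B :: 'a set. finite B \<and> (\<forall>x. \<exists>c. x = (\<Sum>b\<in>B. c b *\<^sub>R b))"
    by (intro exI[of _ Basis]) (auto intro: exI[of _ "\<lambda>b. _ \<bullet> b"])
qed

lemma finite_spanning_set: "\<exists>B :: 'a::fin_dim set. finite B \<and> span B = UNIV"
proof -
  obtain B :: "'a set" where "finite B" and B: "\<And>x. \<exists>c. x = (\<Sum>b\<in>B. c b *\<^sub>R b)"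
    using finite_dim by metis
  then show ?thesis
    by (intro exI[of _ B]) (auto simp: span_finite image_def)
qed

instance prod :: (fin_dim, fin_dim) fin_dim
proof
  obtain B :: "'a set" where B: "finite B" "span B = UNIV"
    using finite_spanning_set by blast
  obtain C :: "'b set" where C: "finite C" "span C = UNIV"
    using finite_spanning_set by blast
  have "span (B \<times> {0} \<union> {0} \<times> C) = (UNIV :: ('a \<times> 'b) set)"
  proof -
    have "(x, 0) \<in> span (B \<times> {0} \<union> {0} \<times> C)" for x :: 'a
    proof -
      have "x \<in> span B" using B by simp
      then show ?thesis
      proof (induction rule: span_induct_alt)
        case base
        then show ?case using span_zero[of "B \<times> {0} \<union> {0} \<times> C"] by (simp add: zero_prod_def)
      next
        case (step c b y)
        from step(1) have "(b, 0) \<in> span (B \<times> {0} \<union> {0} \<times> C)"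
          by (intro span_base) auto
        with step have "c *\<^sub>R (b, 0) + (y, 0) \<in> span (B \<times> {0} \<union> {0} \<times> C)"
          by (intro span_add span_scale)
        then show ?case by simp
      qed
    qed
    moreover have "(0, x) \<in> span (B \<times> {0} \<union> {0} \<times> C)" for x :: 'b
    proof -
      have "x \<in> span C" using C by simp
      then show ?thesis
      proof (induction rule: span_induct_alt)
        case base
        then show ?case using span_zero[of "B \<times> {0} \<union> {0} \<times> C"] by (simp add: zero_prod_def)
      next
        case (step c b y)
        from step(1) have "(0, b) \<in> span (B \<times> {0} \<union> {0} \<times> C)"
          by (intro span_base) auto
        with step have "c *\<^sub>R (0, b) + (0, y) \<in> span (B \<times> {0} \<union> {0} \<times> C)"
          by (intro span_add span_scale)
        then show ?case by simp
      qed
    qed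
    ultimately have "(x, 0) + (0, y) \<in> span (B \<times> {0} \<union> {0} \<times> C)" for x :: 'a and y :: 'b
      by (intro span_add)
    then show ?thesis by auto
  qed
  moreover have "finite (B \<times> {0} \<union> {0} \<times> C)"
    using B C by simp
  ultimately show "\<exists>B :: ('a \<times> 'b) set. finite B \<and> (\<forall>x. \<exists>c. x = (\<Sum>b\<in>B. c b *\<^sub>R b))"
    by (intro exI[of _ "B \<times> {0} \<union> {0} \<times> C"]) (auto simp: span_finite image_def set_eq_iff)
qed

text \<open>On an open subset of a finite-dimensional space, \<open>C\<^sup>n\<close> amounts to the existence and continuity
  of all iterated directional derivatives of order at most \<open>n\<close>.\<close>

primrec Ck_on :: "nat \<Rightarrow> 'a set \<Rightarrow> ('a::fin_dim \<Rightarrow> 'b::real_normed_vector) \<Rightarrow> bool" where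
  "Ck_on 0 = (\<lambda>S f. continuous_on S f)"
| "Ck_on (Suc n) = (\<lambda>S f. (\<forall>x\<in>S. f differentiable (at x)) \<and>
      (\<forall>v. Ck_on n S (\<lambda>x. frechet_derivative f (at x) v)))"

definition smooth_on :: "'a set \<Rightarrow> ('a::fin_dim \<Rightarrow> 'b::real_normed_vector) \<Rightarrow> bool" where
  "smooth_on S f \<longleftrightarrow> (\<forall>n. Ck_on n S f)"

section \<open>Smooth manifolds\<close>

type_synonym ('a, 'e) chart = "'a set \<times> ('a \<Rightarrow> 'e)"

record ('a, 'e) mfd =
  Topo :: "'a topology"
  Atlas :: "('a, 'e) chart set"

definition points :: "('a, 'e) mfd \<Rightarrow> 'a set" where
  "points M = topspace (Topo M)"

definition chart_inv :: "('a, 'e) chart \<Rightarrow> 'e \<Rightarrow> 'a" where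
  "chart_inv c = inv_into (fst c) (snd c)"

definition smooth_manifold :: "('a, 'e::fin_dim) mfd \<Rightarrow> bool" where
  "smooth_manifold M \<longleftrightarrow>
     Hausdorff_space (Topo M) \<and> second_countable (Topo M) \<and>
     (\<forall>(D, \<phi>)\<in>Atlas M. openin (Topo M) D \<and> open (\<phi> ` D) \<and>
        homeomorphic_map (subtopology (Topo M) D) (top_of_set (\<phi> ` D)) \<phi>) \<and>
     (\<Union>c\<in>Atlas M. fst c) = points M \<and>
     (\<forall>(D, \<phi>)\<in>Atlas M. \<forall>(E, \<psi>)\<in>Atlas M. smooth_on (\<phi> ` (D \<inter> E)) (\<psi> \<circ> chart_inv (D, \<phi>)))"

definition open_submfd :: "('a, 'e) mfd \<Rightarrow> 'a set \<Rightarrow> ('a, 'e) mfd" where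
  "open_submfd M V = \<lparr>Topo = subtopology (Topo M) V, Atlas = (\<lambda>(D, \<phi>). (D \<inter> V, \<phi>)) ` Atlas M\<rparr>"

definition prod_mfd :: "('a, 'e) mfd \<Rightarrow> ('b, 'f) mfd \<Rightarrow> ('a \<times> 'b, 'e \<times> 'f) mfd" where
  "prod_mfd M N = \<lparr>Topo = prod_topology (Topo M) (Topo N),
     Atlas = {(D \<times> E, map_prod \<phi> \<psi>) | D \<phi> E \<psi>. (D, \<phi>) \<in> Atlas M \<and> (E, \<psi>) \<in> Atlas N}\<rparr>"

definition vector_space_mfd :: "('e::fin_dim, 'e) mfd" where
  "vector_space_mfd = \<lparr>Topo = euclidean, Atlas = {(UNIV, \<lambda>x. x)}\<rparr>"

definition smooth_map :: "('a, 'e::fin_dim) mfd \<Rightarrow> ('b, 'f::fin_dim) mfd \<Rightarrow> ('a \<Rightarrow> 'b) \<Rightarrow> bool" where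
  "smooth_map M N f \<longleftrightarrow> continuous_map (Topo M) (Topo N) f \<and>
     (\<forall>(D, \<phi>)\<in>Atlas M. \<forall>(E, \<psi>)\<in>Atlas N.
        smooth_on (\<phi> ` (D \<inter> f -` E)) (\<psi> \<circ> f \<circ> chart_inv (D, \<phi>)))"

definition diffeo :: "('a, 'e::fin_dim) mfd \<Rightarrow> ('b, 'f::fin_dim) mfd \<Rightarrow> ('a \<Rightarrow> 'b) \<Rightarrow> bool" where
  "diffeo M N f \<longleftrightarrow> bij_betw f (points M) (points N) \<and>
     smooth_map M N f \<and> smooth_map N M (inv_into (points M) f)"

section \<open>Tangent vectors\<close>

text \<open>
  A chart is chosen at every point \<open>p\<close>, and the tangent space at \<open>p\<close> is identified with the model
  space by means of this chart. The maps \<open>to_chart M c p\<close> and \<open>from_chart M c p\<close> convert between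
  this representation and the components of a tangent vector with respect to another chart \<open>c\<close>.
\<close>

definition chart_at :: "('a, 'e) mfd \<Rightarrow> 'a \<Rightarrow> ('a, 'e) chart" where
  "chart_at M p = (SOME c. c \<in> Atlas M \<and> p \<in> fst c)"

definition coord :: "('a, 'e) mfd \<Rightarrow> 'a \<Rightarrow> 'a \<Rightarrow> 'e" where
  "coord M p = snd (chart_at M p)"

definition param :: "('a, 'e) mfd \<Rightarrow> 'a \<Rightarrow> 'e \<Rightarrow> 'a" where
  "param M p = chart_inv (chart_at M p)"

definition tangent_map ::
  "('a, 'e::fin_dim) mfd \<Rightarrow> ('b, 'f::fin_dim) mfd \<Rightarrow> ('a \<Rightarrow> 'b) \<Rightarrow> 'a \<Rightarrow> 'e \<Rightarrow> 'f" where
  "tangent_map M N f p = frechet_derivative (coord N (f p) \<circ> f \<circ> param M p) (at (coord M p p))"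

definition velocity :: "('a, 'e::fin_dim) mfd \<Rightarrow> (real \<Rightarrow> 'a) \<Rightarrow> real \<Rightarrow> 'e" where
  "velocity M c t = vector_derivative (coord M (c t) \<circ> c) (at t)"

definition to_chart :: "('a, 'e::fin_dim) mfd \<Rightarrow> ('a, 'e) chart \<Rightarrow> 'a \<Rightarrow> 'e \<Rightarrow> 'e" where
  "to_chart M c p = frechet_derivative (snd c \<circ> param M p) (at (coord M p p))"

definition from_chart :: "('a, 'e::fin_dim) mfd \<Rightarrow> ('a, 'e) chart \<Rightarrow> 'a \<Rightarrow> 'e \<Rightarrow> 'e" where
  "from_chart M c p = frechet_derivative (coord M p \<circ> chart_inv c) (at (snd c p))"

definition smooth_field_along ::
  "('a, 'e::fin_dim) mfd \<Rightarrow> ('b, 'f::fin_dim) mfd \<Rightarrow> ('a \<Rightarrow> 'b) \<Rightarrow> ('a \<Rightarrow> 'f) \<Rightarrow> bool" where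
  "smooth_field_along N M f V \<longleftrightarrow>
     (\<forall>(D, \<phi>)\<in>Atlas N. \<forall>(E, \<psi>)\<in>Atlas M.
        smooth_on (\<phi> ` (D \<inter> f -` E))
          (\<lambda>x. let q = chart_inv (D, \<phi>) x in to_chart M (E, \<psi>) (f q) (V q)))"

definition smooth_form_along ::
  "('a, 'e::fin_dim) mfd \<Rightarrow> ('b, 'f::fin_dim) mfd \<Rightarrow> ('a \<Rightarrow> 'b) \<Rightarrow>
   ('a \<Rightarrow> 'f \<Rightarrow> 'w::real_normed_vector) \<Rightarrow> bool" where
  "smooth_form_along N M f \<alpha> \<longleftrightarrow> (\<forall>q\<in>points N. linear (\<alpha> q)) \<and>
     (\<forall>(D, \<phi>)\<in>Atlas N. \<forall>(E, \<psi>)\<in>Atlas M. \<forall>v.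
        smooth_on (\<phi> ` (D \<inter> f -` E))
          (\<lambda>x. let q = chart_inv (D, \<phi>) x in \<alpha> q (from_chart M (E, \<psi>) (f q) v)))"

definition vector_fields :: "('a, 'e::fin_dim) mfd \<Rightarrow> ('a \<Rightarrow> 'e) set" where
  "vector_fields M = {u \<in> extensional (points M). smooth_field_along M M (\<lambda>x. x) u}"

definition embedding ::
  "('a, 'e::fin_dim) mfd \<Rightarrow> ('b, 'f::fin_dim) mfd \<Rightarrow> ('a \<Rightarrow> 'b) \<Rightarrow> bool" where
  "embedding N M f \<longleftrightarrow> smooth_map N M f \<and> embedding_map (Topo N) (Topo M) f \<and>
     (\<forall>x\<in>points N. inj (tangent_map N M f x))"

definition submanifold :: "('a, 'e::fin_dim) mfd \<Rightarrow> ('a, 'f::fin_dim) mfd \<Rightarrow> bool" where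
  "submanifold S M \<longleftrightarrow> smooth_manifold S \<and> points S \<subseteq> points M \<and> embedding S M (\<lambda>x. x)"

section \<open>Volume forms and the integral against a volume form\<close>

definition alternating_form :: "nat \<Rightarrow> ('e::real_vector list \<Rightarrow> real) \<Rightarrow> bool" where
  "alternating_form k \<omega> \<longleftrightarrow>
     (\<forall>vs. length vs = k \<longrightarrow> (\<forall>i<k. linear (\<lambda>v. \<omega> (vs[i := v])))) \<and>
     (\<forall>vs. length vs = k \<longrightarrow> \<not> distinct vs \<longrightarrow> \<omega> vs = 0)"

definition volume_form :: "('a, 'e::fin_dim) mfd \<Rightarrow> ('a \<Rightarrow> 'e list \<Rightarrow> real) \<Rightarrow> bool" where
  "volume_form S vol \<longleftrightarrow>
     (let k = dim (UNIV :: 'e set) in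
       (\<forall>s\<in>points S. alternating_form k (vol s) \<and> (\<exists>vs. length vs = k \<and> vol s vs \<noteq> 0)) \<and>
       (\<forall>c\<in>Atlas S. \<forall>vs. length vs = k \<longrightarrow>
          smooth_on (snd c ` fst c)
            (\<lambda>x. let s = chart_inv c x in vol s (map (from_chart S c s) vs))))"

text \<open>
  A volume form orients the manifold, and with respect to this orientation the integral of
  \<open>f vol\<close> is the integral of \<open>f\<close> against the Borel measure that in each chart has density
  \<open>\<bar>vol(\<partial>\<^sub>1, \<dots>, \<partial>\<^sub>k)\<bar>\<close> with respect to \<open>dx\<^sub>1 \<dots> dx\<^sub>k\<close>. The coordinates \<open>x\<^sub>i\<close> refer to an arbitrary
  basis of the model space, used both for the density and for \<open>dx\<^sub>1 \<dots> dx\<^sub>k\<close>.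
\<close>

definition model_basis :: "'e::fin_dim list" where
  "model_basis = (SOME bs. distinct bs \<and> independent (set bs) \<and> span (set bs) = UNIV)"

definition model_lebesgue :: "'e::fin_dim measure" where
  "model_lebesgue = distr (\<Pi>\<^sub>M i\<in>{..<length (model_basis :: 'e list)}. lborel) borel
     (\<lambda>x. \<Sum>i<length (model_basis :: 'e list). x i *\<^sub>R model_basis ! i)"

definition chart_density ::
  "('a, 'e::fin_dim) mfd \<Rightarrow> ('a \<Rightarrow> 'e list \<Rightarrow> real) \<Rightarrow> ('a, 'e) chart \<Rightarrow> 'e \<Rightarrow> real" where
  "chart_density S vol c x =
     (let s = chart_inv c x in \<bar>vol s (map (from_chart S c s) model_basis)\<bar>)"

definition volume_measure ::
  "('a, 'e::fin_dim) mfd \<Rightarrow> ('a \<Rightarrow> 'e list \<Rightarrow> real) \<Rightarrow> 'a measure" where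
  "volume_measure S vol = (THE \<nu>. space \<nu> = points S \<and>
     sets \<nu> = sigma_sets (points S) {U. openin (Topo S) U} \<and>
     (\<forall>c\<in>Atlas S. \<forall>B\<in>sets \<nu>. B \<subseteq> fst c \<longrightarrow>
        emeasure \<nu> B = (\<integral>\<^sup>+x\<in>snd c ` B. ennreal (chart_density S vol c x) \<partial>model_lebesgue)))"

section \<open>Lie groups and principal bundles\<close>

record ('g, 'o) lie_group = "'g monoid" +
  group_mfd :: "('g, 'o) mfd"

text \<open>The Lie algebra of \<open>G\<close>, as a vector space, is the tangent space at \<open>\<one>\<close>, that is, the model
  space \<open>'o\<close>.\<close>

definition lie_group :: "('g, 'o::fin_dim) lie_group \<Rightarrow> bool" where
  "lie_group G \<longleftrightarrow> group G \<and> smooth_manifold (group_mfd G) \<and> carrier G = points (group_mfd G) \<and>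
     smooth_map (prod_mfd (group_mfd G) (group_mfd G)) (group_mfd G) (\<lambda>(g, h). g \<otimes>\<^bsub>G\<^esub> h) \<and>
     smooth_map (group_mfd G) (group_mfd G) (\<lambda>g. inv\<^bsub>G\<^esub> g)"

definition Ad :: "('g, 'o::fin_dim) lie_group \<Rightarrow> 'g \<Rightarrow> 'o \<Rightarrow> 'o" where
  "Ad G g = tangent_map (group_mfd G) (group_mfd G) (\<lambda>h. g \<otimes>\<^bsub>G\<^esub> h \<otimes>\<^bsub>G\<^esub> inv\<^bsub>G\<^esub> g) \<one>\<^bsub>G\<^esub>"

record ('p, 'ep, 'm, 'em, 'g) fibre_bundle =
  total_space :: "('p, 'ep) mfd"
  base_space :: "('m, 'em) mfd"
  proj :: "'p \<Rightarrow> 'm"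
  act :: "'g \<Rightarrow> 'p \<Rightarrow> 'p"

definition local_trivialization ::
  "('g, 'o::fin_dim) lie_group \<Rightarrow> ('p, 'ep::fin_dim, 'm, 'em::fin_dim, 'g) fibre_bundle \<Rightarrow>
   'm set \<Rightarrow> ('p \<Rightarrow> 'g) \<Rightarrow> bool" where
  "local_trivialization G P V \<tau> \<longleftrightarrow> openin (Topo (base_space P)) V \<and>
     diffeo (open_submfd (total_space P) {p \<in> points (total_space P). proj P p \<in> V})
            (prod_mfd (open_submfd (base_space P) V) (group_mfd G)) (\<lambda>p. (proj P p, \<tau> p)) \<and>
     (\<forall>p\<in>points (total_space P). proj P p \<in> V \<longrightarrow>
        (\<forall>g\<in>carrier G. \<tau> (act P g p) = \<tau> p \<otimes>\<^bsub>G\<^esub> g))"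

definition principal_bundle ::
  "('g, 'o::fin_dim) lie_group \<Rightarrow> ('p, 'ep::fin_dim, 'm, 'em::fin_dim, 'g) fibre_bundle \<Rightarrow> bool" where
  "principal_bundle G P \<longleftrightarrow>
     lie_group G \<and> smooth_manifold (total_space P) \<and> smooth_manifold (base_space P) \<and>
     smooth_map (total_space P) (base_space P) (proj P) \<and>
     smooth_map (prod_mfd (total_space P) (group_mfd G)) (total_space P) (\<lambda>(p, g). act P g p) \<and>
     (\<forall>p\<in>points (total_space P). act P \<one>\<^bsub>G\<^esub> p = p \<and>
        (\<forall>g\<in>carrier G. proj P (act P g p) = proj P p \<and>
           (\<forall>h\<in>carrier G. act P (g \<otimes>\<^bsub>G\<^esub> h) p = act P h (act P g p)))) \<and>
     (\<forall>x\<in>points (base_space P). \<exists>V \<tau>. x \<in> V \<and> local_trivialization G P V \<tau>)"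

definition T_act ::
  "('p, 'ep::fin_dim, 'm, 'em, 'g) fibre_bundle \<Rightarrow> 'g \<Rightarrow> 'p \<Rightarrow> 'ep \<Rightarrow> 'ep" where
  "T_act P g = tangent_map (total_space P) (total_space P) (act P g)"

definition T_proj ::
  "('p, 'ep::fin_dim, 'm, 'em::fin_dim, 'g) fibre_bundle \<Rightarrow> 'p \<Rightarrow> 'ep \<Rightarrow> 'em" where
  "T_proj P = tangent_map (total_space P) (base_space P) (proj P)"

definition generator ::
  "('g, 'o::fin_dim) lie_group \<Rightarrow> ('p, 'ep::fin_dim, 'm, 'em, 'g) fibre_bundle \<Rightarrow> 'o \<Rightarrow> 'p \<Rightarrow> 'ep" where
  "generator G P \<xi> p = tangent_map (group_mfd G) (total_space P) (\<lambda>g. act P g p) \<one>\<^bsub>G\<^esub> \<xi>"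

definition principal_connection ::
  "('g, 'o::fin_dim) lie_group \<Rightarrow> ('p, 'ep::fin_dim, 'm, 'em, 'g) fibre_bundle \<Rightarrow>
   ('p \<Rightarrow> 'ep \<Rightarrow> 'o) \<Rightarrow> bool" where
  "principal_connection G P A \<longleftrightarrow> smooth_form_along (total_space P) (total_space P) (\<lambda>p. p) A \<and>
     (\<forall>p\<in>points (total_space P).
        (\<forall>g\<in>carrier G. \<forall>v. A (act P g p) (T_act P g p v) = Ad G (inv\<^bsub>G\<^esub> g) (A p v)) \<and>
        (\<forall>\<xi>. A p (generator G P \<xi> p) = \<xi>))"

definition Hor ::
  "('p, 'ep::fin_dim, 'm, 'em::fin_dim, 'g) fibre_bundle \<Rightarrow> ('p \<Rightarrow> 'ep \<Rightarrow> 'o::fin_dim) \<Rightarrow>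
   'p \<Rightarrow> 'em \<Rightarrow> 'ep" where
  "Hor P A p v = (THE w. A p w = 0 \<and> T_proj P p w = v)"

section \<open>The adjoint and coadjoint bundles\<close>

definition Ad_class ::
  "('g, 'o::fin_dim) lie_group \<Rightarrow> ('p, 'ep, 'm, 'em, 'g) fibre_bundle \<Rightarrow> 'p \<Rightarrow> 'o \<Rightarrow> ('p \<times> 'o) set" where
  "Ad_class G P p \<xi> = {(act P g p, Ad G (inv\<^bsub>G\<^esub> g) \<xi>) | g. g \<in> carrier G}"

definition coAd_class ::
  "('g, 'o::fin_dim) lie_group \<Rightarrow> ('p, 'ep, 'm, 'em, 'g) fibre_bundle \<Rightarrow> 'p \<Rightarrow> ('o \<Rightarrow> real) \<Rightarrow>
   ('p \<times> ('o \<Rightarrow> real)) set" where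
  "coAd_class G P p \<mu> = {(act P g p, \<lambda>\<xi>. \<mu> (Ad G g \<xi>)) | g. g \<in> carrier G}"

definition fibre_pairing :: "('p \<times> ('o \<Rightarrow> real)) set \<Rightarrow> ('p \<times> 'o) set \<Rightarrow> real" where
  "fibre_pairing a b = (THE r. \<exists>p \<mu> \<xi>. (p, \<mu>) \<in> a \<and> (p, \<xi>) \<in> b \<and> r = \<mu> \<xi>)"

text \<open>Smoothness of a section of \<open>Ad P = (P \<times> 'o) / G\<close> refers to the quotient structure: the
  projection \<open>P \<times> 'o \<rightarrow> Ad P\<close> is a surjective submersion, so a section is smooth iff it locally
  lifts to a smooth map into \<open>P \<times> 'o\<close>.\<close>

definition Ad_sections ::
  "('g, 'o::fin_dim) lie_group \<Rightarrow> ('p, 'ep::fin_dim, 'm, 'em::fin_dim, 'g) fibre_bundle \<Rightarrow>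
   ('m \<Rightarrow> ('p \<times> 'o) set) set" where
  "Ad_sections G P = {\<sigma> \<in> extensional (points (base_space P)). \<forall>x\<in>points (base_space P).
     \<exists>V f \<eta>. openin (Topo (base_space P)) V \<and> x \<in> V \<and>
       smooth_map (open_submfd (base_space P) V) (total_space P) f \<and>
       smooth_map (open_submfd (base_space P) V) vector_space_mfd \<eta> \<and>
       (\<forall>y\<in>V. proj P (f y) = y \<and> \<sigma> y = Ad_class G P (f y) (\<eta> y))}"

text \<open>Linear functionals on spaces of vector fields and of sections of the adjoint bundle. A class
  in the fibre of \<open>Ad P\<close> over \<open>x\<close> is the graph of an equivariant function on the fibre of \<open>P\<close> over
  \<open>x\<close>; the linear operations of \<open>Ad P\<close> are the pointwise ones on these functions.\<close>

definition vector_field_dual :: "('a, 'e::fin_dim) mfd \<Rightarrow> (('a \<Rightarrow> 'e) \<Rightarrow> real) set" where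
  "vector_field_dual M = {l. \<forall>u\<in>vector_fields M. \<forall>v\<in>vector_fields M. \<forall>a b.
     l (\<lambda>x\<in>points M. a *\<^sub>R u x + b *\<^sub>R v x) = a * l u + b * l v}"

definition fibre_combination ::
  "real \<Rightarrow> ('p \<times> 'o) set \<Rightarrow> real \<Rightarrow> ('p \<times> 'o::real_vector) set \<Rightarrow> ('p \<times> 'o) set" where
  "fibre_combination a X b Y = {(p, a *\<^sub>R \<xi> + b *\<^sub>R \<eta>) | p \<xi> \<eta>. (p, \<xi>) \<in> X \<and> (p, \<eta>) \<in> Y}"

definition Ad_section_dual ::
  "('g, 'o::fin_dim) lie_group \<Rightarrow> ('p, 'ep::fin_dim, 'm, 'em::fin_dim, 'g) fibre_bundle \<Rightarrow>
   (('m \<Rightarrow> ('p \<times> 'o) set) \<Rightarrow> real) set" where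
  "Ad_section_dual G P = {l. \<forall>\<sigma>\<in>Ad_sections G P. \<forall>\<tau>\<in>Ad_sections G P. \<forall>a b.
     l (\<lambda>x\<in>points (base_space P). fibre_combination a (\<sigma> x) b (\<tau> x)) = a * l \<sigma> + b * l \<tau>}"

section \<open>Equivariant vector fields\<close>

definition aut ::
  "('g, 'o) lie_group \<Rightarrow> ('p, 'ep::fin_dim, 'm, 'em, 'g) fibre_bundle \<Rightarrow> ('p \<Rightarrow> 'ep) set" where
  "aut G P = {U \<in> vector_fields (total_space P).
     \<forall>p\<in>points (total_space P). \<forall>g\<in>carrier G. U (act P g p) = T_act P g p (U p)}"

definition aut_iso ::
  "('g, 'o::fin_dim) lie_group \<Rightarrow> ('p, 'ep::fin_dim, 'm, 'em::fin_dim, 'g) fibre_bundle \<Rightarrow>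
   ('p \<Rightarrow> 'ep \<Rightarrow> 'o) \<Rightarrow> ('p \<Rightarrow> 'ep) \<Rightarrow> ('m \<Rightarrow> 'em) \<times> ('m \<Rightarrow> ('p \<times> 'o) set)" where
  "aut_iso G P A U =
     ((\<lambda>x\<in>points (base_space P). THE v. \<exists>p\<in>points (total_space P). proj P p = x \<and> v = T_proj P p (U p)),
      (\<lambda>x\<in>points (base_space P). THE c. \<exists>p\<in>points (total_space P). proj P p = x \<and>
         c = Ad_class G P p (A p (U p))))"

text \<open>In the group of equivariant diffeomorphisms of \<open>P\<close>, which enters only through its
  infinitesimal generators, \<open>exp (t U)\<close> is the flow of \<open>U\<close>. For an incomplete \<open>U\<close> the flow is only
  locally defined (and \<open>flow M U t p\<close> unspecified where it is not), but for each fixed \<open>p\<close> it is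
  defined for all \<open>t\<close> near \<open>0\<close>, which suffices for infinitesimal generators.\<close>

definition integral_curve ::
  "('a, 'e::fin_dim) mfd \<Rightarrow> ('a \<Rightarrow> 'e) \<Rightarrow> real set \<Rightarrow> (real \<Rightarrow> 'a) \<Rightarrow> bool" where
  "integral_curve M U I c \<longleftrightarrow> continuous_map (top_of_set I) (Topo M) c \<and>
     (\<forall>t\<in>I. ((coord M (c t) \<circ> c) has_vector_derivative U (c t)) (at t))"

definition flow :: "('a, 'e::fin_dim) mfd \<Rightarrow> ('a \<Rightarrow> 'e) \<Rightarrow> real \<Rightarrow> 'a \<Rightarrow> 'a" where
  "flow M U t p = (THE q. \<exists>I c. open I \<and> connected I \<and> 0 \<in> I \<and> t \<in> I \<and>
     integral_curve M U I c \<and> c 0 = p \<and> c t = q)"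

section \<open>The space of equivariant maps and its cotangent bundle\<close>

definition induced_map ::
  "('p, 'ep, 'm, 'em, 'g) fibre_bundle \<Rightarrow> ('q, 'eq, 's, 'es, 'g) fibre_bundle \<Rightarrow> ('q \<Rightarrow> 'p) \<Rightarrow> 's \<Rightarrow> 'm" where
  "induced_map P PS Q = (\<lambda>s\<in>points (base_space PS).
     THE x. \<exists>q\<in>points (total_space PS). proj PS q = s \<and> x = proj P (Q q))"

definition QKK ::
  "('g, 'o) lie_group \<Rightarrow> ('p, 'ep::fin_dim, 'm, 'em::fin_dim, 'g) fibre_bundle \<Rightarrow>
   ('q, 'eq::fin_dim, 's, 'es::fin_dim, 'g) fibre_bundle \<Rightarrow> ('q \<Rightarrow> 'p) set" where
  "QKK G P PS = {Q \<in> extensional (points (total_space PS)). smooth_map (total_space PS) (total_space P) Q \<and>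
     (\<forall>q\<in>points (total_space PS). \<forall>g\<in>carrier G. Q (act PS g q) = act P g (Q q)) \<and>
     embedding (base_space PS) (base_space P) (induced_map P PS Q)}"

definition T_QKK ::
  "('g, 'o) lie_group \<Rightarrow> ('p, 'ep::fin_dim, 'm, 'em, 'g) fibre_bundle \<Rightarrow>
   ('q, 'eq::fin_dim, 's, 'es, 'g) fibre_bundle \<Rightarrow> ('q \<Rightarrow> 'p) \<Rightarrow> ('q \<Rightarrow> 'ep) set" where
  "T_QKK G P PS Q = {V \<in> extensional (points (total_space PS)).
     smooth_field_along (total_space PS) (total_space P) Q V \<and>
     (\<forall>q\<in>points (total_space PS). \<forall>g\<in>carrier G. V (act PS g q) = T_act P g (Q q) (V q))}"

definition contraction ::
  "('q, 'eq, 's, 'es, 'g) fibre_bundle \<Rightarrow> ('q \<Rightarrow> 'ep \<Rightarrow> real) \<Rightarrow> ('q \<Rightarrow> 'ep) \<Rightarrow> 's \<Rightarrow> real" where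
  "contraction PS \<alpha> V s = (THE r. \<exists>q\<in>points (total_space PS). proj PS q = s \<and> r = \<alpha> q (V q))"

definition KK_pairing ::
  "('q, 'eq, 's, 'es::fin_dim, 'g) fibre_bundle \<Rightarrow> ('s \<Rightarrow> 'es list \<Rightarrow> real) \<Rightarrow>
   ('q \<Rightarrow> 'ep \<Rightarrow> real) \<Rightarrow> ('q \<Rightarrow> 'ep) \<Rightarrow> real" where
  "KK_pairing PS vol \<alpha> V = (\<integral>s. contraction PS \<alpha> V s \<partial>volume_measure (base_space PS) vol)"

text \<open>The convergence of the integrals that define the pairing with tangent vectors is part of the
  definition of a cotangent vector.\<close>

definition cT_QKK ::
  "('g, 'o) lie_group \<Rightarrow> ('p, 'ep::fin_dim, 'm, 'em, 'g) fibre_bundle \<Rightarrow>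
   ('q, 'eq::fin_dim, 's, 'es::fin_dim, 'g) fibre_bundle \<Rightarrow> ('s \<Rightarrow> 'es list \<Rightarrow> real) \<Rightarrow>
   ('q \<Rightarrow> 'p) \<Rightarrow> ('q \<Rightarrow> 'ep \<Rightarrow> real) set" where
  "cT_QKK G P PS vol Q = {\<alpha> \<in> extensional (points (total_space PS)).
     smooth_form_along (total_space PS) (total_space P) Q \<alpha> \<and>
     (\<forall>q\<in>points (total_space PS). \<forall>g\<in>carrier G. \<forall>v. \<alpha> (act PS g q) (T_act P g (Q q) v) = \<alpha> q v) \<and>
     (\<forall>V\<in>T_QKK G P PS Q. integrable (volume_measure (base_space PS) vol) (contraction PS \<alpha> V))}"

section \<open>Momentum maps\<close>

text \<open>The momentum map of a cotangent-lifted action: \<open>pair\<close> is the pairing of covectors with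
  vectors and \<open>gen \<xi> q\<close> the infinitesimal generator of \<open>\<xi>\<close> at \<open>q\<close>.\<close>

definition momentum_map ::
  "('a \<Rightarrow> 'v \<Rightarrow> real) \<Rightarrow> ('x \<Rightarrow> 'q \<Rightarrow> 'v) \<Rightarrow> 'q \<Rightarrow> 'a \<Rightarrow> 'x \<Rightarrow> real" where
  "momentum_map pair gen q \<alpha> \<xi> = pair \<alpha> (gen \<xi> q)"

definition left_action ::
  "('q, 'eq, 's, 'es, 'g) fibre_bundle \<Rightarrow> ('p \<Rightarrow> 'p) \<Rightarrow> ('q \<Rightarrow> 'p) \<Rightarrow> 'q \<Rightarrow> 'p" where
  "left_action PS \<phi> Q = compose (points (total_space PS)) \<phi> Q"

definition aut_generator ::
  "('p, 'ep::fin_dim, 'm, 'em, 'g) fibre_bundle \<Rightarrow> ('q, 'eq, 's, 'es, 'g) fibre_bundle \<Rightarrow>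
   ('p \<Rightarrow> 'ep) \<Rightarrow> ('q \<Rightarrow> 'p) \<Rightarrow> 'q \<Rightarrow> 'ep" where
  "aut_generator P PS U Q = (\<lambda>q\<in>points (total_space PS).
     velocity (total_space P) (\<lambda>t. left_action PS (flow (total_space P) U t) Q q) 0)"

definition J_L ::
  "('p, 'ep::fin_dim, 'm, 'em, 'g) fibre_bundle \<Rightarrow> ('q, 'eq, 's, 'es::fin_dim, 'g) fibre_bundle \<Rightarrow>
   ('s \<Rightarrow> 'es list \<Rightarrow> real) \<Rightarrow> ('q \<Rightarrow> 'p) \<Rightarrow> ('q \<Rightarrow> 'ep \<Rightarrow> real) \<Rightarrow> ('p \<Rightarrow> 'ep) \<Rightarrow> real" where
  "J_L P PS vol = momentum_map (KK_pairing PS vol) (aut_generator P PS)"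

definition J_L_split ::
  "('g, 'o::fin_dim) lie_group \<Rightarrow> ('p, 'ep::fin_dim, 'm, 'em::fin_dim, 'g) fibre_bundle \<Rightarrow>
   ('q, 'eq, 's, 'es::fin_dim, 'g) fibre_bundle \<Rightarrow> ('s \<Rightarrow> 'es list \<Rightarrow> real) \<Rightarrow> ('p \<Rightarrow> 'ep \<Rightarrow> 'o) \<Rightarrow>
   ('q \<Rightarrow> 'p) \<Rightarrow> ('q \<Rightarrow> 'ep \<Rightarrow> real) \<Rightarrow> ('m \<Rightarrow> 'em) \<times> ('m \<Rightarrow> ('p \<times> 'o) set) \<Rightarrow> real" where
  "J_L_split G P PS vol A Q \<alpha> u\<sigma> =
     J_L P PS vol Q \<alpha> (inv_into (aut G P) (aut_iso G P A) u\<sigma>)"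

definition zeta ::
  "('g, 'o::fin_dim) lie_group \<Rightarrow> ('p, 'ep::fin_dim, 'm, 'em, 'g) fibre_bundle \<Rightarrow>
   ('q \<Rightarrow> 'p) \<Rightarrow> ('q \<Rightarrow> 'ep \<Rightarrow> real) \<Rightarrow> 'q \<Rightarrow> 'o \<Rightarrow> real" where
  "zeta G P Q \<alpha> q = momentum_map (\<lambda>\<beta> v. \<beta> v) (generator G P) (Q q) (\<alpha> q)"

definition zeta_bar ::
  "('g, 'o::fin_dim) lie_group \<Rightarrow> ('p, 'ep::fin_dim, 'm, 'em, 'g) fibre_bundle \<Rightarrow>
   ('q, 'eq, 's, 'es, 'g) fibre_bundle \<Rightarrow> ('q \<Rightarrow> 'p) \<Rightarrow> ('q \<Rightarrow> 'ep \<Rightarrow> real) \<Rightarrow>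
   's \<Rightarrow> ('q \<times> ('o \<Rightarrow> real)) set" where
  "zeta_bar G P PS Q \<alpha> s =
     (THE c. \<exists>q\<in>points (total_space PS). proj PS q = s \<and> c = coAd_class G PS q (zeta G P Q \<alpha> q))"

definition coAd_map ::
  "('g, 'o::fin_dim) lie_group \<Rightarrow> ('p, 'ep, 'm, 'em, 'g) fibre_bundle \<Rightarrow> ('q \<Rightarrow> 'p) \<Rightarrow>
   ('q \<times> ('o \<Rightarrow> real)) set \<Rightarrow> ('p \<times> ('o \<Rightarrow> real)) set" where
  "coAd_map G P Q a = (THE b. \<exists>(q, \<mu>)\<in>a. b = coAd_class G P (Q q) \<mu>)"

definition horizontal_momentum ::
  "('p, 'ep::fin_dim, 'm, 'em::fin_dim, 'g) fibre_bundle \<Rightarrow> ('q, 'eq, 's, 'es, 'g) fibre_bundle \<Rightarrow>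
   ('p \<Rightarrow> 'ep \<Rightarrow> 'o::fin_dim) \<Rightarrow> ('q \<Rightarrow> 'p) \<Rightarrow> ('q \<Rightarrow> 'ep \<Rightarrow> real) \<Rightarrow> 's \<Rightarrow> 'em \<Rightarrow> real" where
  "horizontal_momentum P PS A Q \<alpha> s v =
     (THE r. \<exists>q\<in>points (total_space PS). proj PS q = s \<and> r = \<alpha> q (Hor P A (Q q) v))"

text \<open>The distribution \<open>\<integral>\<^sub>S F(s) \<delta>(x - f(s)) d\<nu>(s)\<close>, paired with a field \<open>w\<close>.\<close>

definition delta_integral ::
  "('b \<Rightarrow> 'c \<Rightarrow> real) \<Rightarrow> 's measure \<Rightarrow> ('s \<Rightarrow> 'm) \<Rightarrow> ('s \<Rightarrow> 'b) \<Rightarrow> ('m \<Rightarrow> 'c) \<Rightarrow> real" where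
  "delta_integral pair \<nu> f F w = (\<integral>s. pair (F s) (w (f s)) \<partial>\<nu>)"

end

theory Submission
  imports Defs
begin

text \<open>
  The connection splits a tangent vector of \<open>P\<close> uniquely into a horizontal lift and an infinitesimal
  generator. At the point \<open>\<Q>(p\<^sub>s)\<close>, the generator of the left action of \<open>U \<in> aut(P)\<close> on \<open>Q\<^sub>K\<^sub>K\<close> is
  \<open>U(\<Q>(p\<^sub>s))\<close>, by local existence and uniqueness of integral curves. Contracting its two parts with
  \<open>\<P>\<close> gives \<open>P\<^sup>A(s) \<cdot> u(Q(s))\<close> and \<open>\<zeta>(p\<^sub>s) \<cdot> \<omega>(\<Q>(p\<^sub>s))\<close>, and integration over \<open>S\<close> gives the formula.
  That every pair \<open>(u, \<sigma>)\<close> comes from some \<open>U\<close> rests on the smoothness of the horizontal lift of \<open>u\<close>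
  and of the vertical field of \<open>\<sigma>\<close>: over a local section \<open>f\<close> of \<open>P\<close> they are given by explicit formulas,
  and equivariance transports them along the fibres. The functionals are evaluated with a measure
  defined by a definite description, which is only meaningful because the densities of the volume
  form in overlapping charts agree by the change of variables formula.
\<close>

section \<open>Calculus on finite-dimensional real vector spaces, the zero space included\<close>

section \<open>Finite-dimensional spaces\<close>

text \<open>The definition of a cotangent vector grants convergence only for the contraction with a
  whole tangent vector, whereas the formula consists of two integrals, each of which has to converge
  alone. Since every pair \<open>(u, \<sigma>)\<close> is realised by a field in
  \<open>aut G P\<close>, the pair of \<open>u\<close> and the zero section isolates the horizontal
  integral, and the vertical one is then a difference of integrable functions.

  The representation of tangent vectors shapes the calculus. A vector at p is given by its
  components in a chart chosen at p without any continuity, so the components of a smooth field may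
  jump with p. Smoothness can only be tested after conversion to a fixed chart, and the chain rule,
  the product rule and the equation of integral curves are proved as identities between components
  in arbitrary charts.

  Objects on the base are definite descriptions over a fibre. They have the expected values because
  the structure group acts transitively on fibres, which, like freeness, is extracted from local
  trivializations.\<close>

lemma finite_orthonormal_basis:
  "\<exists>B :: 'a::fin_dim set. finite B \<and> (\<forall>x. x = (\<Sum>b\<in>B. (x \<bullet> b) *\<^sub>R b))"
proof -
  obtain B0 :: "'a set" where B0: "finite B0" "span B0 = UNIV"
    using finite_spanning_set by blast
  obtain C where C: "finite C" "span C = (UNIV :: 'a set)" "pairwise orthogonal C"
    using basis_orthogonal[OF B0(1)] B0(2) by auto
  \<comment> \<open>\<open>C\<close> may contain 0, which cannot be normalised; in the zero space
    nothing remains and the expansion is the empty sum.\<close>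
  define B where "B = (\<lambda>c. c /\<^sub>R norm c) ` (C - {0})"
  have B: "finite B" using C by (simp add: B_def)
  have orth: "b \<bullet> b' = (if b = b' then 1 else 0)" if bb: "b \<in> B" "b' \<in> B" for b b'
  proof -
    obtain c where c: "c \<in> C" "c \<noteq> 0" "b = c /\<^sub>R norm c" using bb by (auto simp: B_def)
    obtain c' where c': "c' \<in> C" "c' \<noteq> 0" "b' = c' /\<^sub>R norm c'" using bb by (auto simp: B_def)
    show ?thesis
    proof (cases "c = c'")
      case True
      then show ?thesis using c c' by (simp add: dot_square_norm power2_eq_square)
    next
      case False
      then have 0: "c \<bullet> c' = 0" using C(3) c c' by (auto simp: pairwise_def orthogonal_def)
      then have "b \<bullet> b' = 0" using c c' by simp
      moreover have "b \<noteq> b'"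
      proof
        assume "b = b'"
        with \<open>b \<bullet> b' = 0\<close> have "b = 0" by simp
        then show False using c by simp
      qed
      ultimately show ?thesis by simp
    qed
  qed
  have "x = (\<Sum>b\<in>B. (x \<bullet> b) *\<^sub>R b)" for x
  proof -
    have "span B = UNIV"
    proof -
      have "c \<in> span B" if "c \<in> C" for c
      proof (cases "c = 0")
        case False
        then have "c /\<^sub>R norm c \<in> span B" using that by (auto simp: B_def intro: span_base)
        then have "norm c *\<^sub>R (c /\<^sub>R norm c) \<in> span B" by (rule span_scale)
        then show ?thesis using False by simp
      qed (simp add: span_zero)
      then have "span C \<subseteq> span B" by (simp add: span_minimal subsetI)
      then show ?thesis using C by auto
    qed
    then have "x \<in> span B" by simp
    then obtain u where u: "x = (\<Sum>b\<in>B. u b *\<^sub>R b)"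
      using B by (auto simp: span_finite)
    have "x \<bullet> b = u b" if "b \<in> B" for b
    proof -
      have "x \<bullet> b = (\<Sum>b'\<in>B. u b' * (b' \<bullet> b))" by (simp add: u inner_sum_left)
      also have "\<dots> = (\<Sum>b'\<in>B. if b' = b then u b' else 0)"
        by (rule sum.cong) (auto simp: orth that)
      also have "\<dots> = u b" using B that by simp
      finally show ?thesis .
    qed
    with u show ?thesis by simp
  qed
  with B show ?thesis by blast
qed

text \<open>Takes the place of \<open>Basis\<close>, which belongs to the class
  \<open>euclidean_space\<close>; that class excludes the zero space.\<close>

definition onb :: "'a::fin_dim set" where
  "onb = (SOME B. finite B \<and> (\<forall>x. x = (\<Sum>b\<in>B. (x \<bullet> b) *\<^sub>R b)))"

lemma finite_onb [simp]: "finite (onb :: 'a::fin_dim set)"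
  and onb_expansion: "(\<Sum>b\<in>onb. (x \<bullet> b) *\<^sub>R b) = (x :: 'a)"
proof -
  have "finite (onb :: 'a set) \<and> (\<forall>x :: 'a. x = (\<Sum>b\<in>onb. (x \<bullet> b) *\<^sub>R b))"
    unfolding onb_def by (rule someI_ex[OF finite_orthonormal_basis])
  then show "finite (onb :: 'a set)" "(\<Sum>b\<in>onb. (x \<bullet> b) *\<^sub>R b) = (x :: 'a)"
    by (blast, metis)
qed

text \<open>The coordinates of a Cauchy sequence along \<open>onb\<close> converge, and finitely
  many of them determine the vector. Completeness is what lets \<open>picard_lindelof\<close> be
  applied to model spaces.\<close>

instance fin_dim \<subseteq> banach
proof
  fix X :: "nat \<Rightarrow> 'a"
  assume X: "Cauchy X"
  have "convergent (\<lambda>n. X n \<bullet> b)" for b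
  proof -
    have "Cauchy (\<lambda>n. X n \<bullet> b)"
      using bounded_linear.Cauchy[OF bounded_linear_inner_left X] .
    then show ?thesis by (simp add: Cauchy_convergent)
  qed
  then obtain l where l: "\<And>b. (\<lambda>n. X n \<bullet> b) \<longlonglongrightarrow> l b"
    unfolding convergent_def by metis
  have "(\<lambda>n. \<Sum>b\<in>onb. (X n \<bullet> b) *\<^sub>R b) \<longlonglongrightarrow> (\<Sum>b\<in>onb. l b *\<^sub>R b)"
    by (intro tendsto_intros l)
  then show "convergent X" by (auto simp: onb_expansion convergent_def)
qed

text \<open>Used to trade a direction that varies with the point for finitely many fixed ones:
  \<open>Ck_on\<close> constrains derivatives in fixed directions only.\<close>

lemma linear_onb_expansion:
  fixes f :: "'a::fin_dim \<Rightarrow> 'b::real_vector"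
  assumes "linear f"
  shows "f x = (\<Sum>b\<in>onb. (x \<bullet> b) *\<^sub>R f b)"
proof -
  have "f x = f (\<Sum>b\<in>onb. (x \<bullet> b) *\<^sub>R b)" by (simp add: onb_expansion)
  also have "\<dots> = (\<Sum>b\<in>onb. (x \<bullet> b) *\<^sub>R f b)"
    by (simp add: linear_sum[OF assms] linear_scale[OF assms])
  finally show ?thesis .
qed

lemma fin_dim_linear_bounded:
  fixes f :: "'a::fin_dim \<Rightarrow> 'b::real_normed_vector"
  assumes "linear f"
  shows "bounded_linear f"
proof -
  have "bounded_linear (\<lambda>x. \<Sum>b\<in>onb. (x \<bullet> b) *\<^sub>R f b)"
    by (intro bounded_linear_sum bounded_linear_scaleR_const bounded_linear_inner_left)
  then show ?thesis by (simp add: linear_onb_expansion[OF assms, symmetric])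
qed

section \<open>Smooth functions between model spaces\<close>

lemma frechet_derivative_eqI:
  "(f has_derivative D) (at x) \<Longrightarrow> frechet_derivative f (at x) v = D v"
  by (drule frechet_derivative_at) simp

text \<open>A derivative at x sees a whole neighbourhood of x, so the congruence rules ask for
  agreement on an open set.\<close>

lemma frechet_derivative_cong_open:
  assumes "open S" "x \<in> S" "\<And>y. y \<in> S \<Longrightarrow> f y = g y"
  shows "frechet_derivative f (at x) = frechet_derivative g (at x)"
proof -
  have "(f has_derivative D) (at x) \<longleftrightarrow> (g has_derivative D) (at x)" for D
    using assms by (metis has_derivative_transform_within_open)
  then show ?thesis by (simp add: frechet_derivative_def)
qed

lemma differentiable_cong_open:
  assumes "open S" "x \<in> S" "\<And>y. y \<in> S \<Longrightarrow> f y = g y"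
  shows "f differentiable (at x) \<longleftrightarrow> g differentiable (at x)"
  using assms unfolding differentiable_def by (metis has_derivative_transform_within_open)

lemma Ck_on_cong:
  assumes "open S" "\<And>y. y \<in> S \<Longrightarrow> f y = g y"
  shows "Ck_on n S f \<longleftrightarrow> Ck_on n S g"
  using assms(2)
proof (induction n arbitrary: f g)
  case 0
  then show ?case by (auto intro: continuous_on_cong)
next
  case (Suc n)
  have "Ck_on n S (\<lambda>x. frechet_derivative f (at x) v) = Ck_on n S (\<lambda>x. frechet_derivative g (at x) v)" for v
    by (intro Suc.IH) (metis Suc.prems assms(1) frechet_derivative_cong_open)
  moreover have "(\<forall>x\<in>S. f differentiable (at x)) \<longleftrightarrow> (\<forall>x\<in>S. g differentiable (at x))"
    using differentiable_cong_open[OF assms(1)] Suc.prems by blast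
  ultimately show ?case by simp
qed

lemma Ck_on_subset: "Ck_on n S f \<Longrightarrow> T \<subseteq> S \<Longrightarrow> Ck_on n T f"
  by (induction n arbitrary: f) (auto intro: continuous_on_subset)

lemma Ck_on_SucD: "Ck_on (Suc n) S f \<Longrightarrow> Ck_on n S f"
proof (induction n arbitrary: f)
  case 0
  then show ?case
    by (auto intro!: continuous_at_imp_continuous_on differentiable_imp_continuous_within)
next
  case (Suc n)
  then show ?case by (metis Ck_on.simps(2))
qed

text \<open>Every clause of \<open>Ck_on\<close> concerns the behaviour near single points, so it
  may be checked on neighbourhoods. This underlies the passage between local and global smoothness
  on manifolds.\<close>

lemma Ck_on_local:
  "(\<And>x. x \<in> S \<Longrightarrow> \<exists>T. open T \<and> x \<in> T \<and> Ck_on n T f) \<Longrightarrow> Ck_on n S f"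
proof (induction n arbitrary: f)
  case 0
  then show ?case
    by (force intro!: continuous_at_imp_continuous_on simp: continuous_on_eq_continuous_at)
next
  case (Suc n)
  have "Ck_on n S (\<lambda>x. frechet_derivative f (at x) v)" for v
    by (rule Suc.IH) (use Suc.prems in fastforce)
  moreover have "\<forall>x\<in>S. f differentiable (at x)" using Suc.prems by fastforce
  ultimately show ?case by simp
qed

lemma Ck_on_const: "Ck_on n S (\<lambda>x. c)"
  by (induction n arbitrary: c) (auto simp: frechet_derivative_const)

lemma Ck_on_linear:
  assumes "bounded_linear f"
  shows "Ck_on n S f"
proof (cases n)
  case 0
  then show ?thesis using assms by (simp add: linear_continuous_on)
next
  case (Suc m)
  have "frechet_derivative f (at x) = f" for x
    using assms by (metis bounded_linear_imp_has_derivative frechet_derivative_at)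
  then show ?thesis
    using assms by (auto simp: Suc Ck_on_const intro: bounded_linear_imp_differentiable)
qed

lemma Ck_on_add:
  assumes "open S" "Ck_on n S f" "Ck_on n S g"
  shows "Ck_on n S (\<lambda>x. f x + g x)"
  using assms(2,3)
proof (induction n arbitrary: f g)
  case 0
  then show ?case by (auto intro: continuous_intros)
next
  case (Suc n)
  have "frechet_derivative (\<lambda>x. f x + g x) (at x) v =
      frechet_derivative f (at x) v + frechet_derivative g (at x) v" if "x \<in> S" for x v
  proof -
    have "((\<lambda>x. f x + g x) has_derivative
        (\<lambda>v. frechet_derivative f (at x) v + frechet_derivative g (at x) v)) (at x)"
      using Suc.prems that by (intro has_derivative_add) (auto simp: frechet_derivative_works[symmetric])
    then show ?thesis by (rule frechet_derivative_eqI)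
  qed
  moreover have "Ck_on n S (\<lambda>x. frechet_derivative f (at x) v + frechet_derivative g (at x) v)" for v
    using Suc by simp
  ultimately have "Ck_on n S (\<lambda>x. frechet_derivative (\<lambda>x. f x + g x) (at x) v)" for v
    by (subst Ck_on_cong[OF assms(1)])
  then show ?case using Suc.prems by simp
qed

text \<open>Leibniz rule: both summands of the derivative are products of the same kind with factors
  of class \<open>C^n\<close>, so an induction over n for all pairs of factors closes.\<close>

lemma Ck_on_bilinear:
  assumes "open S" "bounded_bilinear pr" "Ck_on n S f" "Ck_on n S g"
  shows "Ck_on n S (\<lambda>x. pr (f x) (g x))"
  using assms(3,4)
proof (induction n arbitrary: f g)
  case 0
  then show ?case using bounded_bilinear.continuous_on[OF assms(2)] by simp
next
  case (Suc n)
  have der: "((\<lambda>x. pr (f x) (g x)) has_derivative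
        (\<lambda>v. pr (f x) (frechet_derivative g (at x) v) + pr (frechet_derivative f (at x) v) (g x))) (at x)"
    if "x \<in> S" for x
    using Suc.prems that
    by (intro bounded_bilinear.FDERIV[OF assms(2)]) (auto simp: frechet_derivative_works[symmetric])
  then have eq: "frechet_derivative (\<lambda>x. pr (f x) (g x)) (at x) v =
      pr (f x) (frechet_derivative g (at x) v) + pr (frechet_derivative f (at x) v) (g x)" if "x \<in> S" for x v
    using that by (intro frechet_derivative_eqI) blast
  moreover have "Ck_on n S (\<lambda>x. pr (f x) (frechet_derivative g (at x) v) + pr (frechet_derivative f (at x) v) (g x))" for v
    using Suc.prems Ck_on_SucD[OF Suc.prems(1)] Ck_on_SucD[OF Suc.prems(2)]
    by (intro Ck_on_add[OF assms(1)] Suc.IH) auto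
  ultimately have "Ck_on n S (\<lambda>x. frechet_derivative (\<lambda>x. pr (f x) (g x)) (at x) v)" for v
    by (subst Ck_on_cong[OF assms(1)])
  moreover have "\<forall>x\<in>S. (\<lambda>x. pr (f x) (g x)) differentiable (at x)"
    using der by (blast intro: differentiableI)
  ultimately show ?case by simp
qed

lemma Ck_on_sum:
  assumes "open S" "finite I" "\<And>i. i \<in> I \<Longrightarrow> Ck_on n S (f i)"
  shows "Ck_on n S (\<lambda>x. \<Sum>i\<in>I. f i x)"
  using assms(2,3)
  by (induction I rule: finite_induct) (auto simp: Ck_on_const intro: Ck_on_add[OF assms(1)])

lemma Ck_on_compose_linear:
  assumes "open S" "bounded_linear l" "Ck_on n S f"
  shows "Ck_on n S (\<lambda>x. l (f x))"
proof -
  show ?thesis using assms(3)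
  proof (induction n arbitrary: f)
    case 0
    then show ?case using bounded_linear.continuous_on[OF assms(2)] by simp
  next
    case (Suc n)
    have der: "((\<lambda>x. l (f x)) has_derivative (\<lambda>v. l (frechet_derivative f (at x) v))) (at x)"
      if "x \<in> S" for x
      using Suc.prems that
      by (intro bounded_linear.has_derivative[OF assms(2)]) (auto simp: frechet_derivative_works[symmetric])
    then have eq: "frechet_derivative (\<lambda>x. l (f x)) (at x) v = l (frechet_derivative f (at x) v)"
      if "x \<in> S" for x v
      using that by (intro frechet_derivative_eqI) blast
    moreover have "Ck_on n S (\<lambda>x. l (frechet_derivative f (at x) v))" for v
      using Suc by simp
    ultimately have "Ck_on n S (\<lambda>x. frechet_derivative (\<lambda>x. l (f x)) (at x) v)" for v
      by (subst Ck_on_cong[OF assms(1)])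
    moreover have "\<forall>x\<in>S. (\<lambda>x. l (f x)) differentiable (at x)"
      using der by (blast intro: differentiableI)
    ultimately show ?case by simp
  qed
qed

text \<open>The chain rule produces the derivative of f at \<open>g x\<close> in a direction that
  moves with x. Expanding that direction in \<open>onb\<close> gives a sum of products: a
  coefficient of class \<open>C^n\<close> coming from g, times a fixed partial derivative of f
  composed with g, to which the induction hypothesis for another f applies.\<close>

lemma Ck_on_compose:
  fixes f :: "'b::fin_dim \<Rightarrow> 'c::real_normed_vector" and g :: "'a::fin_dim \<Rightarrow> 'b"
  assumes "open S" "g ` S \<subseteq> T" "Ck_on n T f" "Ck_on n S g"
  shows "Ck_on n S (\<lambda>x. f (g x))"
  using assms(3,4)
proof (induction n arbitrary: f)
  case 0
  then show ?case using assms(2) by (auto intro: continuous_on_compose2)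
next
  case (Suc n)
  have df: "(f has_derivative frechet_derivative f (at (g x))) (at (g x))" if "x \<in> S" for x
    using that Suc.prems assms(2) by (auto simp: frechet_derivative_works[symmetric])
  have dg: "(g has_derivative frechet_derivative g (at x)) (at x)" if "x \<in> S" for x
    using that Suc.prems by (auto simp: frechet_derivative_works[symmetric])
  have der: "((\<lambda>x. f (g x)) has_derivative
      (\<lambda>v. frechet_derivative f (at (g x)) (frechet_derivative g (at x) v))) (at x)" if "x \<in> S" for x
    using has_derivative_compose[OF dg df] that by blast
  have "frechet_derivative (\<lambda>x. f (g x)) (at x) v =
      (\<Sum>b\<in>onb. (frechet_derivative g (at x) v \<bullet> b) *\<^sub>R frechet_derivative f (at (g x)) b)" if "x \<in> S" for x v
  proof -
    have "frechet_derivative (\<lambda>x. f (g x)) (at x) v = frechet_derivative f (at (g x)) (frechet_derivative g (at x) v)"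
      using der[OF that] by (rule frechet_derivative_eqI)
    also have "\<dots> = (\<Sum>b\<in>onb. (frechet_derivative g (at x) v \<bullet> b) *\<^sub>R frechet_derivative f (at (g x)) b)"
      by (rule linear_onb_expansion) (use df[OF that] in \<open>rule has_derivative_linear\<close>)
    finally show ?thesis .
  qed
  moreover have "Ck_on n S (\<lambda>x. \<Sum>b\<in>onb. (frechet_derivative g (at x) v \<bullet> b) *\<^sub>R frechet_derivative f (at (g x)) b)" for v
  proof (intro Ck_on_sum[OF assms(1)] Ck_on_bilinear[OF assms(1) bounded_bilinear_scaleR])
    fix b
    show "Ck_on n S (\<lambda>x. frechet_derivative g (at x) v \<bullet> b)"
      using Suc.prems by (intro Ck_on_compose_linear[OF assms(1) bounded_linear_inner_left]) auto
    show "Ck_on n S (\<lambda>x. frechet_derivative f (at (g x)) b)"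
      using Suc.IH[of "\<lambda>y. frechet_derivative f (at y) b"] Suc.prems Ck_on_SucD[OF Suc.prems(2)] by simp
  qed simp
  ultimately have "Ck_on n S (\<lambda>x. frechet_derivative (\<lambda>x. f (g x)) (at x) v)" for v
    by (subst Ck_on_cong[OF assms(1)])
  moreover have "\<forall>x\<in>S. (\<lambda>x. f (g x)) differentiable (at x)"
    using der by (blast intro: differentiableI)
  ultimately show ?case by simp
qed

lemma smooth_on_cong:
  "open S \<Longrightarrow> (\<And>y. y \<in> S \<Longrightarrow> f y = g y) \<Longrightarrow> smooth_on S f \<longleftrightarrow> smooth_on S g"
  unfolding smooth_on_def using Ck_on_cong by blast

lemma smooth_on_subset: "smooth_on S f \<Longrightarrow> T \<subseteq> S \<Longrightarrow> smooth_on T f"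
  unfolding smooth_on_def using Ck_on_subset by blast

lemma smooth_on_local:
  "(\<And>x. x \<in> S \<Longrightarrow> \<exists>T. open T \<and> x \<in> T \<and> smooth_on T f) \<Longrightarrow> smooth_on S f"
  unfolding smooth_on_def by (intro allI Ck_on_local) blast

lemma smooth_on_const [simp]: "smooth_on S (\<lambda>x. c)"
  by (simp add: smooth_on_def Ck_on_const)

lemma smooth_on_linear: "bounded_linear f \<Longrightarrow> smooth_on S f"
  by (simp add: smooth_on_def Ck_on_linear)

lemma smooth_on_id [simp]: "smooth_on S (\<lambda>x. x)"
  by (simp add: smooth_on_linear)

lemma smooth_on_add: "open S \<Longrightarrow> smooth_on S f \<Longrightarrow> smooth_on S g \<Longrightarrow> smooth_on S (\<lambda>x. f x + g x)"
  by (simp add: smooth_on_def Ck_on_add)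

lemma smooth_on_bilinear:
  "open S \<Longrightarrow> bounded_bilinear pr \<Longrightarrow> smooth_on S f \<Longrightarrow> smooth_on S g \<Longrightarrow> smooth_on S (\<lambda>x. pr (f x) (g x))"
  by (simp add: smooth_on_def Ck_on_bilinear)

lemma smooth_on_sum:
  "open S \<Longrightarrow> finite I \<Longrightarrow> (\<And>i. i \<in> I \<Longrightarrow> smooth_on S (f i)) \<Longrightarrow> smooth_on S (\<lambda>x. \<Sum>i\<in>I. f i x)"
  by (simp add: smooth_on_def Ck_on_sum)

lemma smooth_on_compose_linear:
  "open S \<Longrightarrow> bounded_linear l \<Longrightarrow> smooth_on S f \<Longrightarrow> smooth_on S (\<lambda>x. l (f x))"
  by (simp add: smooth_on_def Ck_on_compose_linear)

lemma smooth_on_compose: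
  "open S \<Longrightarrow> g ` S \<subseteq> T \<Longrightarrow> smooth_on T f \<Longrightarrow> smooth_on S g \<Longrightarrow> smooth_on S (\<lambda>x. f (g x))"
  using Ck_on_compose[of S g T _ f] unfolding smooth_on_def by simp

lemma smooth_on_Pair:
  assumes "open S" "smooth_on S f" "smooth_on S g"
  shows "smooth_on S (\<lambda>x. (f x, g x))"
proof -
  have "bounded_linear (\<lambda>a. (a, 0))" "bounded_linear (\<lambda>b. (0, b))"
    by (auto intro: bounded_linear_Pair)
  then have "smooth_on S (\<lambda>x. (f x, 0) + (0, g x))"
    using assms by (intro smooth_on_add smooth_on_compose_linear[of _ "\<lambda>a. (a, 0)"]
        smooth_on_compose_linear[of _ "\<lambda>b. (0, b)"])
  then show ?thesis by simp
qed

lemma smooth_on_differentiable: "smooth_on S f \<Longrightarrow> x \<in> S \<Longrightarrow> f differentiable (at x)"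
  unfolding smooth_on_def by (metis Ck_on.simps(2))

lemma smooth_on_has_derivative:
  "smooth_on S f \<Longrightarrow> x \<in> S \<Longrightarrow> (f has_derivative frechet_derivative f (at x)) (at x)"
  using smooth_on_differentiable frechet_derivative_works by blast

lemma smooth_on_continuous_on: "smooth_on S f \<Longrightarrow> continuous_on S f"
  unfolding smooth_on_def by (metis Ck_on.simps(1))

lemma smooth_on_derivative: "smooth_on S f \<Longrightarrow> smooth_on S (\<lambda>x. frechet_derivative f (at x) v)"
  unfolding smooth_on_def by (metis Ck_on.simps(2))

text \<open>The shape of a tangent map applied to a vector field in coordinates: base point and
  direction both depend on x.\<close>

lemma smooth_on_derivative_compose:
  fixes f :: "'b::fin_dim \<Rightarrow> 'c::real_normed_vector" and g h :: "'a::fin_dim \<Rightarrow> 'b"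
  assumes "open S" "g ` S \<subseteq> T" "smooth_on T f" "smooth_on S g" "smooth_on S h"
  shows "smooth_on S (\<lambda>x. frechet_derivative f (at (g x)) (h x))"
proof -
  have "frechet_derivative f (at (g x)) (h x) = (\<Sum>b\<in>onb. (h x \<bullet> b) *\<^sub>R frechet_derivative f (at (g x)) b)"
    if "x \<in> S" for x
    using that assms(2) smooth_on_has_derivative[OF assms(3)] has_derivative_linear
    by (intro linear_onb_expansion) blast
  moreover have "smooth_on S (\<lambda>x. \<Sum>b\<in>onb. (h x \<bullet> b) *\<^sub>R frechet_derivative f (at (g x)) b)"
  proof (intro smooth_on_sum[OF assms(1) finite_onb] smooth_on_bilinear[OF assms(1) bounded_bilinear_scaleR])
    fix b
    show "smooth_on S (\<lambda>x. h x \<bullet> b)"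
      by (rule smooth_on_compose_linear[OF assms(1) bounded_linear_inner_left assms(5)])
    show "smooth_on S (\<lambda>x. frechet_derivative f (at (g x)) b)"
      by (rule smooth_on_compose[OF assms(1,2) smooth_on_derivative[OF assms(3)] assms(4)])
  qed
  ultimately show ?thesis
    by (simp add: smooth_on_cong[OF assms(1), of "\<lambda>x. frechet_derivative f (at (g x)) (h x)"])
qed

section \<open>Differential calculus on manifolds by means of charts\<close>

section \<open>Smooth functions on manifolds\<close>

text \<open>The part of \<open>smooth_manifold\<close> on which the calculus rests, with the
  homeomorphism property of charts unfolded into images and preimages of open sets. It is inherited
  by open submanifolds and products, between which local trivializations are stated.\<close>

definition smooth_atlas :: "('a, 'e::fin_dim) mfd \<Rightarrow> bool" where
  "smooth_atlas M \<longleftrightarrow>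
     (\<forall>c\<in>Atlas M. openin (Topo M) (fst c) \<and> inj_on (snd c) (fst c) \<and>
        (\<forall>W. openin (Topo M) W \<longrightarrow> open (snd c ` (fst c \<inter> W))) \<and>
        (\<forall>T. open T \<longrightarrow> openin (Topo M) (fst c \<inter> snd c -` T))) \<and>
     (\<Union>c\<in>Atlas M. fst c) = points M \<and>
     (\<forall>c\<in>Atlas M. \<forall>d\<in>Atlas M. smooth_on (snd c ` (fst c \<inter> fst d)) (\<lambda>x. snd d (chart_inv c x)))"

lemma smooth_manifold_atlas:
  assumes "smooth_manifold M"
  shows "smooth_atlas M"
  unfolding smooth_atlas_def
proof (intro conjI ballI allI impI)
  fix c assume c: "c \<in> Atlas M"
  have 1: "openin (Topo M) (fst c)" "open (snd c ` fst c)"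
    and 2: "homeomorphic_map (subtopology (Topo M) (fst c)) (top_of_set (snd c ` fst c)) (snd c)"
    using assms c unfolding smooth_manifold_def by force+
  have ts: "topspace (subtopology (Topo M) (fst c)) = fst c"
    using openin_subset[OF 1(1)] by (auto simp: topspace_subtopology)
  show "openin (Topo M) (fst c)" by fact
  show "inj_on (snd c) (fst c)" using homeomorphic_imp_injective_map[OF 2] ts by simp
  show "open (snd c ` (fst c \<inter> W))" if "openin (Topo M) W" for W
  proof -
    have "openin (subtopology (Topo M) (fst c)) (fst c \<inter> W)"
      using that by (auto simp: openin_subtopology)
    then have "openin (top_of_set (snd c ` fst c)) (snd c ` (fst c \<inter> W))"
      using homeomorphic_map_openness_eq[OF 2] by (metis homeomorphic_imp_open_map[OF 2] open_map_def)
    then show ?thesis using 1(2) openin_open_trans by blast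
  qed
  show "openin (Topo M) (fst c \<inter> snd c -` T)" if "open T" for T
  proof -
    have "continuous_map (subtopology (Topo M) (fst c)) (top_of_set (snd c ` fst c)) (snd c)"
      using 2 by (simp add: homeomorphic_imp_continuous_map)
    moreover have "openin (top_of_set (snd c ` fst c)) (snd c ` fst c \<inter> T)"
      using that by (auto simp: openin_open)
    ultimately have "openin (subtopology (Topo M) (fst c))
        {x \<in> topspace (subtopology (Topo M) (fst c)). snd c x \<in> snd c ` fst c \<inter> T}"
      by (rule openin_continuous_map_preimage)
    also have "{x \<in> topspace (subtopology (Topo M) (fst c)). snd c x \<in> snd c ` fst c \<inter> T} = fst c \<inter> snd c -` T"
      using ts by auto
    finally show ?thesis using 1(1) openin_trans_full by blast
  qed
next
  show "(\<Union>c\<in>Atlas M. fst c) = points M" using assms unfolding smooth_manifold_def by blast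
next
  fix c d assume "c \<in> Atlas M" "d \<in> Atlas M"
  then have "smooth_on (snd c ` (fst c \<inter> fst d)) (snd d \<circ> chart_inv (fst c, snd c))"
    using assms unfolding smooth_manifold_def by (auto simp: split_beta)
  then show "smooth_on (snd c ` (fst c \<inter> fst d)) (\<lambda>x. snd d (chart_inv c x))"
    by (simp add: comp_def)
qed

lemma chart_openin: "smooth_atlas M \<Longrightarrow> c \<in> Atlas M \<Longrightarrow> openin (Topo M) (fst c)"
  and chart_inj: "smooth_atlas M \<Longrightarrow> c \<in> Atlas M \<Longrightarrow> inj_on (snd c) (fst c)"
  and chart_open_image: "smooth_atlas M \<Longrightarrow> c \<in> Atlas M \<Longrightarrow> openin (Topo M) W \<Longrightarrow> open (snd c ` (fst c \<inter> W))"
  and chart_preimage: "smooth_atlas M \<Longrightarrow> c \<in> Atlas M \<Longrightarrow> open T \<Longrightarrow> openin (Topo M) (fst c \<inter> snd c -` T)"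
  and transition_smooth: "smooth_atlas M \<Longrightarrow> c \<in> Atlas M \<Longrightarrow> d \<in> Atlas M \<Longrightarrow>
        smooth_on (snd c ` (fst c \<inter> fst d)) (\<lambda>x. snd d (chart_inv c x))"
  unfolding smooth_atlas_def by auto

lemma chart_subset: "smooth_atlas M \<Longrightarrow> c \<in> Atlas M \<Longrightarrow> fst c \<subseteq> points M"
  unfolding smooth_atlas_def by blast

lemma chart_open_image': "smooth_atlas M \<Longrightarrow> c \<in> Atlas M \<Longrightarrow> openin (Topo M) W \<Longrightarrow> W \<subseteq> fst c \<Longrightarrow> open (snd c ` W)"
  using chart_open_image[of M c W] by (simp add: Int_absorb1)

lemma chart_inv_left [simp]: "smooth_atlas M \<Longrightarrow> c \<in> Atlas M \<Longrightarrow> p \<in> fst c \<Longrightarrow> chart_inv c (snd c p) = p"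
  using chart_inj[of M c] by (simp add: chart_inv_def inv_into_f_f)

lemma chart_exists:
  assumes "smooth_atlas M" "p \<in> points M"
  obtains c where "c \<in> Atlas M" "p \<in> fst c"
  using assms unfolding smooth_atlas_def by blast

lemma chart_at:
  assumes "smooth_atlas M" "p \<in> points M"
  shows "chart_at M p \<in> Atlas M" "p \<in> fst (chart_at M p)"
proof -
  have "\<exists>c. c \<in> Atlas M \<and> p \<in> fst c" using chart_exists[OF assms] by metis
  from someI_ex[OF this] show "chart_at M p \<in> Atlas M" "p \<in> fst (chart_at M p)"
    by (auto simp: chart_at_def)
qed

text \<open>Openness of the domain is built in, so that it travels with each smoothness fact:
  \<open>Ck_on\<close> uses full derivatives and behaves well only on open sets.\<close>

definition smooth_fun :: "('a, 'e::fin_dim) mfd \<Rightarrow> 'a set \<Rightarrow> ('a \<Rightarrow> 'v::real_normed_vector) \<Rightarrow> bool" where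
  "smooth_fun M W h \<longleftrightarrow> openin (Topo M) W \<and>
     (\<forall>c\<in>Atlas M. smooth_on (snd c ` (fst c \<inter> W)) (\<lambda>x. h (chart_inv c x)))"

lemma smooth_fun_openin: "smooth_fun M W h \<Longrightarrow> openin (Topo M) W"
  by (simp add: smooth_fun_def)

lemma smooth_fun_chart:
  "smooth_fun M W h \<Longrightarrow> c \<in> Atlas M \<Longrightarrow> smooth_on (snd c ` (fst c \<inter> W)) (\<lambda>x. h (chart_inv c x))"
  by (simp add: smooth_fun_def)

lemma smooth_fun_cong:
  assumes "smooth_atlas M" "\<And>p. p \<in> W \<Longrightarrow> h p = h' p"
  shows "smooth_fun M W h \<longleftrightarrow> smooth_fun M W h'"
proof -
  have "smooth_on (snd c ` (fst c \<inter> W)) (\<lambda>x. h (chart_inv c x)) \<longleftrightarrow>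
      smooth_on (snd c ` (fst c \<inter> W)) (\<lambda>x. h' (chart_inv c x))" if "openin (Topo M) W" "c \<in> Atlas M" for c
    using assms that chart_open_image[OF assms(1) that(2,1)] by (intro smooth_on_cong) auto
  then show ?thesis unfolding smooth_fun_def by blast
qed

lemma smooth_fun_subset: "smooth_fun M W h \<Longrightarrow> openin (Topo M) W' \<Longrightarrow> W' \<subseteq> W \<Longrightarrow> smooth_fun M W' h"
  unfolding smooth_fun_def by (meson smooth_on_subset Int_mono image_mono order_refl)

lemma smooth_fun_Int: "smooth_fun M W h \<Longrightarrow> openin (Topo M) V \<Longrightarrow> smooth_fun M (W \<inter> V) h"
  by (meson smooth_fun_subset smooth_fun_openin openin_Int Int_lower1)

lemma smooth_fun_local:
  assumes M: "smooth_atlas M" and "\<And>p. p \<in> W \<Longrightarrow> \<exists>W'. p \<in> W' \<and> W' \<subseteq> W \<and> smooth_fun M W' h"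
  shows "smooth_fun M W h"
  unfolding smooth_fun_def
proof (intro conjI ballI)
  show "openin (Topo M) W" by (subst openin_subopen) (use assms smooth_fun_openin in meson)
  fix c assume c: "c \<in> Atlas M"
  show "smooth_on (snd c ` (fst c \<inter> W)) (\<lambda>x. h (chart_inv c x))"
  proof (rule smooth_on_local)
    fix x assume "x \<in> snd c ` (fst c \<inter> W)"
    then obtain p where p: "p \<in> fst c" "p \<in> W" "x = snd c p" by auto
    obtain W' where "p \<in> W'" "smooth_fun M W' h" using assms(2)[OF p(2)] by blast
    with p c M show "\<exists>T. open T \<and> x \<in> T \<and> smooth_on T (\<lambda>x. h (chart_inv c x))"
      by (intro exI[of _ "snd c ` (fst c \<inter> W')"])
         (auto intro: chart_open_image smooth_fun_openin smooth_fun_chart)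
  qed
qed

text \<open>One chart containing W suffices, since any other chart differs from it by a smooth
  transition map.\<close>

lemma smooth_funI_chart:
  assumes M: "smooth_atlas M" and c: "c \<in> Atlas M" and W: "openin (Topo M) W" "W \<subseteq> fst c"
    and h: "smooth_on (snd c ` W) F" "\<And>p. p \<in> W \<Longrightarrow> h p = F (snd c p)"
  shows "smooth_fun M W h"
  unfolding smooth_fun_def
proof (intro conjI ballI)
  fix d assume d: "d \<in> Atlas M"
  have o: "open (snd d ` (fst d \<inter> W))" using chart_open_image[OF M d W(1)] .
  have "smooth_on (snd d ` (fst d \<inter> W)) (\<lambda>x. F (snd c (chart_inv d x)))"
  proof (rule smooth_on_compose[OF o _ h(1)])
    show "(\<lambda>x. snd c (chart_inv d x)) ` snd d ` (fst d \<inter> W) \<subseteq> snd c ` W"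
      using M d by auto
    show "smooth_on (snd d ` (fst d \<inter> W)) (\<lambda>x. snd c (chart_inv d x))"
      by (rule smooth_on_subset[OF transition_smooth[OF M d c]]) (use W in auto)
  qed
  then show "smooth_on (snd d ` (fst d \<inter> W)) (\<lambda>x. h (chart_inv d x))"
    by (subst smooth_on_cong[OF o]) (use M d h(2) in auto)
qed (rule W)

lemma smooth_fun_coord: "smooth_atlas M \<Longrightarrow> c \<in> Atlas M \<Longrightarrow> smooth_fun M (fst c) (snd c)"
  by (rule smooth_funI_chart[of M c _ "\<lambda>x. x"]) (auto intro: chart_openin)

lemma smooth_fun_const: "openin (Topo M) W \<Longrightarrow> smooth_fun M W (\<lambda>p. k)"
  by (simp add: smooth_fun_def)

lemma smooth_fun_add:
  "smooth_atlas M \<Longrightarrow> smooth_fun M W f \<Longrightarrow> smooth_fun M W g \<Longrightarrow> smooth_fun M W (\<lambda>p. f p + g p)"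
  unfolding smooth_fun_def by (simp add: smooth_on_add chart_open_image)

lemma smooth_fun_bilinear:
  "smooth_atlas M \<Longrightarrow> bounded_bilinear pr \<Longrightarrow> smooth_fun M W f \<Longrightarrow> smooth_fun M W g \<Longrightarrow>
    smooth_fun M W (\<lambda>p. pr (f p) (g p))"
  unfolding smooth_fun_def by (auto intro!: smooth_on_bilinear[where pr = pr] chart_open_image)

lemma smooth_fun_linear:
  "smooth_atlas M \<Longrightarrow> bounded_linear l \<Longrightarrow> smooth_fun M W f \<Longrightarrow> smooth_fun M W (\<lambda>p. l (f p))"
  unfolding smooth_fun_def by (auto intro!: smooth_on_compose_linear[where l = l] chart_open_image)

lemma smooth_fun_sum:
  "smooth_atlas M \<Longrightarrow> finite I \<Longrightarrow> openin (Topo M) W \<Longrightarrow> (\<And>i. i \<in> I \<Longrightarrow> smooth_fun M W (f i)) \<Longrightarrow>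
    smooth_fun M W (\<lambda>p. \<Sum>i\<in>I. f i p)"
  unfolding smooth_fun_def by (simp add: smooth_on_sum chart_open_image)

lemma smooth_fun_Pair:
  "smooth_atlas M \<Longrightarrow> smooth_fun M W f \<Longrightarrow> smooth_fun M W g \<Longrightarrow> smooth_fun M W (\<lambda>p. (f p, g p))"
  unfolding smooth_fun_def by (simp add: smooth_on_Pair chart_open_image)

lemma smooth_fun_compose:
  assumes "smooth_atlas M" "smooth_fun M W f" "f ` W \<subseteq> T" "smooth_on T F"
  shows "smooth_fun M W (\<lambda>p. F (f p))"
  unfolding smooth_fun_def
proof (intro conjI ballI)
  fix c assume c: "c \<in> Atlas M"
  show "smooth_on (snd c ` (fst c \<inter> W)) (\<lambda>x. F (f (chart_inv c x)))"
    by (rule smooth_on_compose[OF chart_open_image[OF assms(1) c] _ assms(4) smooth_fun_chart[OF assms(2) c]])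
       (use assms c in \<open>auto simp: smooth_fun_openin\<close>)
qed (use assms in \<open>simp add: smooth_fun_openin\<close>)

lemma smooth_fun_derivative:
  fixes F :: "'b::fin_dim \<Rightarrow> 'c::real_normed_vector"
  assumes "smooth_atlas M" "smooth_fun M W f" "f ` W \<subseteq> T" "smooth_on T F" "smooth_fun M W g"
  shows "smooth_fun M W (\<lambda>p. frechet_derivative F (at (f p)) (g p))"
  unfolding smooth_fun_def
proof (intro conjI ballI)
  fix c assume c: "c \<in> Atlas M"
  show "smooth_on (snd c ` (fst c \<inter> W)) (\<lambda>x. frechet_derivative F (at (f (chart_inv c x))) (g (chart_inv c x)))"
    by (rule smooth_on_derivative_compose[OF chart_open_image[OF assms(1) c] _ assms(4)
          smooth_fun_chart[OF assms(2) c] smooth_fun_chart[OF assms(5) c]])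
       (use assms c in \<open>auto simp: smooth_fun_openin\<close>)
qed (use assms in \<open>simp add: smooth_fun_openin\<close>)

lemma smooth_fun_preimage:
  assumes M: "smooth_atlas M" and h: "smooth_fun M W h" and T: "open T"
  shows "openin (Topo M) (W \<inter> h -` T)"
proof (subst openin_subopen, intro ballI)
  fix p assume p: "p \<in> W \<inter> h -` T"
  then have "p \<in> points M" using openin_subset[OF smooth_fun_openin[OF h]] by (auto simp: points_def)
  then obtain c where c: "c \<in> Atlas M" "p \<in> fst c" using chart_exists[OF M] by metis
  let ?S = "snd c ` (fst c \<inter> W)"
  have o: "open ?S" by (rule chart_open_image[OF M c(1) smooth_fun_openin[OF h]])
  have "continuous_on ?S (\<lambda>x. h (chart_inv c x))"
    by (rule smooth_on_continuous_on[OF smooth_fun_chart[OF h c(1)]])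
  then have "open (?S \<inter> (\<lambda>x. h (chart_inv c x)) -` T)"
    using o T by (rule continuous_open_preimage)
  then have "openin (Topo M) (fst c \<inter> snd c -` (?S \<inter> (\<lambda>x. h (chart_inv c x)) -` T))"
    by (rule chart_preimage[OF M c(1)])
  moreover have "fst c \<inter> snd c -` (?S \<inter> (\<lambda>x. h (chart_inv c x)) -` T) \<subseteq> W \<inter> h -` T"
    using M c chart_inj[OF M c(1)] by (auto dest!: inj_onD)
  moreover have "p \<in> fst c \<inter> snd c -` (?S \<inter> (\<lambda>x. h (chart_inv c x)) -` T)"
    using p c M by auto
  ultimately show "\<exists>V. openin (Topo M) V \<and> p \<in> V \<and> V \<subseteq> W \<inter> h -` T" by blast
qed

section \<open>Smooth maps\<close>

text \<open>Continuity of f is hidden in the openness that \<open>smooth_fun\<close> demands of the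
  preimages of chart domains; \<open>smooth_map_on_preimage\<close> recovers it for all open
  sets.\<close>

definition smooth_map_on ::
  "('a, 'e::fin_dim) mfd \<Rightarrow> 'a set \<Rightarrow> ('b, 'f::fin_dim) mfd \<Rightarrow> ('a \<Rightarrow> 'b) \<Rightarrow> bool" where
  "smooth_map_on N W M f \<longleftrightarrow> openin (Topo N) W \<and> f ` W \<subseteq> points M \<and>
     (\<forall>d\<in>Atlas M. smooth_fun N (W \<inter> f -` fst d) (\<lambda>p. snd d (f p)))"

lemma smooth_map_on_openin: "smooth_map_on N W M f \<Longrightarrow> openin (Topo N) W"
  and smooth_map_on_points: "smooth_map_on N W M f \<Longrightarrow> p \<in> W \<Longrightarrow> f p \<in> points M"
  and smooth_map_on_chart: "smooth_map_on N W M f \<Longrightarrow> d \<in> Atlas M \<Longrightarrow>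
        smooth_fun N (W \<inter> f -` fst d) (\<lambda>p. snd d (f p))"
  by (auto simp: smooth_map_on_def)

lemma points_openin [simp]: "openin (Topo M) (points M)"
  by (simp add: points_def)

lemma smooth_map_imp_on:
  assumes "smooth_atlas N" "smooth_atlas M" "smooth_map N M f"
  shows "smooth_map_on N (points N) M f"
  unfolding smooth_map_on_def
proof (intro conjI ballI)
  have f: "continuous_map (Topo N) (Topo M) f" using assms(3) by (simp add: smooth_map_def)
  then show "f ` points N \<subseteq> points M" by (auto simp: continuous_map_def points_def)
  fix d assume d: "d \<in> Atlas M"
  show "smooth_fun N (points N \<inter> f -` fst d) (\<lambda>p. snd d (f p))"
    unfolding smooth_fun_def
  proof (intro conjI ballI)
    have "openin (Topo N) {x \<in> topspace (Topo N). f x \<in> fst d}"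
      by (rule openin_continuous_map_preimage[OF f chart_openin[OF assms(2) d]])
    then show "openin (Topo N) (points N \<inter> f -` fst d)"
      by (simp add: points_def Int_def vimage_def)
    fix c assume c: "c \<in> Atlas N"
    have "fst c \<inter> (points N \<inter> f -` fst d) = fst c \<inter> f -` fst d"
      using chart_subset[OF assms(1) c] by auto
    moreover have "smooth_on (snd c ` (fst c \<inter> f -` fst d)) (snd d \<circ> f \<circ> chart_inv (fst c, snd c))"
      using assms(3) c d by (force simp: smooth_map_def)
    ultimately show "smooth_on (snd c ` (fst c \<inter> (points N \<inter> f -` fst d))) (\<lambda>x. snd d (f (chart_inv c x)))"
      by (simp add: comp_def)
  qed
qed simp

lemma smooth_map_on_subset:
  "smooth_map_on N W M f \<Longrightarrow> openin (Topo N) W' \<Longrightarrow> W' \<subseteq> W \<Longrightarrow> smooth_map_on N W' M f"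
  unfolding smooth_map_on_def
proof (intro conjI ballI)
  assume a: "openin (Topo N) W \<and> f ` W \<subseteq> points M \<and>
     (\<forall>d\<in>Atlas M. smooth_fun N (W \<inter> f -` fst d) (\<lambda>p. snd d (f p)))"
    and W': "openin (Topo N) W'" "W' \<subseteq> W"
  fix d assume d: "d \<in> Atlas M"
  have "W' \<inter> f -` fst d = (W \<inter> f -` fst d) \<inter> W'" using W' by auto
  then show "smooth_fun N (W' \<inter> f -` fst d) (\<lambda>p. snd d (f p))"
    using a d W' by (metis smooth_fun_Int)
qed auto

lemma smooth_map_on_preimage:
  assumes N: "smooth_atlas N" and M: "smooth_atlas M" and f: "smooth_map_on N W M f"
    and V: "openin (Topo M) V"
  shows "openin (Topo N) (W \<inter> f -` V)"
proof (subst openin_subopen, intro ballI)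
  fix p assume p: "p \<in> W \<inter> f -` V"
  then obtain d where d: "d \<in> Atlas M" "f p \<in> fst d"
    using chart_exists[OF M] smooth_map_on_points[OF f] by (metis IntD1)
  have "open (snd d ` (fst d \<inter> V))" by (rule chart_open_image[OF M d(1) V])
  then have "openin (Topo N) ((W \<inter> f -` fst d) \<inter> (\<lambda>p. snd d (f p)) -` (snd d ` (fst d \<inter> V)))"
    by (rule smooth_fun_preimage[OF N smooth_map_on_chart[OF f d(1)]])
  moreover have "(W \<inter> f -` fst d) \<inter> (\<lambda>p. snd d (f p)) -` (snd d ` (fst d \<inter> V)) \<subseteq> W \<inter> f -` V"
    using chart_inj[OF M d(1)] by (auto dest!: inj_onD)
  ultimately show "\<exists>T. openin (Topo N) T \<and> p \<in> T \<and> T \<subseteq> W \<inter> f -` V"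
    using p d by (intro exI[of _ "(W \<inter> f -` fst d) \<inter> (\<lambda>p. snd d (f p)) -` (snd d ` (fst d \<inter> V))"]) auto
qed

lemma smooth_fun_compose_map:
  assumes N: "smooth_atlas N" and M: "smooth_atlas M" and f: "smooth_map_on N W M f"
    and h: "smooth_fun M V h"
  shows "smooth_fun N (W \<inter> f -` V) (\<lambda>p. h (f p))"
proof (rule smooth_fun_local[OF N])
  fix p assume p: "p \<in> W \<inter> f -` V"
  then obtain d where d: "d \<in> Atlas M" "f p \<in> fst d"
    using chart_exists[OF M] smooth_map_on_points[OF f] by (metis IntD1)
  let ?W = "(W \<inter> f -` fst d) \<inter> (W \<inter> f -` V)"
  have "smooth_fun N ?W (\<lambda>p. snd d (f p))"
    by (rule smooth_fun_Int[OF smooth_map_on_chart[OF f d(1)] smooth_map_on_preimage[OF N M f smooth_fun_openin[OF h]]])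
  then have "smooth_fun N ?W (\<lambda>p. h (chart_inv d (snd d (f p))))"
    by (rule smooth_fun_compose[OF N _ _ smooth_fun_chart[OF h d(1)]]) auto
  then have "smooth_fun N ?W (\<lambda>p. h (f p))"
    by (subst smooth_fun_cong[OF N]) (use M d in auto)
  then show "\<exists>W'. p \<in> W' \<and> W' \<subseteq> W \<inter> f -` V \<and> smooth_fun N W' (\<lambda>p. h (f p))"
    using p d by (intro exI[of _ ?W]) auto
qed

lemma smooth_map_on_compose:
  assumes N: "smooth_atlas N" and M: "smooth_atlas M"
    and f: "smooth_map_on N W M f" and g: "smooth_map_on M V K g"
  shows "smooth_map_on N (W \<inter> f -` V) K (\<lambda>p. g (f p))"
  unfolding smooth_map_on_def
proof (intro conjI ballI)
  show "openin (Topo N) (W \<inter> f -` V)"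
    by (rule smooth_map_on_preimage[OF N M f smooth_map_on_openin[OF g]])
  show "(\<lambda>p. g (f p)) ` (W \<inter> f -` V) \<subseteq> points K" using smooth_map_on_points[OF g] by auto
  fix d assume d: "d \<in> Atlas K"
  have "smooth_fun N (W \<inter> f -` (V \<inter> g -` fst d)) (\<lambda>p. snd d (g (f p)))"
    by (rule smooth_fun_compose_map[OF N M f smooth_map_on_chart[OF g d]])
  moreover have "W \<inter> f -` (V \<inter> g -` fst d) = W \<inter> f -` V \<inter> (\<lambda>p. g (f p)) -` fst d" by auto
  ultimately show "smooth_fun N (W \<inter> f -` V \<inter> (\<lambda>p. g (f p)) -` fst d) (\<lambda>p. snd d (g (f p)))"
    by simp
qed

lemma smooth_map_on_compose':
  assumes "smooth_atlas N" "smooth_atlas M" "smooth_map_on N W M f" "smooth_map_on M V K g" "f ` W \<subseteq> V"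
  shows "smooth_map_on N W K (\<lambda>p. g (f p))"
proof -
  have "W \<inter> f -` V = W" using assms(5) by auto
  then show ?thesis using smooth_map_on_compose[OF assms(1-4)] by simp
qed

lemma smooth_map_on_const: "openin (Topo N) W \<Longrightarrow> k \<in> points M \<Longrightarrow> smooth_map_on N W M (\<lambda>p. k)"
  by (auto simp: smooth_map_on_def smooth_fun_const)

lemma smooth_map_on_id:
  assumes M: "smooth_atlas M" and "openin (Topo M) W"
  shows "smooth_map_on M W M (\<lambda>p. p)"
proof -
  have "smooth_fun M (W \<inter> fst d) (snd d)" if "d \<in> Atlas M" for d
    using smooth_fun_Int[OF smooth_fun_coord[OF M that] assms(2)] by (simp add: Int_commute)
  then show ?thesis
    using assms openin_subset[OF assms(2)] by (auto simp: smooth_map_on_def points_def)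
qed

lemma smooth_map_on_cong:
  assumes N: "smooth_atlas N" and "\<And>p. p \<in> W \<Longrightarrow> f p = g p"
  shows "smooth_map_on N W M f \<longleftrightarrow> smooth_map_on N W M g"
proof -
  have *: "W \<inter> f -` T = W \<inter> g -` T" for T using assms(2) by auto
  have "smooth_fun N (W \<inter> g -` fst d) (\<lambda>p. snd d (f p)) \<longleftrightarrow> smooth_fun N (W \<inter> g -` fst d) (\<lambda>p. snd d (g p))"
    if "d \<in> Atlas M" for d
    by (rule smooth_fun_cong[OF N]) (use assms(2) in auto)
  moreover have "f ` W = g ` W" using assms(2) by auto
  ultimately show ?thesis unfolding smooth_map_on_def * by (simp cong: ball_cong)
qed

section \<open>Tangent vectors in charts\<close>

text \<open>Jacobian of a change of coordinates at p. Both \<open>to_chart\<close> and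
  \<open>from_chart\<close> are instances in which one of the charts is the chosen one at p, so that
  their rules reduce to the cocycle identity \<open>transition_transition\<close>.\<close>

definition transition :: "('a, 'e::fin_dim) chart \<Rightarrow> ('a, 'f::fin_dim) chart \<Rightarrow> 'a \<Rightarrow> 'e \<Rightarrow> 'f" where
  "transition c d p = frechet_derivative (\<lambda>x. snd d (chart_inv c x)) (at (snd c p))"

lemma to_chart_transition: "to_chart M c p = transition (chart_at M p) c p"
  by (simp add: to_chart_def transition_def param_def coord_def comp_def)

lemma from_chart_transition: "from_chart M c p = transition c (chart_at M p) p"
  by (simp add: from_chart_def transition_def coord_def comp_def)

lemma transition_has_derivative:
  assumes "smooth_atlas M" "c \<in> Atlas M" "d \<in> Atlas M" "p \<in> fst c" "p \<in> fst d"
  shows "((\<lambda>x. snd d (chart_inv c x)) has_derivative transition c d p) (at (snd c p))"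
  unfolding transition_def
  by (rule smooth_on_has_derivative[OF transition_smooth[OF assms(1-3)]]) (use assms in auto)

lemma transition_linear:
  assumes "smooth_atlas M" "c \<in> Atlas M" "d \<in> Atlas M" "p \<in> fst c" "p \<in> fst d"
  shows "linear (transition c d p)"
  using transition_has_derivative[OF assms] by (rule has_derivative_linear)

text \<open>Chain rule for coordinate changes. Passing through the chart d and back is the identity
  only on the overlap with d, an open set, which is enough for the derivative.\<close>

lemma transition_transition:
  assumes M: "smooth_atlas M" and c: "c \<in> Atlas M" "p \<in> fst c" and d: "d \<in> Atlas M" "p \<in> fst d"
    and e: "e \<in> Atlas M" "p \<in> fst e"
  shows "transition d e p (transition c d p v) = transition c e p v"
proof -
  let ?S = "snd c ` (fst c \<inter> fst d)"
  have "((\<lambda>x. snd e (chart_inv d (snd d (chart_inv c x)))) has_derivative (\<lambda>v. transition d e p (transition c d p v))) (at (snd c p))"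
    using transition_has_derivative[OF M d(1) e(1) d(2) e(2)] M c
    by (intro has_derivative_compose[OF transition_has_derivative[OF M c(1) d(1) c(2) d(2)]]) simp
  then have "((\<lambda>x. snd e (chart_inv c x)) has_derivative (\<lambda>v. transition d e p (transition c d p v))) (at (snd c p))"
    by (rule has_derivative_transform_within_open[of _ _ _ _ ?S])
       (use M c d chart_open_image[OF M c(1) chart_openin[OF M d(1)]] in auto)
  then show ?thesis unfolding transition_def[of c e] by (rule frechet_derivative_eqI[symmetric])
qed

lemma transition_same:
  assumes M: "smooth_atlas M" and c: "c \<in> Atlas M" "p \<in> fst c"
  shows "transition c c p v = v"
proof -
  have "((\<lambda>x. snd c (chart_inv c x)) has_derivative (\<lambda>v. v)) (at (snd c p))"
    by (rule has_derivative_transform_within_open[OF has_derivative_ident, of "snd c ` fst c"])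
       (use M c chart_open_image'[OF M c(1) chart_openin[OF M c(1)]] in auto)
  then show ?thesis unfolding transition_def by (rule frechet_derivative_eqI)
qed

lemma from_to_chart:
  assumes "smooth_atlas M" "c \<in> Atlas M" "p \<in> fst c"
  shows "from_chart M c p (to_chart M c p v) = v"
  using assms chart_at[OF assms(1)] chart_subset[OF assms(1,2)]
  by (auto simp: from_chart_transition to_chart_transition transition_same subsetD transition_transition[of M])

lemma to_chart_eq_iff:
  assumes "smooth_atlas M" "c \<in> Atlas M" "p \<in> fst c"
  shows "to_chart M c p v = to_chart M c p w \<longleftrightarrow> v = w"
  using from_to_chart[OF assms] by metis

lemma to_chart_linear:
  assumes "smooth_atlas M" "c \<in> Atlas M" "p \<in> fst c"
  shows "linear (to_chart M c p)"
  using assms chart_at[OF assms(1)] chart_subset[OF assms(1,2)]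
  by (auto simp: to_chart_transition subsetD intro: transition_linear)

lemma from_chart_linear:
  assumes "smooth_atlas M" "c \<in> Atlas M" "p \<in> fst c"
  shows "linear (from_chart M c p)"
  using assms chart_at[OF assms(1)] chart_subset[OF assms(1,2)]
  by (auto simp: from_chart_transition subsetD intro: transition_linear)

lemma transition_to_chart:
  assumes "smooth_atlas M" "c \<in> Atlas M" "p \<in> fst c" "d \<in> Atlas M" "p \<in> fst d"
  shows "transition c d p (to_chart M c p v) = to_chart M d p v"
  using assms chart_at[OF assms(1)] chart_subset[OF assms(1,2)]
  by (auto simp: to_chart_transition subsetD transition_transition[of M])

lemma from_chart_transition_eq:
  assumes "smooth_atlas M" "c \<in> Atlas M" "p \<in> fst c" "d \<in> Atlas M" "p \<in> fst d"
  shows "from_chart M d p (transition c d p v) = from_chart M c p v"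
  using assms chart_at[OF assms(1)] chart_subset[OF assms(1,2)]
  by (auto simp: from_chart_transition subsetD transition_transition[of M])

lemma to_chart_at:
  assumes "smooth_atlas M" "p \<in> points M"
  shows "to_chart M (chart_at M p) p v = v"
  using assms chart_at[OF assms] by (simp add: to_chart_transition transition_same)

section \<open>Tangent maps\<close>

lemma smooth_map_on_rep:
  assumes N: "smooth_atlas N" and f: "smooth_map_on N W M f"
    and c: "c \<in> Atlas N" and d: "d \<in> Atlas M"
  shows "smooth_on (snd c ` (fst c \<inter> (W \<inter> f -` fst d))) (\<lambda>x. snd d (f (chart_inv c x)))"
    and "open (snd c ` (fst c \<inter> (W \<inter> f -` fst d)))"
  using smooth_fun_chart[OF smooth_map_on_chart[OF f d] c]
    chart_open_image[OF N c smooth_fun_openin[OF smooth_map_on_chart[OF f d]]] by auto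

lemma smooth_map_on_has_derivative:
  assumes N: "smooth_atlas N" and f: "smooth_map_on N W M f" and p: "p \<in> W"
    and c: "c \<in> Atlas N" "p \<in> fst c" and d: "d \<in> Atlas M" "f p \<in> fst d"
  shows "((\<lambda>x. snd d (f (chart_inv c x))) has_derivative
      frechet_derivative (\<lambda>x. snd d (f (chart_inv c x))) (at (snd c p))) (at (snd c p))"
  by (rule smooth_on_has_derivative[OF smooth_map_on_rep(1)[OF N f c(1) d(1)]]) (use p c d in auto)

lemma tangent_map_alt:
  "tangent_map N M f p = frechet_derivative (\<lambda>x. snd (chart_at M (f p)) (f (chart_inv (chart_at N p) x)))
     (at (snd (chart_at N p) p))"
  by (simp add: tangent_map_def coord_def param_def comp_def)

text \<open>The map from the chosen coordinates at p to the chart d is differentiated twice, once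
  factored through the chosen chart at \<open>f p\<close> and once through c. Equality of the
  results turns the definition by chosen charts into a rule for arbitrary ones.\<close>

lemma tangent_map_chart:
  assumes N: "smooth_atlas N" and M: "smooth_atlas M" and f: "smooth_map_on N W M f" and p: "p \<in> W"
    and c: "c \<in> Atlas N" "p \<in> fst c" and d: "d \<in> Atlas M" "f p \<in> fst d"
  shows "to_chart M d (f p) (tangent_map N M f p v) =
    frechet_derivative (\<lambda>x. snd d (f (chart_inv c x))) (at (snd c p)) (to_chart N c p v)"
proof -
  let ?c = "chart_at N p" and ?d = "chart_at M (f p)"
  have c': "?c \<in> Atlas N" "p \<in> fst ?c"
    using chart_at[OF N] chart_subset[OF N c(1)] c(2) by auto
  have d': "?d \<in> Atlas M" "f p \<in> fst ?d"
    using chart_at[OF M] chart_subset[OF M d(1)] d(2) by auto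
  \<comment> \<open>A coordinate neighbourhood on which all four charts are defined, so that both
    factorisations equal the direct local expression.\<close>
  define S where "S = snd ?c ` (fst ?c \<inter> ((W \<inter> f -` fst d) \<inter> (W \<inter> f -` fst ?d) \<inter> fst c))"
  have S: "open S" unfolding S_def
    by (intro chart_open_image[OF N c'(1)] openin_Int smooth_fun_openin[OF smooth_map_on_chart[OF f]]
        d d' chart_openin[OF N c(1)])
  have pS: "snd ?c p \<in> S" unfolding S_def using p c d c' d' by auto
  let ?T = "frechet_derivative (\<lambda>x. snd ?d (f (chart_inv ?c x))) (at (snd ?c p))"
  have 1: "((\<lambda>x. snd d (chart_inv ?d (snd ?d (f (chart_inv ?c x))))) has_derivative
      (\<lambda>v. transition ?d d (f p) (?T v))) (at (snd ?c p))"
    using transition_has_derivative[OF M d'(1) d(1) d'(2) d(2)] N c'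
    by (intro has_derivative_compose[OF smooth_map_on_has_derivative[OF N f p c' d']]) simp
  have "((\<lambda>x. snd d (f (chart_inv ?c x))) has_derivative
      (\<lambda>v. transition ?d d (f p) (?T v))) (at (snd ?c p))"
    by (rule has_derivative_transform_within_open[OF 1 S pS]) (use M d' N c' in \<open>auto simp: S_def\<close>)
  then have A: "frechet_derivative (\<lambda>x. snd d (f (chart_inv ?c x))) (at (snd ?c p)) v = transition ?d d (f p) (?T v)"
    by (rule frechet_derivative_eqI)
  have 2: "((\<lambda>x. snd d (f (chart_inv c (snd c (chart_inv ?c x))))) has_derivative
      (\<lambda>v. frechet_derivative (\<lambda>x. snd d (f (chart_inv c x))) (at (snd c p)) (transition ?c c p v))) (at (snd ?c p))"
    using smooth_map_on_has_derivative[OF N f p c d] N c'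
    by (intro has_derivative_compose[OF transition_has_derivative[OF N c'(1) c(1) c'(2) c(2)]]) simp
  have "((\<lambda>x. snd d (f (chart_inv ?c x))) has_derivative
      (\<lambda>v. frechet_derivative (\<lambda>x. snd d (f (chart_inv c x))) (at (snd c p)) (transition ?c c p v))) (at (snd ?c p))"
    by (rule has_derivative_transform_within_open[OF 2 S pS]) (use M d' N c' c in \<open>auto simp: S_def\<close>)
  then have B: "frechet_derivative (\<lambda>x. snd d (f (chart_inv ?c x))) (at (snd ?c p)) v =
      frechet_derivative (\<lambda>x. snd d (f (chart_inv c x))) (at (snd c p)) (transition ?c c p v)"
    by (rule frechet_derivative_eqI)
  show ?thesis using A B by (simp add: to_chart_transition tangent_map_alt)
qed

lemma tangent_map_linear:
  assumes N: "smooth_atlas N" and M: "smooth_atlas M" and f: "smooth_map_on N W M f" and p: "p \<in> W"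
  shows "linear (tangent_map N M f p)"
proof -
  have "p \<in> points N" using p openin_subset[OF smooth_map_on_openin[OF f]] by (auto simp: points_def)
  then show ?thesis
    unfolding tangent_map_alt
    by (intro has_derivative_linear[OF smooth_map_on_has_derivative[OF N f p]] chart_at[OF N]
        chart_at[OF M] smooth_map_on_points[OF f p])
qed

text \<open>Once the base charts are arbitrary, this is the chain rule for local expressions;
  injectivity of \<open>to_chart\<close> removes the charts again.\<close>

lemma tangent_map_compose:
  assumes N: "smooth_atlas N" and M: "smooth_atlas M" and K: "smooth_atlas K"
    and f: "smooth_map_on N W M f" and g: "smooth_map_on M V K g" and p: "p \<in> W" "f p \<in> V"
  shows "tangent_map N K (\<lambda>x. g (f x)) p v = tangent_map M K g (f p) (tangent_map N M f p v)"
proof -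
  have pN: "p \<in> points N" using p openin_subset[OF smooth_map_on_openin[OF f]] by (auto simp: points_def)
  obtain c where c: "c \<in> Atlas N" "p \<in> fst c" using chart_exists[OF N pN] .
  obtain d where d: "d \<in> Atlas M" "f p \<in> fst d" using chart_exists[OF M smooth_map_on_points[OF f p(1)]] .
  obtain e where e: "e \<in> Atlas K" "g (f p) \<in> fst e" using chart_exists[OF K smooth_map_on_points[OF g p(2)]] .
  define S where "S = snd c ` (fst c \<inter> (W \<inter> f -` fst d))"
  have S: "open S" "snd c p \<in> S"
    using smooth_map_on_rep(2)[OF N f c(1) d(1)] p c d by (auto simp: S_def)
  let ?F = "frechet_derivative (\<lambda>x. snd d (f (chart_inv c x))) (at (snd c p))"
  let ?G = "frechet_derivative (\<lambda>x. snd e (g (chart_inv d x))) (at (snd d (f p)))"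
  have 1: "((\<lambda>x. snd e (g (chart_inv d (snd d (f (chart_inv c x)))))) has_derivative (\<lambda>v. ?G (?F v))) (at (snd c p))"
    using smooth_map_on_has_derivative[OF M g p(2) d e] N c
    by (intro has_derivative_compose[OF smooth_map_on_has_derivative[OF N f p(1) c d]]) simp
  have "((\<lambda>x. snd e (g (f (chart_inv c x)))) has_derivative (\<lambda>v. ?G (?F v))) (at (snd c p))"
    by (rule has_derivative_transform_within_open[OF 1 S]) (use M d N c in \<open>auto simp: S_def\<close>)
  then have "frechet_derivative (\<lambda>x. snd e (g (f (chart_inv c x)))) (at (snd c p)) (to_chart N c p v) =
      ?G (?F (to_chart N c p v))"
    by (rule frechet_derivative_eqI)
  then have "to_chart K e (g (f p)) (tangent_map N K (\<lambda>x. g (f x)) p v) =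
      to_chart K e (g (f p)) (tangent_map M K g (f p) (tangent_map N M f p v))"
    using tangent_map_chart[OF N K smooth_map_on_compose[OF N M f g] _ c e] p
      tangent_map_chart[OF M K g p(2) d e] tangent_map_chart[OF N M f p(1) c d] by simp
  then show ?thesis using to_chart_eq_iff[OF K e] by simp
qed

lemma tangent_map_cong:
  assumes N: "smooth_atlas N" and W: "openin (Topo N) W" "p \<in> W" and "\<And>x. x \<in> W \<Longrightarrow> f x = g x"
  shows "tangent_map N M f p = tangent_map N M g p"
proof -
  have p: "p \<in> points N" using W openin_subset[OF W(1)] by (auto simp: points_def)
  note c = chart_at[OF N p]
  show ?thesis unfolding tangent_map_alt
    using assms(4)[OF W(2)]
    by (intro frechet_derivative_cong_open[OF chart_open_image[OF N c(1) W(1)]])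
       (use c W assms(4) N in auto)
qed

lemma tangent_map_id:
  assumes N: "smooth_atlas N" and p: "p \<in> points N"
  shows "tangent_map N N (\<lambda>x. x) p v = v"
  using transition_same[OF N chart_at[OF N p]] by (simp add: tangent_map_alt transition_def)

lemma tangent_map_const: "tangent_map N M (\<lambda>x. k) p v = 0"
  by (simp add: tangent_map_alt frechet_derivative_const)

section \<open>Vector fields along maps\<close>

definition smooth_field_on ::
  "('a, 'e::fin_dim) mfd \<Rightarrow> 'a set \<Rightarrow> ('b, 'f::fin_dim) mfd \<Rightarrow> ('a \<Rightarrow> 'b) \<Rightarrow> ('a \<Rightarrow> 'f) \<Rightarrow> bool" where
  "smooth_field_on N W M f V \<longleftrightarrow> smooth_map_on N W M f \<and>
     (\<forall>d\<in>Atlas M. smooth_fun N (W \<inter> f -` fst d) (\<lambda>q. to_chart M d (f q) (V q)))"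

lemma smooth_field_on_map: "smooth_field_on N W M f V \<Longrightarrow> smooth_map_on N W M f"
  and smooth_field_on_chart: "smooth_field_on N W M f V \<Longrightarrow> d \<in> Atlas M \<Longrightarrow>
        smooth_fun N (W \<inter> f -` fst d) (\<lambda>q. to_chart M d (f q) (V q))"
  by (auto simp: smooth_field_on_def)

lemma smooth_field_along_iff:
  assumes N: "smooth_atlas N" and M: "smooth_atlas M" and f: "smooth_map_on N (points N) M f"
  shows "smooth_field_along N M f V \<longleftrightarrow> smooth_field_on N (points N) M f V"
proof -
  have "fst c \<inter> (points N \<inter> f -` fst d) = fst c \<inter> f -` fst d"
    if "c \<in> Atlas N" "d \<in> Atlas M" for c d
    using chart_subset[OF N that(1)] by auto
  moreover have "openin (Topo N) (points N \<inter> f -` fst d)" if "d \<in> Atlas M" for d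
    by (rule smooth_map_on_preimage[OF N M f chart_openin[OF M that]])
  ultimately have "smooth_field_on N (points N) M f V \<longleftrightarrow>
      (\<forall>d\<in>Atlas M. \<forall>c\<in>Atlas N. smooth_on (snd c ` (fst c \<inter> f -` fst d))
        (\<lambda>x. to_chart M d (f (chart_inv c x)) (V (chart_inv c x))))"
    using f by (simp add: smooth_field_on_def smooth_fun_def cong: ball_cong)
  moreover have "smooth_field_along N M f V \<longleftrightarrow>
      (\<forall>c\<in>Atlas N. \<forall>d\<in>Atlas M. smooth_on (snd c ` (fst c \<inter> f -` fst d))
        (\<lambda>x. to_chart M d (f (chart_inv c x)) (V (chart_inv c x))))"
    by (simp add: smooth_field_along_def split_beta Let_def)
  ultimately show ?thesis by blast
qed

text \<open>Components with respect to e arise from those with respect to d by the Jacobian of the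
  coordinate change at \<open>f q\<close>, which varies smoothly with q. Hence one chart around each
  value is enough.\<close>

lemma smooth_field_onI_local:
  assumes N: "smooth_atlas N" and M: "smooth_atlas M" and f: "smooth_map_on N W M f"
    and loc: "\<And>q. q \<in> W \<Longrightarrow> \<exists>d W'. d \<in> Atlas M \<and> q \<in> W' \<and> W' \<subseteq> W \<and> f ` W' \<subseteq> fst d \<and>
          smooth_fun N W' (\<lambda>q. to_chart M d (f q) (V q))"
  shows "smooth_field_on N W M f V"
  unfolding smooth_field_on_def
proof (intro conjI ballI smooth_fun_local[OF N])
  fix e q assume e: "e \<in> Atlas M" and q: "q \<in> W \<inter> f -` fst e"
  then obtain d W' where d: "d \<in> Atlas M" "q \<in> W'" "W' \<subseteq> W" "f ` W' \<subseteq> fst d"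
    and V: "smooth_fun N W' (\<lambda>q. to_chart M d (f q) (V q))" using loc by (metis IntD1)
  let ?W = "W' \<inter> (W \<inter> f -` fst e)"
  have oW: "openin (Topo N) (W \<inter> f -` fst e)"
    by (rule smooth_fun_openin[OF smooth_map_on_chart[OF f e]])
  have V': "smooth_fun N ?W (\<lambda>q. to_chart M d (f q) (V q))" by (rule smooth_fun_Int[OF V oW])
  have "smooth_fun N (W \<inter> f -` fst d) (\<lambda>p. snd d (f p))" by (rule smooth_map_on_chart[OF f d(1)])
  then have f': "smooth_fun N ?W (\<lambda>p. snd d (f p))"
    by (rule smooth_fun_subset) (use smooth_fun_openin[OF V'] d in auto)
  have "smooth_fun N ?W (\<lambda>q. frechet_derivative (\<lambda>x. snd e (chart_inv d x)) (at (snd d (f q))) (to_chart M d (f q) (V q)))"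
    by (rule smooth_fun_derivative[OF N f' _ transition_smooth[OF M d(1) e] V']) (use d in auto)
  then have "smooth_fun N ?W (\<lambda>q. to_chart M e (f q) (V q))"
    by (subst (asm) smooth_fun_cong[OF N, where h' = "\<lambda>q. to_chart M e (f q) (V q)"])
       (use transition_to_chart[OF M d(1) _ e] d in \<open>auto simp: transition_def\<close>)
  then show "\<exists>W'. q \<in> W' \<and> W' \<subseteq> W \<inter> f -` fst e \<and> smooth_fun N W' (\<lambda>q. to_chart M e (f q) (V q))"
    using q d by (intro exI[of _ ?W]) auto
qed (rule f)

lemma smooth_field_on_subset:
  assumes "smooth_field_on N W M f V" "openin (Topo N) W'" "W' \<subseteq> W"
  shows "smooth_field_on N W' M f V"
  unfolding smooth_field_on_def
proof (intro conjI ballI smooth_map_on_subset[OF smooth_field_on_map[OF assms(1)] assms(2,3)])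
  fix d assume d: "d \<in> Atlas M"
  have "W' \<inter> f -` fst d = (W \<inter> f -` fst d) \<inter> W'" using assms by auto
  then show "smooth_fun N (W' \<inter> f -` fst d) (\<lambda>q. to_chart M d (f q) (V q))"
    using smooth_fun_Int[OF smooth_field_on_chart[OF assms(1) d] assms(2)] by simp
qed

lemma smooth_field_on_local:
  assumes N: "smooth_atlas N" and M: "smooth_atlas M" and f: "smooth_map_on N W M f"
    and loc: "\<And>q. q \<in> W \<Longrightarrow> \<exists>W'. q \<in> W' \<and> W' \<subseteq> W \<and> smooth_field_on N W' M f V"
  shows "smooth_field_on N W M f V"
proof (rule smooth_field_onI_local[OF N M f])
  fix q assume q: "q \<in> W"
  obtain W' where W': "q \<in> W'" "W' \<subseteq> W" "smooth_field_on N W' M f V" using loc[OF q] by blast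
  obtain d where d: "d \<in> Atlas M" "f q \<in> fst d" using chart_exists[OF M smooth_map_on_points[OF f q]] .
  show "\<exists>d W'. d \<in> Atlas M \<and> q \<in> W' \<and> W' \<subseteq> W \<and> f ` W' \<subseteq> fst d \<and>
          smooth_fun N W' (\<lambda>q. to_chart M d (f q) (V q))"
    using W' d smooth_field_on_chart[OF W'(3) d(1)] by (intro exI[of _ d] exI[of _ "W' \<inter> f -` fst d"]) auto
qed

lemma smooth_field_on_cong:
  assumes N: "smooth_atlas N" and "\<And>q. q \<in> W \<Longrightarrow> f q = f' q" "\<And>q. q \<in> W \<Longrightarrow> V q = V' q"
  shows "smooth_field_on N W M f V \<longleftrightarrow> smooth_field_on N W M f' V'"
proof -
  have *: "W \<inter> f -` T = W \<inter> f' -` T" for T using assms by auto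
  have "smooth_fun N (W \<inter> f' -` fst d) (\<lambda>q. to_chart M d (f q) (V q)) =
      smooth_fun N (W \<inter> f' -` fst d) (\<lambda>q. to_chart M d (f' q) (V' q))" if "d \<in> Atlas M" for d
    by (rule smooth_fun_cong[OF N]) (use assms in auto)
  moreover have "smooth_map_on N W M f = smooth_map_on N W M f'"
    by (rule smooth_map_on_cong[OF N assms(2)])
  ultimately show ?thesis unfolding smooth_field_on_def * by (simp cong: ball_cong)
qed

lemma smooth_field_on_compose:
  assumes K: "smooth_atlas K" and N: "smooth_atlas N" and M: "smooth_atlas M"
    and h: "smooth_map_on K T N h" and V: "smooth_field_on N W M f V"
  shows "smooth_field_on K (T \<inter> h -` W) M (\<lambda>q. f (h q)) (\<lambda>q. V (h q))"
  unfolding smooth_field_on_def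
proof (intro conjI ballI)
  show "smooth_map_on K (T \<inter> h -` W) M (\<lambda>q. f (h q))"
    by (rule smooth_map_on_compose[OF K N h smooth_field_on_map[OF V]])
  fix d assume d: "d \<in> Atlas M"
  have "smooth_fun K (T \<inter> h -` (W \<inter> f -` fst d)) (\<lambda>q. to_chart M d (f (h q)) (V (h q)))"
    by (rule smooth_fun_compose_map[OF K N h smooth_field_on_chart[OF V d]])
  moreover have "T \<inter> h -` (W \<inter> f -` fst d) = T \<inter> h -` W \<inter> (\<lambda>q. f (h q)) -` fst d" by auto
  ultimately show "smooth_fun K (T \<inter> h -` W \<inter> (\<lambda>q. f (h q)) -` fst d) (\<lambda>q. to_chart M d (f (h q)) (V (h q)))"
    by simp
qed

lemma smooth_field_on_add:
  assumes N: "smooth_atlas N" and M: "smooth_atlas M"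
    and V: "smooth_field_on N W M f V" and V': "smooth_field_on N W M f V'"
  shows "smooth_field_on N W M f (\<lambda>q. V q + V' q)"
  unfolding smooth_field_on_def
proof (intro conjI ballI smooth_field_on_map[OF V])
  fix d assume d: "d \<in> Atlas M"
  show "smooth_fun N (W \<inter> f -` fst d) (\<lambda>q. to_chart M d (f q) (V q + V' q))"
    by (subst smooth_fun_cong[OF N, where h' = "\<lambda>q. to_chart M d (f q) (V q) + to_chart M d (f q) (V' q)"])
       (use smooth_fun_add[OF N smooth_field_on_chart[OF V d] smooth_field_on_chart[OF V' d]]
          linear_add[OF to_chart_linear[OF M d]] in auto)
qed

lemma smooth_field_on_zero:
  assumes N: "smooth_atlas N" and M: "smooth_atlas M" and f: "smooth_map_on N W M f"
  shows "smooth_field_on N W M f (\<lambda>q. 0)"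
  unfolding smooth_field_on_def
proof (intro conjI ballI f)
  fix d assume d: "d \<in> Atlas M"
  show "smooth_fun N (W \<inter> f -` fst d) (\<lambda>q. to_chart M d (f q) 0)"
    by (subst smooth_fun_cong[OF N, where h' = "\<lambda>q. 0"])
       (use smooth_fun_openin[OF smooth_map_on_chart[OF f d]] linear_0[OF to_chart_linear[OF M d]]
        in \<open>auto intro: smooth_fun_const\<close>)
qed

lemma smooth_field_on_tangent:
  assumes K: "smooth_atlas K" and N: "smooth_atlas N" and M: "smooth_atlas M"
    and X: "smooth_field_on K W N f X" and g: "smooth_map_on N V M g" and fW: "f ` W \<subseteq> V"
  shows "smooth_field_on K W M (\<lambda>q. g (f q)) (\<lambda>q. tangent_map N M g (f q) (X q))"
proof (rule smooth_field_onI_local[OF K M])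
  note f = smooth_field_on_map[OF X]
  show gf: "smooth_map_on K W M (\<lambda>q. g (f q))"
    by (rule smooth_map_on_compose'[OF K N f g fW])
  fix q assume q: "q \<in> W"
  obtain c where c: "c \<in> Atlas N" "f q \<in> fst c" using chart_exists[OF N smooth_map_on_points[OF f q]] .
  obtain d where d: "d \<in> Atlas M" "g (f q) \<in> fst d" using chart_exists[OF M smooth_map_on_points[OF gf q]] .
  let ?W = "(W \<inter> f -` fst c) \<inter> (W \<inter> (\<lambda>q. g (f q)) -` fst d)"
  have o: "openin (Topo K) (W \<inter> (\<lambda>q. g (f q)) -` fst d)"
    by (rule smooth_fun_openin[OF smooth_map_on_chart[OF gf d(1)]])
  have "smooth_fun K ?W (\<lambda>q. frechet_derivative (\<lambda>x. snd d (g (chart_inv c x))) (at (snd c (f q))) (to_chart N c (f q) (X q)))"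
    by (rule smooth_fun_derivative[OF K smooth_fun_Int[OF smooth_map_on_chart[OF f c(1)] o] _
          smooth_map_on_rep(1)[OF N g c(1) d(1)] smooth_fun_Int[OF smooth_field_on_chart[OF X c(1)] o]])
       (use fW in auto)
  then have "smooth_fun K ?W (\<lambda>q. to_chart M d (g (f q)) (tangent_map N M g (f q) (X q)))"
    by (subst smooth_fun_cong[OF K]) (use tangent_map_chart[OF N M g _ c(1) _ d(1)] fW in auto)
  then show "\<exists>d W'. d \<in> Atlas M \<and> q \<in> W' \<and> W' \<subseteq> W \<and> (\<lambda>q. g (f q)) ` W' \<subseteq> fst d \<and>
      smooth_fun K W' (\<lambda>q. to_chart M d (g (f q)) (tangent_map N M g (f q) (X q)))"
    using q c d by (intro exI[of _ d] exI[of _ ?W]) auto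
qed

text \<open>\<open>smooth_form_along\<close> tests a form on fields with constant components in a
  chart. The components of X along \<open>onb\<close> write the value on X as a finite combination
  of such values with smooth coefficients.\<close>

lemma smooth_form_apply:
  fixes \<alpha> :: "'b \<Rightarrow> 'f::fin_dim \<Rightarrow> 'w::real_normed_vector"
  assumes N: "smooth_atlas N" and M: "smooth_atlas M"
    and \<alpha>: "smooth_form_along M M (\<lambda>p. p) \<alpha>" and X: "smooth_field_on N W M f X"
  shows "smooth_fun N W (\<lambda>q. \<alpha> (f q) (X q))"
proof (rule smooth_fun_local[OF N])
  note f = smooth_field_on_map[OF X]
  fix q assume q: "q \<in> W"
  obtain d where d: "d \<in> Atlas M" "f q \<in> fst d" using chart_exists[OF M smooth_map_on_points[OF f q]] .
  have lin: "linear (\<alpha> p)" if "p \<in> points M" for p using \<alpha> that by (simp add: smooth_form_along_def)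
  have \<alpha>d: "smooth_fun M (fst d) (\<lambda>p. \<alpha> p (from_chart M d p v))" for v
  proof (rule smooth_funI_chart[OF M d(1) chart_openin[OF M d(1)] order_refl])
    have "\<forall>c\<in>Atlas M. \<forall>d\<in>Atlas M. \<forall>v. smooth_on (snd c ` (fst c \<inter> fst d))
        (\<lambda>x. \<alpha> (chart_inv c x) (from_chart M d (chart_inv c x) v))"
      using \<alpha> by (simp add: smooth_form_along_def split_beta Let_def)
    from this[rule_format, OF d(1) d(1), of v]
    show "smooth_on (snd d ` fst d) (\<lambda>x. \<alpha> (chart_inv d x) (from_chart M d (chart_inv d x) v))"
      by simp
  qed (use M d in auto)
  let ?W = "W \<inter> f -` fst d"
  have "smooth_fun N ?W (\<lambda>q. \<Sum>b\<in>onb. (to_chart M d (f q) (X q) \<bullet> b) *\<^sub>R \<alpha> (f q) (from_chart M d (f q) b))"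
  proof (intro smooth_fun_sum[OF N finite_onb] smooth_fun_bilinear[OF N bounded_bilinear_scaleR])
    show "openin (Topo N) ?W" by (rule smooth_fun_openin[OF smooth_map_on_chart[OF f d(1)]])
    show "smooth_fun N ?W (\<lambda>q. to_chart M d (f q) (X q) \<bullet> b)" for b
      by (rule smooth_fun_linear[OF N bounded_linear_inner_left smooth_field_on_chart[OF X d(1)]])
    show "smooth_fun N ?W (\<lambda>q. \<alpha> (f q) (from_chart M d (f q) b))" for b
      by (rule smooth_fun_compose_map[OF N M f \<alpha>d])
  qed
  moreover have "\<alpha> (f q) (X q) = (\<Sum>b\<in>onb. (to_chart M d (f q) (X q) \<bullet> b) *\<^sub>R \<alpha> (f q) (from_chart M d (f q) b))"
    if "q \<in> ?W" for q
  proof -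
    have "linear (\<lambda>v. \<alpha> (f q) (from_chart M d (f q) v))"
      using linear_compose[OF from_chart_linear[OF M d(1)] lin] that smooth_map_on_points[OF f] by (auto simp: comp_def)
    then have "\<alpha> (f q) (from_chart M d (f q) (to_chart M d (f q) (X q))) =
        (\<Sum>b\<in>onb. (to_chart M d (f q) (X q) \<bullet> b) *\<^sub>R \<alpha> (f q) (from_chart M d (f q) b))"
      by (rule linear_onb_expansion)
    then show ?thesis using that from_to_chart[OF M d(1)] by simp
  qed
  ultimately have "smooth_fun N ?W (\<lambda>q. \<alpha> (f q) (X q))" by (subst smooth_fun_cong[OF N]) auto
  then show "\<exists>W'. q \<in> W' \<and> W' \<subseteq> W \<and> smooth_fun N W' (\<lambda>q. \<alpha> (f q) (X q))"
    using q d by (intro exI[of _ ?W]) auto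
qed

section \<open>Open submanifolds and products\<close>

lemma Atlas_open_submfd: "Atlas (open_submfd M V) = (\<lambda>c. (fst c \<inter> V, snd c)) ` Atlas M"
  by (simp add: open_submfd_def split_beta)

lemma points_open_submfd: "points (open_submfd M V) = points M \<inter> V"
  by (simp add: open_submfd_def points_def)

lemma openin_open_submfd:
  "openin (Topo M) V \<Longrightarrow> openin (Topo (open_submfd M V)) W \<longleftrightarrow> openin (Topo M) W \<and> W \<subseteq> V"
  by (auto simp: open_submfd_def openin_open_subtopology)

text \<open>\<open>chart_inv\<close> is \<open>inv_into\<close> of the chart domain, so shrinking
  the domain changes the function; the two inverses are only known to agree at coordinates of points
  that remain.\<close>

lemma chart_inv_restrict:
  assumes "smooth_atlas M" "c \<in> Atlas M" "p \<in> fst c" "p \<in> V"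
  shows "chart_inv (fst c \<inter> V, snd c) (snd c p) = p"
  using assms inj_on_subset[OF chart_inj[OF assms(1,2)], of "fst c \<inter> V"]
  by (simp add: chart_inv_def inv_into_f_f)

lemma smooth_atlas_open_submfd:
  assumes M: "smooth_atlas M" and V: "openin (Topo M) V"
  shows "smooth_atlas (open_submfd M V)"
  unfolding smooth_atlas_def
proof (intro conjI ballI allI impI)
  fix c' assume "c' \<in> Atlas (open_submfd M V)"
  then obtain c where c: "c \<in> Atlas M" "c' = (fst c \<inter> V, snd c)" by (auto simp: Atlas_open_submfd)
  show "openin (Topo (open_submfd M V)) (fst c')"
    using c M V by (auto simp: openin_open_submfd intro: openin_Int chart_openin)
  show "inj_on (snd c') (fst c')"
    using c chart_inj[OF M c(1)] by (auto intro: inj_on_subset)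
  show "open (snd c' ` (fst c' \<inter> W))" if "openin (Topo (open_submfd M V)) W" for W
  proof -
    have "fst c' \<inter> W = fst c \<inter> W" using that c V by (auto simp: openin_open_submfd)
    then show ?thesis using that c V chart_open_image[OF M c(1)] by (simp add: openin_open_submfd)
  qed
  show "openin (Topo (open_submfd M V)) (fst c' \<inter> snd c' -` T)" if "open T" for T
  proof -
    have "fst c' \<inter> snd c' -` T = (fst c \<inter> snd c -` T) \<inter> V" using c by auto
    then show ?thesis using chart_preimage[OF M c(1) that] V by (auto simp: openin_open_submfd)
  qed
  fix d' assume "d' \<in> Atlas (open_submfd M V)"
  then obtain d where d: "d \<in> Atlas M" "d' = (fst d \<inter> V, snd d)" by (auto simp: Atlas_open_submfd)
  have eq: "fst c' \<inter> fst d' = fst c \<inter> (fst d \<inter> V)" using c d by auto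
  have "smooth_on (snd c ` (fst c \<inter> (fst d \<inter> V))) (\<lambda>x. snd d (chart_inv c x))"
    by (rule smooth_on_subset[OF transition_smooth[OF M c(1) d(1)]]) auto
  then have "smooth_on (snd c ` (fst c \<inter> (fst d \<inter> V))) (\<lambda>x. snd d' (chart_inv c' x))"
    by (subst smooth_on_cong[OF chart_open_image[OF M c(1)]])
       (use c d M V chart_inv_restrict[OF M c(1)] in \<open>auto intro: openin_Int chart_openin\<close>)
  then show "smooth_on (snd c' ` (fst c' \<inter> fst d')) (\<lambda>x. snd d' (chart_inv c' x))"
    using c eq by simp
next
  have "(\<Union>c\<in>Atlas M. fst c) = points M" using M by (simp add: smooth_atlas_def)
  then show "(\<Union>c\<in>Atlas (open_submfd M V). fst c) = points (open_submfd M V)"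
    by (auto simp: Atlas_open_submfd points_open_submfd)
qed

lemma smooth_fun_open_submfd:
  assumes M: "smooth_atlas M" and V: "openin (Topo M) V" and h: "smooth_fun (open_submfd M V) W h"
  shows "smooth_fun M W h"
  unfolding smooth_fun_def
proof (intro conjI ballI)
  have W: "openin (Topo M) W" "W \<subseteq> V" using smooth_fun_openin[OF h] V by (auto simp: openin_open_submfd)
  show "openin (Topo M) W" by fact
  fix c assume c: "c \<in> Atlas M"
  then have "(fst c \<inter> V, snd c) \<in> Atlas (open_submfd M V)" by (auto simp: Atlas_open_submfd)
  from smooth_fun_chart[OF h this] have "smooth_on (snd c ` (fst c \<inter> W)) (\<lambda>x. h (chart_inv (fst c \<inter> V, snd c) x))"
    using W by (simp add: Int_assoc Int_absorb1)
  then show "smooth_on (snd c ` (fst c \<inter> W)) (\<lambda>x. h (chart_inv c x))"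
    by (subst smooth_on_cong[OF chart_open_image[OF M c W(1)]])
       (use M c W chart_inv_restrict[OF M c] in auto)
qed

text \<open>Local trivializations are stated for open submanifolds. This lemma for the source and
  the next one for the target move them to the full manifolds, where maps compose without further
  restriction of charts.\<close>

lemma smooth_map_on_from_open_submfd:
  assumes M: "smooth_atlas M" and V: "openin (Topo M) V" and f: "smooth_map_on (open_submfd M V) W K f"
  shows "smooth_map_on M W K f"
  unfolding smooth_map_on_def
  using smooth_map_on_openin[OF f] V smooth_map_on_points[OF f]
    smooth_fun_open_submfd[OF M V smooth_map_on_chart[OF f]]
  by (auto simp: openin_open_submfd)

lemma smooth_map_on_into_open_submfd:
  assumes f: "smooth_map_on K W (open_submfd M V) f"
  shows "smooth_map_on K W M f"
  unfolding smooth_map_on_def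
proof (intro conjI ballI smooth_map_on_openin[OF f])
  have fV: "f ` W \<subseteq> points M \<inter> V"
    using smooth_map_on_points[OF f] by (auto simp: points_open_submfd)
  then show "f ` W \<subseteq> points M" by auto
  fix d assume "d \<in> Atlas M"
  then have "(fst d \<inter> V, snd d) \<in> Atlas (open_submfd M V)" by (auto simp: Atlas_open_submfd)
  from smooth_map_on_chart[OF f this]
  have "smooth_fun K (W \<inter> f -` (fst d \<inter> V)) (\<lambda>p. snd d (f p))" by simp
  moreover have "W \<inter> f -` (fst d \<inter> V) = W \<inter> f -` fst d" using fV by auto
  ultimately show "smooth_fun K (W \<inter> f -` fst d) (\<lambda>p. snd d (f p))" by simp
qed

text \<open>The way back, needed to exhibit members of \<open>Ad_sections\<close>, whose definition
  speaks of \<open>open_submfd\<close>.\<close>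

lemma smooth_map_open_submfdI:
  assumes M: "smooth_atlas M" and K: "smooth_atlas K" and h: "smooth_map_on M V K h"
  shows "smooth_map (open_submfd M V) K h"
  unfolding smooth_map_def
proof (intro conjI)
  note V = smooth_map_on_openin[OF h]
  have ts: "topspace (Topo (open_submfd M V)) = V"
    using openin_subset[OF V] points_open_submfd[of M V] by (auto simp: points_def)
  show "continuous_map (Topo (open_submfd M V)) (Topo K) h"
    unfolding continuous_map_def
  proof (intro conjI allI impI)
    show "h \<in> topspace (Topo (open_submfd M V)) \<rightarrow> topspace (Topo K)"
      using smooth_map_on_points[OF h] unfolding ts by (auto simp: points_def)
    fix U assume "openin (Topo K) U"
    from smooth_map_on_preimage[OF M K h this]
    have "openin (Topo (open_submfd M V)) (V \<inter> h -` U)"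
      by (simp add: openin_open_submfd[OF V])
    moreover have "V \<inter> h -` U = {x \<in> topspace (Topo (open_submfd M V)). h x \<in> U}"
      unfolding ts by auto
    ultimately show "openin (Topo (open_submfd M V)) {x \<in> topspace (Topo (open_submfd M V)). h x \<in> U}" by simp
  qed
  have "smooth_on (snd c ` ((fst c \<inter> V) \<inter> h -` fst d)) (\<lambda>x. snd d (h (chart_inv (fst c \<inter> V, snd c) x)))"
    if c: "c \<in> Atlas M" and d: "d \<in> Atlas K" for c d
  proof -
    have o: "open (snd c ` (fst c \<inter> (V \<inter> h -` fst d)))"
      by (rule smooth_map_on_rep(2)[OF M h c d])
    have "smooth_on (snd c ` (fst c \<inter> (V \<inter> h -` fst d))) (\<lambda>x. snd d (h (chart_inv (fst c \<inter> V, snd c) x)))"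
      by (subst smooth_on_cong[OF o, of _ "\<lambda>x. snd d (h (chart_inv c x))"])
         (use smooth_map_on_rep(1)[OF M h c d] chart_inv_restrict[OF M c] M c in auto)
    then show ?thesis by (simp add: Int_assoc)
  qed
  then show "\<forall>(D, \<phi>)\<in>Atlas (open_submfd M V). \<forall>(E, \<psi>)\<in>Atlas K.
      smooth_on (\<phi> ` (D \<inter> h -` E)) (\<psi> \<circ> h \<circ> chart_inv (D, \<phi>))"
    by (auto simp: Atlas_open_submfd comp_def split_beta)
qed

lemma Atlas_prod_mfd:
  "Atlas (prod_mfd M N) = {(fst c \<times> fst e, map_prod (snd c) (snd e)) | c e. c \<in> Atlas M \<and> e \<in> Atlas N}"
  by (auto simp: prod_mfd_def)

lemma prod_chart:
  "c \<in> Atlas M \<Longrightarrow> e \<in> Atlas N \<Longrightarrow> (fst c \<times> fst e, map_prod (snd c) (snd e)) \<in> Atlas (prod_mfd M N)"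
  unfolding Atlas_prod_mfd by blast

lemma points_prod_mfd: "points (prod_mfd M N) = points M \<times> points N"
  by (simp add: prod_mfd_def points_def)

lemma chart_inv_prod:
  assumes "smooth_atlas M" "smooth_atlas N" "c \<in> Atlas M" "e \<in> Atlas N" "p \<in> fst c" "q \<in> fst e"
  shows "chart_inv (fst c \<times> fst e, map_prod (snd c) (snd e)) (snd c p, snd e q) = (p, q)"
proof -
  have "inj_on (map_prod (snd c) (snd e)) (fst c \<times> fst e)"
    by (rule map_prod_inj_on[OF chart_inj[OF assms(1,3)] chart_inj[OF assms(2,4)]])
  from inv_into_f_f[OF this, of "(p, q)"] show ?thesis using assms by (simp add: chart_inv_def)
qed

lemma smooth_atlas_prod:
  assumes M: "smooth_atlas M" and N: "smooth_atlas N"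
  shows "smooth_atlas (prod_mfd M N)"
  unfolding smooth_atlas_def
proof (intro conjI ballI allI impI)
  have T: "Topo (prod_mfd M N) = prod_topology (Topo M) (Topo N)" by (simp add: prod_mfd_def)
  fix x assume "x \<in> Atlas (prod_mfd M N)"
  then obtain c e where c: "c \<in> Atlas M" and e: "e \<in> Atlas N"
    and x: "x = (fst c \<times> fst e, map_prod (snd c) (snd e))" by (auto simp: Atlas_prod_mfd)
  show o: "openin (Topo (prod_mfd M N)) (fst x)"
    using chart_openin[OF M c] chart_openin[OF N e] by (simp add: x T openin_prod_Times_iff)
  show "inj_on (snd x) (fst x)"
    unfolding x by (simp add: map_prod_inj_on chart_inj[OF M c] chart_inj[OF N e])
  show "open (snd x ` (fst x \<inter> W))" if W: "openin (Topo (prod_mfd M N)) W" for W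
    unfolding open_prod_def
  proof
    fix y assume "y \<in> snd x ` (fst x \<inter> W)"
    then obtain p q where pq: "p \<in> fst c" "q \<in> fst e" "(p, q) \<in> W" "y = (snd c p, snd e q)"
      by (auto simp: x)
    obtain U U' where U: "openin (Topo M) U" "openin (Topo N) U'" "p \<in> U" "q \<in> U'" "U \<times> U' \<subseteq> W"
      using W pq(3) unfolding T openin_prod_topology_alt by metis
    have "snd c ` (fst c \<inter> U) \<times> snd e ` (fst e \<inter> U') \<subseteq> snd x ` (fst x \<inter> W)"
      using U(5) by (fastforce simp: x)
    then show "\<exists>A B. open A \<and> open B \<and> y \<in> A \<times> B \<and> A \<times> B \<subseteq> snd x ` (fst x \<inter> W)"
      using pq U chart_open_image[OF M c U(1)] chart_open_image[OF N e U(2)]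
      by (intro exI[of _ "snd c ` (fst c \<inter> U)"] exI[of _ "snd e ` (fst e \<inter> U')"]) auto
  qed
  show "openin (Topo (prod_mfd M N)) (fst x \<inter> snd x -` T')" if T': "open T'" for T'
    unfolding T openin_prod_topology_alt
  proof (intro allI impI)
    fix p q assume "(p, q) \<in> fst x \<inter> snd x -` T'"
    then have pq: "p \<in> fst c" "q \<in> fst e" "(snd c p, snd e q) \<in> T'" by (auto simp: x)
    obtain A B where AB: "open A" "open B" "snd c p \<in> A" "snd e q \<in> B" "A \<times> B \<subseteq> T'"
      using T' pq(3) unfolding open_prod_def by fastforce
    then show "\<exists>U V. openin (Topo M) U \<and> openin (Topo N) V \<and> p \<in> U \<and> q \<in> V \<and> U \<times> V \<subseteq> fst x \<inter> snd x -` T'"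
      using pq chart_preimage[OF M c AB(1)] chart_preimage[OF N e AB(2)]
      by (intro exI[of _ "fst c \<inter> snd c -` A"] exI[of _ "fst e \<inter> snd e -` B"]) (auto simp: x)
  qed
  fix x' assume "x' \<in> Atlas (prod_mfd M N)"
  then obtain c' e' where c': "c' \<in> Atlas M" and e': "e' \<in> Atlas N"
    and x': "x' = (fst c' \<times> fst e', map_prod (snd c') (snd e'))" by (auto simp: Atlas_prod_mfd)
  let ?A = "snd c ` (fst c \<inter> fst c')" and ?B = "snd e ` (fst e \<inter> fst e')"
  have eq: "snd x ` (fst x \<inter> fst x') = ?A \<times> ?B" by (fastforce simp: x x')
  have AB: "open (?A \<times> ?B)"
    by (intro open_Times chart_open_image[OF M c] chart_open_image[OF N e] chart_openin[OF M c'] chart_openin[OF N e'])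
  have "smooth_on (?A \<times> ?B) (\<lambda>z. snd c' (chart_inv c (fst z)))"
    by (rule smooth_on_compose[OF AB _ transition_smooth[OF M c c']])
       (auto intro: smooth_on_linear bounded_linear_fst)
  moreover have "smooth_on (?A \<times> ?B) (\<lambda>z. snd e' (chart_inv e (snd z)))"
    by (rule smooth_on_compose[OF AB _ transition_smooth[OF N e e']])
       (auto intro: smooth_on_linear bounded_linear_snd)
  ultimately have "smooth_on (?A \<times> ?B) (\<lambda>z. (snd c' (chart_inv c (fst z)), snd e' (chart_inv e (snd z))))"
    by (rule smooth_on_Pair[OF AB])
  then show "smooth_on (snd x ` (fst x \<inter> fst x')) (\<lambda>y. snd x' (chart_inv x y))"
    unfolding eq by (subst smooth_on_cong[OF AB])
      (use M N c e chart_inv_prod[OF M N c e] in \<open>auto simp: x x'\<close>)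
next
  have "(\<Union>c\<in>Atlas M. fst c) = points M" "(\<Union>c\<in>Atlas N. fst c) = points N"
    using M N by (simp_all add: smooth_atlas_def)
  moreover have "(\<Union>c\<in>Atlas (prod_mfd M N). fst c) = (\<Union>c\<in>Atlas M. fst c) \<times> (\<Union>c\<in>Atlas N. fst c)"
    by (force simp: Atlas_prod_mfd)
  ultimately show "(\<Union>c\<in>Atlas (prod_mfd M N). fst c) = points (prod_mfd M N)"
    by (simp add: points_prod_mfd)
qed

lemma smooth_map_on_Pair:
  assumes K: "smooth_atlas K" and a: "smooth_map_on K W M a" and b: "smooth_map_on K W N b"
  shows "smooth_map_on K W (prod_mfd M N) (\<lambda>x. (a x, b x))"
  unfolding smooth_map_on_def
proof (intro conjI ballI smooth_map_on_openin[OF a])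
  show "(\<lambda>x. (a x, b x)) ` W \<subseteq> points (prod_mfd M N)"
    using smooth_map_on_points[OF a] smooth_map_on_points[OF b] by (auto simp: points_prod_mfd)
  fix d assume "d \<in> Atlas (prod_mfd M N)"
  then obtain c e where c: "c \<in> Atlas M" and e: "e \<in> Atlas N"
    and d: "d = (fst c \<times> fst e, map_prod (snd c) (snd e))" by (auto simp: Atlas_prod_mfd)
  let ?W = "(W \<inter> a -` fst c) \<inter> (W \<inter> b -` fst e)"
  have "smooth_fun K ?W (\<lambda>x. (snd c (a x), snd e (b x)))"
    using smooth_fun_Int[OF smooth_map_on_chart[OF a c] smooth_fun_openin[OF smooth_map_on_chart[OF b e]]]
      smooth_fun_Int[OF smooth_map_on_chart[OF b e] smooth_fun_openin[OF smooth_map_on_chart[OF a c]]]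
    by (intro smooth_fun_Pair[OF K]) (auto simp: Int_commute)
  moreover have "?W = W \<inter> (\<lambda>x. (a x, b x)) -` fst d" by (auto simp: d)
  ultimately show "smooth_fun K (W \<inter> (\<lambda>x. (a x, b x)) -` fst d) (\<lambda>p. snd d (a p, b p))"
    by (simp add: d)
qed

text \<open>A product chart also involves a chart of the first factor; any chart around
  \<open>a p\<close> will do, and only the second coordinate is kept.\<close>

lemma smooth_map_on_prod_snd:
  assumes K: "smooth_atlas K" and M: "smooth_atlas M" and N: "smooth_atlas N"
    and f: "smooth_map_on K W (prod_mfd M N) (\<lambda>x. (a x, b x))"
  shows "smooth_map_on K W N b"
  unfolding smooth_map_on_def
proof (intro conjI ballI smooth_map_on_openin[OF f])
  have pts: "a x \<in> points M" "b x \<in> points N" if "x \<in> W" for x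
    using smooth_map_on_points[OF f that] by (auto simp: points_prod_mfd)
  then show "b ` W \<subseteq> points N" by auto
  fix e assume e: "e \<in> Atlas N"
  show "smooth_fun K (W \<inter> b -` fst e) (\<lambda>p. snd e (b p))"
  proof (rule smooth_fun_local[OF K])
    fix p assume p: "p \<in> W \<inter> b -` fst e"
    then obtain c where c: "c \<in> Atlas M" "a p \<in> fst c" using chart_exists[OF M pts(1)] by blast
    let ?d = "(fst c \<times> fst e, map_prod (snd c) (snd e))"
    have d: "?d \<in> Atlas (prod_mfd M N)" using c e by (simp add: prod_chart)
    have "smooth_fun K (W \<inter> (\<lambda>x. (a x, b x)) -` fst ?d) (\<lambda>x. snd (snd ?d (a x, b x)))"
      by (rule smooth_fun_linear[OF K bounded_linear_snd smooth_map_on_chart[OF f d]])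
    then show "\<exists>W'. p \<in> W' \<and> W' \<subseteq> W \<inter> b -` fst e \<and> smooth_fun K W' (\<lambda>p. snd e (b p))"
      using p c by (intro exI[of _ "W \<inter> (\<lambda>x. (a x, b x)) -` fst ?d"]) auto
  qed
qed

section \<open>Partial tangent maps of maps of two variables\<close>

text \<open>Made for the bundle action and the group multiplication, with both arguments moving. For
  the action, the partial tangent map in the point is \<open>T_act\<close>, and the one in the group
  variable at the unit is \<open>generator\<close>.\<close>

locale smooth_two_var =
  fixes M1 :: "('a, 'e::fin_dim) mfd" and M2 :: "('b, 'f::fin_dim) mfd" and K :: "('c, 'k::fin_dim) mfd"
    and F :: "'a \<times> 'b \<Rightarrow> 'c"
  assumes M1: "smooth_atlas M1" and M2: "smooth_atlas M2" and K: "smooth_atlas K"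
    and F: "smooth_map (prod_mfd M1 M2) K F"
begin

lemma F_on: "smooth_map_on (prod_mfd M1 M2) (points M1 \<times> points M2) K F"
  using smooth_map_imp_on[OF smooth_atlas_prod[OF M1 M2] K F] by (simp add: points_prod_mfd)

lemma smooth_F:
  assumes "smooth_atlas N" "smooth_map_on N W M1 a" "smooth_map_on N W M2 b"
  shows "smooth_map_on N W K (\<lambda>x. F (a x, b x))"
  by (rule smooth_map_on_compose'[OF assms(1) smooth_atlas_prod[OF M1 M2] smooth_map_on_Pair[OF assms] F_on])
     (use smooth_map_on_points[OF assms(2)] smooth_map_on_points[OF assms(3)] in auto)

lemma smooth_F1: "q \<in> points M2 \<Longrightarrow> smooth_map_on M1 (points M1) K (\<lambda>y. F (y, q))"
  by (intro smooth_F M1 smooth_map_on_id smooth_map_on_const) auto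

lemma smooth_F2: "p \<in> points M1 \<Longrightarrow> smooth_map_on M2 (points M2) K (\<lambda>z. F (p, z))"
  by (intro smooth_F M2 smooth_map_on_id smooth_map_on_const) auto

abbreviation (input) dom where
  "dom c e k \<equiv> map_prod (snd c) (snd e) ` ((fst c \<times> fst e) \<inter> F -` fst k)"

abbreviation (input) rep where
  "rep c e k \<equiv> (\<lambda>z. snd k (F (chart_inv c (fst z), chart_inv e (snd z))))"

lemma rep_smooth:
  assumes c: "c \<in> Atlas M1" and e: "e \<in> Atlas M2" and k: "k \<in> Atlas K"
  shows "open (dom c e k)" "smooth_on (dom c e k) (rep c e k)"
proof -
  let ?d = "(fst c \<times> fst e, map_prod (snd c) (snd e))"
  have d: "?d \<in> Atlas (prod_mfd M1 M2)" using c e by (simp add: prod_chart)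
  have eq: "fst ?d \<inter> (points M1 \<times> points M2 \<inter> F -` fst k) = (fst c \<times> fst e) \<inter> F -` fst k"
    using chart_subset[OF M1 c] chart_subset[OF M2 e] by auto
  show o: "open (dom c e k)"
    using smooth_map_on_rep(2)[OF smooth_atlas_prod[OF M1 M2] F_on d k] unfolding eq by simp
  have "smooth_on (dom c e k) (\<lambda>x. snd k (F (chart_inv ?d x)))"
    using smooth_map_on_rep(1)[OF smooth_atlas_prod[OF M1 M2] F_on d k] unfolding eq by simp
  then show "smooth_on (dom c e k) (rep c e k)"
    by (subst smooth_on_cong[OF o])
       (use M1 M2 c e chart_inv_prod[OF M1 M2 c e] in auto)
qed

lemma tangent_F:
  assumes N: "smooth_atlas N" and a: "smooth_map_on N W M1 a" and b: "smooth_map_on N W M2 b" and x: "x \<in> W"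
    and c: "c \<in> Atlas M1" "a x \<in> fst c" and e: "e \<in> Atlas M2" "b x \<in> fst e"
    and k: "k \<in> Atlas K" "F (a x, b x) \<in> fst k"
  shows "to_chart K k (F (a x, b x)) (tangent_map N K (\<lambda>x. F (a x, b x)) x v) =
    frechet_derivative (rep c e k) (at (snd c (a x), snd e (b x)))
      (to_chart M1 c (a x) (tangent_map N M1 a x v), to_chart M2 e (b x) (tangent_map N M2 b x v))"
proof -
  have "x \<in> points N" using x openin_subset[OF smooth_map_on_openin[OF a]] by (auto simp: points_def)
  then obtain n where n: "n \<in> Atlas N" "x \<in> fst n" using chart_exists[OF N] by blast
  note Fab = smooth_F[OF N a b]
  let ?A = "frechet_derivative (\<lambda>y. snd c (a (chart_inv n y))) (at (snd n x))"
  let ?B = "frechet_derivative (\<lambda>y. snd e (b (chart_inv n y))) (at (snd n x))"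
  let ?D = "frechet_derivative (rep c e k) (at (snd c (a x), snd e (b x)))"
  define W' where "W' = (W \<inter> a -` fst c) \<inter> (W \<inter> b -` fst e)"
  have W': "openin (Topo N) W'" unfolding W'_def
    by (intro openin_Int smooth_fun_openin[OF smooth_map_on_chart[OF a c(1)]]
        smooth_fun_openin[OF smooth_map_on_chart[OF b e(1)]])
  have 0: "(rep c e k has_derivative ?D) (at (snd c (a x), snd e (b x)))"
    by (rule smooth_on_has_derivative[OF rep_smooth(2)[OF c(1) e(1) k(1)]])
       (use c e k in \<open>auto intro!: image_eqI[of _ _ "(a x, b x)"]\<close>)
  have 1: "((\<lambda>y. (snd c (a (chart_inv n y)), snd e (b (chart_inv n y)))) has_derivative (\<lambda>u. (?A u, ?B u))) (at (snd n x))"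
    by (intro has_derivative_Pair smooth_map_on_has_derivative[OF N a x n c] smooth_map_on_has_derivative[OF N b x n e])
  have 2: "((\<lambda>y. rep c e k (snd c (a (chart_inv n y)), snd e (b (chart_inv n y)))) has_derivative
      (\<lambda>u. ?D (?A u, ?B u))) (at (snd n x))"
    by (rule has_derivative_compose[OF 1]) (use 0 N n in simp)
  have "((\<lambda>y. snd k (F (a (chart_inv n y), b (chart_inv n y)))) has_derivative (\<lambda>u. ?D (?A u, ?B u))) (at (snd n x))"
    by (rule has_derivative_transform_within_open[OF 2 chart_open_image[OF N n(1) W']])
       (use N n c e x M1 M2 in \<open>auto simp: W'_def\<close>)
  from frechet_derivative_eqI[OF this] show ?thesis
    using tangent_map_chart[OF N K Fab x n k] tangent_map_chart[OF N M1 a x n c]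
      tangent_map_chart[OF N M2 b x n e] by simp
qed

lemma tangent_F1:
  assumes p: "p \<in> fst c" and q: "q \<in> fst e" and c: "c \<in> Atlas M1" and e: "e \<in> Atlas M2"
    and k: "k \<in> Atlas K" "F (p, q) \<in> fst k"
  shows "to_chart K k (F (p, q)) (tangent_map M1 K (\<lambda>y. F (y, q)) p v) =
    frechet_derivative (rep c e k) (at (snd c p, snd e q)) (to_chart M1 c p v, 0)"
proof -
  have pt: "p \<in> points M1" "q \<in> points M2" using chart_subset[OF M1 c] chart_subset[OF M2 e] p q by auto
  have "to_chart M2 e q 0 = 0" by (rule linear_0[OF to_chart_linear[OF M2 e q]])
  then show ?thesis
    using tangent_F[OF M1 smooth_map_on_id[OF M1 points_openin] smooth_map_on_const[OF points_openin pt(2)] pt(1) c _ e _ k(1)]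
      p q k tangent_map_id[OF M1 pt(1)] by (simp add: tangent_map_const)
qed

lemma tangent_F2:
  assumes p: "p \<in> fst c" and q: "q \<in> fst e" and c: "c \<in> Atlas M1" and e: "e \<in> Atlas M2"
    and k: "k \<in> Atlas K" "F (p, q) \<in> fst k"
  shows "to_chart K k (F (p, q)) (tangent_map M2 K (\<lambda>z. F (p, z)) q w) =
    frechet_derivative (rep c e k) (at (snd c p, snd e q)) (0, to_chart M2 e q w)"
proof -
  have pt: "p \<in> points M1" "q \<in> points M2" using chart_subset[OF M1 c] chart_subset[OF M2 e] p q by auto
  have "to_chart M1 c p 0 = 0" by (rule linear_0[OF to_chart_linear[OF M1 c p]])
  then show ?thesis
    using tangent_F[OF M2 smooth_map_on_const[OF points_openin pt(1)] smooth_map_on_id[OF M2 points_openin] pt(2) c _ e _ k(1)]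
      p q k tangent_map_id[OF M2 pt(2)] by (simp add: tangent_map_const)
qed

text \<open>Product rule: the derivative of the local expression of F is linear in the pair of
  directions, and (u, w) splits as (u, 0) + (0, w). The two summands are partial tangent maps by
  \<open>tangent_F1\<close> and \<open>tangent_F2\<close>.\<close>

lemma tangent_two_var:
  assumes N: "smooth_atlas N" and a: "smooth_map_on N W M1 a" and b: "smooth_map_on N W M2 b" and x: "x \<in> W"
  shows "tangent_map N K (\<lambda>x. F (a x, b x)) x v =
    tangent_map M1 K (\<lambda>y. F (y, b x)) (a x) (tangent_map N M1 a x v) +
    tangent_map M2 K (\<lambda>z. F (a x, z)) (b x) (tangent_map N M2 b x v)"
proof -
  obtain c where c: "c \<in> Atlas M1" "a x \<in> fst c" using chart_exists[OF M1 smooth_map_on_points[OF a x]] .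
  obtain e where e: "e \<in> Atlas M2" "b x \<in> fst e" using chart_exists[OF M2 smooth_map_on_points[OF b x]] .
  obtain k where k: "k \<in> Atlas K" "F (a x, b x) \<in> fst k"
    using chart_exists[OF K smooth_map_on_points[OF smooth_F[OF N a b] x]] .
  let ?D = "frechet_derivative (rep c e k) (at (snd c (a x), snd e (b x)))"
  have "linear ?D"
    by (rule has_derivative_linear[OF smooth_on_has_derivative[OF rep_smooth(2)[OF c(1) e(1) k(1)]]])
       (use c e k in \<open>auto intro!: image_eqI[of _ _ "(a x, b x)"]\<close>)
  then have split: "?D (u, w) = ?D (u, 0) + ?D (0, w)" for u w
    using linear_add[of ?D "(u, 0)" "(0, w)"] by simp
  let ?u = "tangent_map M1 K (\<lambda>y. F (y, b x)) (a x) (tangent_map N M1 a x v)"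
  let ?w = "tangent_map M2 K (\<lambda>z. F (a x, z)) (b x) (tangent_map N M2 b x v)"
  have "to_chart K k (F (a x, b x)) (tangent_map N K (\<lambda>x. F (a x, b x)) x v) =
      to_chart K k (F (a x, b x)) ?u + to_chart K k (F (a x, b x)) ?w"
    unfolding tangent_F[OF N a b x c e k] tangent_F1[OF c(2) e(2) c(1) e(1) k] tangent_F2[OF c(2) e(2) c(1) e(1) k]
    by (rule split)
  also have "\<dots> = to_chart K k (F (a x, b x)) (?u + ?w)"
    by (rule linear_add[OF to_chart_linear[OF K k], symmetric])
  finally show ?thesis by (simp only: to_chart_eq_iff[OF K k])
qed

text \<open>The partial tangent map depends on x also through the argument held fixed, so it is not
  the tangent map of one smooth map and \<open>smooth_field_on_tangent\<close> does not apply. In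
  charts it is the full derivative of the local expression at a moving point, applied to a pair with
  one zero entry.\<close>

lemma smooth_field_partial:
  assumes N: "smooth_atlas N" and a: "smooth_map_on N W M1 a" and b: "smooth_map_on N W M2 b"
  shows "smooth_field_on N W M1 a X \<Longrightarrow>
      smooth_field_on N W K (\<lambda>x. F (a x, b x)) (\<lambda>x. tangent_map M1 K (\<lambda>y. F (y, b x)) (a x) (X x))"
    and "smooth_field_on N W M2 b Y \<Longrightarrow>
      smooth_field_on N W K (\<lambda>x. F (a x, b x)) (\<lambda>x. tangent_map M2 K (\<lambda>z. F (a x, z)) (b x) (Y x))"
proof -
  note Fab = smooth_F[OF N a b]
  \<comment> \<open>Serves both partial maps: S and T are the chart components of the two
    directions, one of which is zero in each use.\<close>
  have main: "smooth_field_on N W K (\<lambda>x. F (a x, b x)) Z"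
    if Z: "\<And>x c e k. x \<in> W \<Longrightarrow> c \<in> Atlas M1 \<Longrightarrow> a x \<in> fst c \<Longrightarrow> e \<in> Atlas M2 \<Longrightarrow> b x \<in> fst e \<Longrightarrow>
        k \<in> Atlas K \<Longrightarrow> F (a x, b x) \<in> fst k \<Longrightarrow> to_chart K k (F (a x, b x)) (Z x) =
        frechet_derivative (rep c e k) (at (snd c (a x), snd e (b x))) (S c x, T e x)"
      and S: "\<And>c. c \<in> Atlas M1 \<Longrightarrow> smooth_fun N (W \<inter> a -` fst c) (S c)"
      and T: "\<And>e. e \<in> Atlas M2 \<Longrightarrow> smooth_fun N (W \<inter> b -` fst e) (T e)" for Z S T
  proof (rule smooth_field_onI_local[OF N K Fab])
    fix x assume x: "x \<in> W"
    obtain c where c: "c \<in> Atlas M1" "a x \<in> fst c" using chart_exists[OF M1 smooth_map_on_points[OF a x]] .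
    obtain e where e: "e \<in> Atlas M2" "b x \<in> fst e" using chart_exists[OF M2 smooth_map_on_points[OF b x]] .
    obtain k where k: "k \<in> Atlas K" "F (a x, b x) \<in> fst k"
      using chart_exists[OF K smooth_map_on_points[OF Fab x]] .
    define W' where "W' = (W \<inter> a -` fst c) \<inter> (W \<inter> b -` fst e) \<inter> (W \<inter> (\<lambda>x. F (a x, b x)) -` fst k)"
    have W': "openin (Topo N) W'" unfolding W'_def
      by (intro openin_Int smooth_fun_openin[OF smooth_map_on_chart[OF a c(1)]]
          smooth_fun_openin[OF smooth_map_on_chart[OF b e(1)]] smooth_fun_openin[OF smooth_map_on_chart[OF Fab k(1)]])
    have "smooth_fun N W' (\<lambda>x. (snd c (a x), snd e (b x)))"
      by (intro smooth_fun_Pair[OF N] smooth_fun_subset[OF smooth_map_on_chart[OF a c(1)] W']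
          smooth_fun_subset[OF smooth_map_on_chart[OF b e(1)] W']) (auto simp: W'_def)
    moreover have "smooth_fun N W' (\<lambda>x. (S c x, T e x))"
      by (intro smooth_fun_Pair[OF N] smooth_fun_subset[OF S[OF c(1)] W'] smooth_fun_subset[OF T[OF e(1)] W'])
         (auto simp: W'_def)
    moreover have "(\<lambda>x. (snd c (a x), snd e (b x))) ` W' \<subseteq> dom c e k"
      by (force simp: W'_def)
    ultimately have "smooth_fun N W' (\<lambda>x. frechet_derivative (rep c e k) (at (snd c (a x), snd e (b x))) (S c x, T e x))"
      using smooth_fun_derivative[OF N _ _ rep_smooth(2)[OF c(1) e(1) k(1)]] by blast
    then have "smooth_fun N W' (\<lambda>x. to_chart K k (F (a x, b x)) (Z x))"
      by (subst smooth_fun_cong[OF N]) (use Z[OF _ c(1) _ e(1) _ k(1)] in \<open>auto simp: W'_def\<close>)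
    then show "\<exists>d W'. d \<in> Atlas K \<and> x \<in> W' \<and> W' \<subseteq> W \<and> (\<lambda>x. F (a x, b x)) ` W' \<subseteq> fst d \<and>
        smooth_fun N W' (\<lambda>x. to_chart K d (F (a x, b x)) (Z x))"
      using x c e k by (intro exI[of _ k] exI[of _ W']) (auto simp: W'_def)
  qed
  have oa: "openin (Topo N) (W \<inter> a -` fst c)" if "c \<in> Atlas M1" for c
    by (rule smooth_fun_openin[OF smooth_map_on_chart[OF a that]])
  have ob: "openin (Topo N) (W \<inter> b -` fst e)" if "e \<in> Atlas M2" for e
    by (rule smooth_fun_openin[OF smooth_map_on_chart[OF b that]])
  show "smooth_field_on N W K (\<lambda>x. F (a x, b x)) (\<lambda>x. tangent_map M1 K (\<lambda>y. F (y, b x)) (a x) (X x))"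
    if X: "smooth_field_on N W M1 a X"
    by (rule main[of _ "\<lambda>c x. to_chart M1 c (a x) (X x)" "\<lambda>e x. 0"])
       (auto simp: tangent_F1 smooth_field_on_chart[OF X] intro: smooth_fun_const ob)
  show "smooth_field_on N W K (\<lambda>x. F (a x, b x)) (\<lambda>x. tangent_map M2 K (\<lambda>z. F (a x, z)) (b x) (Y x))"
    if Y: "smooth_field_on N W M2 b Y"
    by (rule main[of _ "\<lambda>c x. 0" "\<lambda>e x. to_chart M2 e (b x) (Y x)"])
       (auto simp: tangent_F2 smooth_field_on_chart[OF Y] intro: smooth_fun_const oa)
qed

end

section \<open>Existence and uniqueness of integral curves, and flows\<close>

section \<open>Ordinary differential equations\<close>

lemma vector_derivative_bound:
  fixes f :: "real \<Rightarrow> 'a::real_normed_vector"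
  assumes "\<And>t. t \<in> {a..b} \<Longrightarrow> (f has_vector_derivative f' t) (at t within {a..b})"
    and "\<And>t. t \<in> {a..b} \<Longrightarrow> norm (f' t) \<le> C" and "s \<in> {a..b}" "t \<in> {a..b}"
  shows "norm (f s - f t) \<le> C * \<bar>s - t\<bar>"
proof -
  have "onorm (\<lambda>h. h *\<^sub>R f' t) \<le> C" if t: "t \<in> {a..b}" for t
  proof (rule onorm_bound)
    show "0 \<le> C" using order_trans[OF norm_ge_zero assms(2)[OF t]] .
    show "norm (h *\<^sub>R f' t) \<le> C * norm h" for h
      using mult_right_mono[OF assms(2)[OF t] abs_ge_zero, of h] by (simp add: mult.commute)
  qed
  then show ?thesis
    using differentiable_bound[of "{a..b}" f "\<lambda>t h. h *\<^sub>R f' t" C s t] assms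
    by (simp add: has_vector_derivative_def)
qed

text \<open>Picard iteration as a contraction of bounded continuous functions on the whole line with
  values in the closed ball. The integral operator is controlled only on a short interval, so time
  is clamped to it.\<close>

lemma picard_lindelof:
  fixes Y :: "'e::banach \<Rightarrow> 'e"
  assumes r: "0 < r" and L: "0 \<le> L"
    and lip: "\<And>x y. x \<in> cball x0 r \<Longrightarrow> y \<in> cball x0 r \<Longrightarrow> norm (Y x - Y y) \<le> L * norm (x - y)"
  obtains h x where "0 < h" "x 0 = x0" "\<And>t. t \<in> {-h<..<h} \<Longrightarrow> x t \<in> cball x0 r"
    "\<And>t. t \<in> {-h<..<h} \<Longrightarrow> (x has_vector_derivative Y (x t)) (at t)"
proof -
  \<comment> \<open>A bound for Y on the ball; the added 1 keeps it positive, so that r may be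
    divided by it.\<close>
  define B where "B = norm (Y x0) + L * r + 1"
  have B: "0 < B" using r L by (simp add: B_def add_nonneg_pos)
  have YB: "norm (Y x) \<le> B" if "x \<in> cball x0 r" for x
  proof -
    have "norm (Y x - Y x0) \<le> L * r"
      using lip[OF that, of x0] that r L mult_left_mono[of "norm (x - x0)" r L]
      by (simp add: dist_norm norm_minus_commute)
    then show ?thesis using norm_triangle_ineq2[of "Y x" "Y x0"] by (simp add: B_def)
  qed
  \<comment> \<open>The first bound keeps the iterates in the ball, the second makes the operator
    contract by 1/2; \<open>L + 1\<close> is nonzero even for L = 0.\<close>
  define h where "h = min (r / B) (1 / (2 * (L + 1)))"
  have h: "0 < h" "B * h \<le> r" "L * h \<le> 1/2"
  proof -
    show "0 < h" using r B L by (simp add: h_def)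
    have "h \<le> r / B" by (simp add: h_def)
    then show "B * h \<le> r" using B by (simp add: field_simps)
    have "h \<le> 1 / (2 * (L + 1))" by (simp add: h_def)
    then have "(L + 1) * h \<le> 1/2" using L by (simp add: field_simps)
    then show "L * h \<le> 1/2" using \<open>0 < h\<close> by (simp add: algebra_simps)
  qed
  define s :: "(real \<Rightarrow>\<^sub>C 'e) set" where "s = PiC UNIV (\<lambda>_. cball x0 r)"
  have s: "\<phi> \<in> s \<longleftrightarrow> (\<forall>t. \<phi> t \<in> cball x0 r)" for \<phi> :: "real \<Rightarrow>\<^sub>C 'e"
    by (auto simp: s_def mem_PiC_iff)
  have contY: "continuous_on (cball x0 r) Y"
    by (rule lipschitz_on_continuous_on[of L]) (auto intro!: lipschitz_onI L lip simp: dist_norm)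
  have contYp: "continuous_on T (\<lambda>t. Y (apply_bcontfun \<phi> t))" if "\<phi> \<in> s" for \<phi> T
    by (rule continuous_on_compose2[OF contY]) (use that s in auto)
  \<comment> \<open>The integral from 0 to t for either sign of t, as a difference of integrals
    starting at -h.\<close>
  define F where "F \<phi> t = integral {-h..t} (\<lambda>t. Y (apply_bcontfun \<phi> t)) - integral {-h..0} (\<lambda>t. Y (apply_bcontfun \<phi> t))"
    for \<phi> :: "real \<Rightarrow>\<^sub>C 'e" and t
  have F0: "F \<phi> 0 = 0" for \<phi> by (simp add: F_def)
  have dF: "(F \<phi> has_vector_derivative Y (\<phi> t)) (at t within {-h..h})" if "\<phi> \<in> s" "t \<in> {-h..h}" for \<phi> t
  proof -
    have "((\<lambda>u. integral {-h..u} (\<lambda>t. Y (\<phi> t)) - integral {-h..0} (\<lambda>t. Y (\<phi> t))) has_vector_derivative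
        (Y (\<phi> t) - 0)) (at t within {-h..h})"
      by (intro has_vector_derivative_diff integral_has_vector_derivative contYp that has_vector_derivative_const)
    then show ?thesis by (simp add: F_def[abs_def])
  qed
  \<comment> \<open>Projection of the line onto [-h, h]; it makes \<open>F \<phi> (cl t)\<close>
    bounded and continuous in all t.\<close>
  define cl where "cl t = max (-h) (min h t)" for t :: real
  have cl: "cl t \<in> {-h..h}" "\<bar>cl t\<bar> \<le> h" for t using h by (auto simp: cl_def)
  have contcl: "continuous_on UNIV cl" unfolding cl_def[abs_def] by (intro continuous_intros)
  have h0: "0 \<in> {-h..h}" using h by auto
  define \<Phi> where "\<Phi> \<phi> = Bcontfun (\<lambda>t. x0 + F \<phi> (cl t))" for \<phi>
  have Fb: "norm (F \<phi> (cl t)) \<le> r" if "\<phi> \<in> s" for \<phi> t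
  proof -
    have "norm (F \<phi> (cl t) - F \<phi> 0) \<le> B * \<bar>cl t - 0\<bar>"
      by (rule vector_derivative_bound[OF dF[OF that] _ cl(1) h0]) (use that s YB in auto)
    also have "\<dots> \<le> B * h" using cl(2)[of t] B by simp
    finally show ?thesis using h F0 by simp
  qed
  have \<Phi>: "apply_bcontfun (\<Phi> \<phi>) = (\<lambda>t. x0 + F \<phi> (cl t))" if "\<phi> \<in> s" for \<phi>
  proof -
    have "continuous_on {-h..h} (F \<phi>)"
      by (rule continuous_on_vector_derivative[OF dF[OF that]])
    then have "continuous_on UNIV (\<lambda>t. F \<phi> (cl t))"
      by (rule continuous_on_compose2[OF _ contcl]) (use cl in auto)
    then have "continuous_on UNIV (\<lambda>t. x0 + F \<phi> (cl t))" by (intro continuous_intros)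
    moreover have "norm (x0 + F \<phi> (cl t)) \<le> norm x0 + r" for t
      using norm_triangle_ineq[of x0 "F \<phi> (cl t)"] Fb[OF that, of t] by simp
    ultimately have "(\<lambda>t. x0 + F \<phi> (cl t)) \<in> bcontfun" by (rule bcontfun_normI)
    then show ?thesis by (simp add: \<Phi>_def Bcontfun_inverse)
  qed
  have "\<exists>!\<phi>. \<phi> \<in> s \<and> \<Phi> \<phi> = \<phi>"
  proof (rule Banach_fix[of s "1/2"])
    show "complete s" unfolding s_def complete_eq_closed by (intro closed_PiC) auto
    show "s \<noteq> {}" using s[of "const_bcontfun x0"] r by auto
    show "\<Phi> ` s \<subseteq> s" using Fb by (auto simp: s \<Phi> dist_norm)
    fix \<phi> \<psi> assume \<phi>: "\<phi> \<in> s" and \<psi>: "\<psi> \<in> s"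
    show "dist (\<Phi> \<phi>) (\<Phi> \<psi>) \<le> 1/2 * dist \<phi> \<psi>"
    proof (rule dist_bound)
      fix t
      have "norm ((F \<phi> (cl t) - F \<psi> (cl t)) - (F \<phi> 0 - F \<psi> 0)) \<le> (L * dist \<phi> \<psi>) * \<bar>cl t - 0\<bar>"
      proof (rule vector_derivative_bound[OF _ _ cl(1) h0])
        fix u assume u: "u \<in> {-h..h}"
        show "((\<lambda>t. F \<phi> t - F \<psi> t) has_vector_derivative (Y (\<phi> u) - Y (\<psi> u))) (at u within {-h..h})"
          by (intro has_vector_derivative_diff dF \<phi> \<psi> u)
        have "norm (Y (\<phi> u) - Y (\<psi> u)) \<le> L * norm (\<phi> u - \<psi> u)"
          by (rule lip) (use s \<phi> \<psi> in auto)
        also have "\<dots> \<le> L * dist \<phi> \<psi>" using dist_bounded[of \<phi> u \<psi>] L by (simp add: dist_norm mult_left_mono)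
        finally show "norm (Y (\<phi> u) - Y (\<psi> u)) \<le> L * dist \<phi> \<psi>" .
      qed
      also have "\<dots> \<le> (L * dist \<phi> \<psi>) * h" using cl(2)[of t] L by (simp add: mult_left_mono)
      also have "\<dots> = (L * h) * dist \<phi> \<psi>" by simp
      also have "\<dots> \<le> 1/2 * dist \<phi> \<psi>" by (rule mult_right_mono[OF h(3) zero_le_dist])
      finally show "dist (\<Phi> \<phi> t) (\<Phi> \<psi> t) \<le> 1/2 * dist \<phi> \<psi>"
        by (simp add: \<Phi> \<phi> \<psi> F0 dist_norm)
    qed
  qed auto
  then obtain \<phi> where \<phi>: "\<phi> \<in> s" "\<Phi> \<phi> = \<phi>" by blast
  have eq: "\<phi> t = x0 + F \<phi> (cl t)" for t using \<Phi>[OF \<phi>(1)] \<phi>(2) by simp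
  show thesis
  proof (rule that[OF h(1), of "apply_bcontfun \<phi>"])
    show "\<phi> 0 = x0" using h eq[of 0] by (simp add: cl_def F0)
    show "\<phi> t \<in> cball x0 r" if "t \<in> {-h<..<h}" for t using \<phi>(1) s by blast
    show "(apply_bcontfun \<phi> has_vector_derivative Y (\<phi> t)) (at t)" if t: "t \<in> {-h<..<h}" for t
    proof -
      have "(F \<phi> has_vector_derivative Y (\<phi> t)) (at t within {-h<..<h})"
        by (rule has_vector_derivative_within_subset[OF dF[OF \<phi>(1)]]) (use t in auto)
      then have "(F \<phi> has_vector_derivative Y (\<phi> t)) (at t)"
        by (simp only: has_vector_derivative_within_open[OF t open_greaterThanLessThan])
      then have "((\<lambda>u. x0 + F \<phi> u) has_vector_derivative (0 + Y (\<phi> t))) (at t)"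
        by (intro has_vector_derivative_add has_vector_derivative_const)
      then have "((\<lambda>u. x0 + F \<phi> u) has_vector_derivative Y (\<phi> t)) (at t)" by simp
      then show ?thesis
        by (rule has_vector_derivative_transform_within_open[OF _ open_greaterThanLessThan t])
           (use eq in \<open>auto simp: cl_def\<close>)
    qed
  qed
qed

text \<open>Derivatives in the finitely many directions of \<open>onb\<close> are continuous, hence
  bounded near x0, and they bound the operator norm of the full derivative. The mean value
  inequality on a convex ball then gives the Lipschitz constant.\<close>

lemma smooth_on_locally_lipschitz:
  fixes Y :: "'e::fin_dim \<Rightarrow> 'f::real_normed_vector"
  assumes Y: "smooth_on S Y" and S: "open S" "x0 \<in> S"
  obtains r L where "0 < r" "0 \<le> L" "cball x0 r \<subseteq> S"
    "\<And>x y. x \<in> cball x0 r \<Longrightarrow> y \<in> cball x0 r \<Longrightarrow> norm (Y x - Y y) \<le> L * norm (x - y)"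
proof -
  let ?D = "\<lambda>x. frechet_derivative Y (at x)"
  \<comment> \<open>The 1 turns the norm at x0 into a strict upper bound, which persists in a
    neighbourhood.\<close>
  define k where "k b = norm (?D x0 b) + 1" for b
  have "\<forall>\<^sub>F x in nhds x0. norm (?D x b) < k b" for b
  proof -
    have "continuous_on S (\<lambda>x. ?D x b)"
      by (rule smooth_on_continuous_on[OF smooth_on_derivative[OF Y]])
    then have "isCont (\<lambda>x. ?D x b) x0" using S by (simp add: continuous_on_eq_continuous_at)
    then have "isCont (\<lambda>x. norm (?D x b)) x0" by (rule continuous_norm)
    then have "((\<lambda>x. norm (?D x b)) \<longlongrightarrow> norm (?D x0 b)) (nhds x0)"
      unfolding isCont_def using tendsto_at_iff_tendsto_nhds[of "\<lambda>x. norm (?D x b)"] by blast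
    then show ?thesis by (rule order_tendstoD) (simp add: k_def)
  qed
  then have "\<forall>\<^sub>F x in nhds x0. \<forall>b\<in>onb. norm (?D x b) < k b"
    by (intro eventually_ball_finite) auto
  moreover have "\<forall>\<^sub>F x in nhds x0. x \<in> S" using S by (simp add: eventually_nhds_in_open)
  ultimately have "\<forall>\<^sub>F x in nhds x0. x \<in> S \<and> (\<forall>b\<in>onb. norm (?D x b) < k b)"
    by (simp add: eventually_conj)
  then obtain e where e: "0 < e" "\<And>x. dist x x0 < e \<Longrightarrow> x \<in> S \<and> (\<forall>b\<in>onb. norm (?D x b) < k b)"
    by (auto simp: eventually_nhds_metric)
  define r where "r = e / 2"
  define L where "L = (\<Sum>b\<in>(onb :: 'e set). norm b * k b)"
  have r: "0 < r" "cball x0 r \<subseteq> S" using e by (auto simp: r_def dist_commute)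
  have kpos: "0 \<le> k b" for b by (simp add: k_def)
  have L: "0 \<le> L" unfolding L_def by (intro sum_nonneg mult_nonneg_nonneg kpos) auto
  have der: "(Y has_derivative ?D x) (at x)" if "x \<in> cball x0 r" for x
    using smooth_on_has_derivative[OF Y] r that by blast
  have "onorm (?D x) \<le> L" if x: "x \<in> cball x0 r" for x
  proof (rule onorm_bound[OF L])
    fix v
    have "?D x v = (\<Sum>b\<in>onb. (v \<bullet> b) *\<^sub>R ?D x b)"
      by (rule linear_onb_expansion[OF has_derivative_linear[OF der[OF x]]])
    also have "norm \<dots> \<le> (\<Sum>b\<in>onb. norm ((v \<bullet> b) *\<^sub>R ?D x b))" by (rule norm_sum)
    also have "\<dots> \<le> (\<Sum>b\<in>(onb :: 'e set). (norm v * norm b) * k b)"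
    proof (rule sum_mono)
      fix b :: 'e assume b: "b \<in> onb"
      have "norm (?D x b) \<le> k b" using e(2)[of x] x b e(1) by (auto simp: r_def dist_commute less_imp_le)
      then show "norm ((v \<bullet> b) *\<^sub>R ?D x b) \<le> (norm v * norm b) * k b"
        using Cauchy_Schwarz_ineq2[of v b] by (simp add: mult_mono)
    qed
    also have "\<dots> = L * norm v" by (simp add: L_def sum_distrib_left mult_ac)
    finally show "norm (?D x v) \<le> L * norm v" .
  qed
  then show thesis
    using that[OF r(1) L r(2)] differentiable_bound[OF convex_cball has_derivative_at_withinI[OF der]] by blast
qed

text \<open>Gronwall for g, the squared distance of the two curves. The Lipschitz bound gives |g'|
  at most 2 L g, so g times exp(-2 L t) does not increase, which settles times after t0; for earlier
  times g times exp(2 L t) does not decrease. Since g is 0 at t0 and nonnegative, it is 0 at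
  t1.\<close>

lemma ode_unique_local:
  fixes x y :: "real \<Rightarrow> 'e::real_inner"
  assumes I: "is_interval I" "t0 \<in> I" "t1 \<in> I" and L: "0 \<le> L" and eq: "x t0 = y t0"
    and x: "\<And>t. t \<in> I \<Longrightarrow> (x has_vector_derivative x' t) (at t)"
    and y: "\<And>t. t \<in> I \<Longrightarrow> (y has_vector_derivative y' t) (at t)"
    and lip: "\<And>t. t \<in> I \<Longrightarrow> norm (x' t - y' t) \<le> L * norm (x t - y t)"
  shows "x t1 = y t1"
proof -
  define g where "g t = (x t - y t) \<bullet> (x t - y t)" for t
  have dg: "(g has_real_derivative 2 * ((x t - y t) \<bullet> (x' t - y' t))) (at t)" if "t \<in> I" for t
  proof -
    have "((\<lambda>t. x t - y t) has_derivative (\<lambda>h. h *\<^sub>R (x' t - y' t))) (at t)"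
      using has_vector_derivative_diff[OF x[OF that] y[OF that]] by (simp add: has_vector_derivative_def)
    from has_derivative_inner[OF this this]
    show ?thesis unfolding g_def[abs_def] has_field_derivative_def
      by (rule has_derivative_eq_rhs) (auto simp: inner_commute algebra_simps)
  qed
  have bound: "\<bar>2 * ((x t - y t) \<bullet> (x' t - y' t))\<bar> \<le> 2 * L * g t" if "t \<in> I" for t
  proof -
    have "\<bar>(x t - y t) \<bullet> (x' t - y' t)\<bar> \<le> norm (x t - y t) * norm (x' t - y' t)"
      by (rule Cauchy_Schwarz_ineq2)
    also have "\<dots> \<le> norm (x t - y t) * (L * norm (x t - y t))"
      by (rule mult_left_mono[OF lip[OF that] norm_ge_zero])
    also have "\<dots> = L * g t" by (simp add: g_def dot_square_norm power2_eq_square)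
    finally show ?thesis by simp
  qed
  have seg: "t \<in> I" if "min t0 t1 \<le> t" "t \<le> max t0 t1" for t
    using I that unfolding is_interval_1 by (metis (full_types) max_def min_def)
  have "g t1 \<le> 0"
  proof (cases "t0 \<le> t1")
    case True
    have "g t1 * exp (- (2 * L * t1)) \<le> g t0 * exp (- (2 * L * t0))"
    proof (rule DERIV_nonpos_imp_nonincreasing[OF True])
      fix t assume t: "t0 \<le> t" "t \<le> t1"
      then have tI: "t \<in> I" using seg True by auto
      let ?d = "2 * ((x t - y t) \<bullet> (x' t - y' t))"
      have "((\<lambda>t. g t * exp (- (2 * L * t))) has_real_derivative
          ?d * exp (- (2 * L * t)) + (exp (- (2 * L * t)) * (- (2 * L))) * g t) (at t)"
        by (intro DERIV_mult dg[OF tI]) (auto intro!: derivative_eq_intros)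
      moreover have "?d * exp (- (2 * L * t)) + (exp (- (2 * L * t)) * (- (2 * L))) * g t =
          (?d - 2 * L * g t) * exp (- (2 * L * t))" by (simp add: algebra_simps)
      moreover have "(?d - 2 * L * g t) * exp (- (2 * L * t)) \<le> 0"
        using bound[OF tI] by (intro mult_nonpos_nonneg) auto
      ultimately show "\<exists>z. ((\<lambda>t. g t * exp (- (2 * L * t))) has_real_derivative z) (at t) \<and> z \<le> 0" by metis
    qed
    then show ?thesis using eq by (simp add: g_def mult_le_0_iff)
  next
    case False
    then have le: "t1 \<le> t0" by simp
    have "g t1 * exp (2 * L * t1) \<le> g t0 * exp (2 * L * t0)"
    proof (rule DERIV_nonneg_imp_nondecreasing[OF le])
      fix t assume t: "t1 \<le> t" "t \<le> t0"
      then have tI: "t \<in> I" using seg le by auto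
      let ?d = "2 * ((x t - y t) \<bullet> (x' t - y' t))"
      have "((\<lambda>t. g t * exp (2 * L * t)) has_real_derivative
          ?d * exp (2 * L * t) + (exp (2 * L * t) * (2 * L)) * g t) (at t)"
        by (intro DERIV_mult dg[OF tI]) (auto intro!: derivative_eq_intros)
      moreover have "?d * exp (2 * L * t) + (exp (2 * L * t) * (2 * L)) * g t =
          (?d + 2 * L * g t) * exp (2 * L * t)" by (simp add: algebra_simps)
      moreover have "0 \<le> (?d + 2 * L * g t) * exp (2 * L * t)"
        using bound[OF tI] by (intro mult_nonneg_nonneg) auto
      ultimately show "\<exists>z. ((\<lambda>t. g t * exp (2 * L * t)) has_real_derivative z) (at t) \<and> 0 \<le> z" by metis
    qed
    then show ?thesis using eq by (simp add: g_def mult_le_0_iff)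
  qed
  then have "(x t1 - y t1) \<bullet> (x t1 - y t1) = 0" using inner_ge_zero[of "x t1 - y t1"] by (simp add: g_def)
  then show ?thesis by simp
qed

section \<open>Flows of vector fields\<close>

text \<open>\<open>integral_curve\<close> differentiates at each t in the chart chosen at
  \<open>c t\<close>, which changes with t. In one fixed chart the condition becomes an ordinary
  differential equation.\<close>

lemma integral_curve_chart:
  assumes M: "smooth_atlas M" and I: "open I" and c: "integral_curve M U I c"
    and d: "d \<in> Atlas M" and t: "t \<in> I" "c t \<in> fst d"
  shows "((\<lambda>s. snd d (c s)) has_vector_derivative to_chart M d (c t) (U (c t))) (at t)"
proof -
  have cont: "continuous_map (top_of_set I) (Topo M) c"
    and der: "((coord M (c t) \<circ> c) has_vector_derivative U (c t)) (at t)"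
    using c t by (auto simp: integral_curve_def)
  let ?e = "chart_at M (c t)"
  have e: "?e \<in> Atlas M" "c t \<in> fst ?e" using chart_at[OF M] chart_subset[OF M d] t by auto
  have 1: "((\<lambda>s. snd d (chart_inv ?e (snd ?e (c s)))) has_derivative
      (\<lambda>h. transition ?e d (c t) (h *\<^sub>R U (c t)))) (at t)"
    using transition_has_derivative[OF M e(1) d e(2) t(2)] der
    by (intro has_derivative_compose[of "\<lambda>s. snd ?e (c s)" _ t UNIV "\<lambda>x. snd d (chart_inv ?e x)"])
       (auto simp: has_vector_derivative_def coord_def comp_def)
  have "openin (top_of_set I) {s \<in> topspace (top_of_set I). c s \<in> fst ?e}"
    by (rule openin_continuous_map_preimage[OF cont chart_openin[OF M e(1)]])
  then have o: "open {s \<in> I. c s \<in> fst ?e}" using I openin_open_trans by fastforce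
  have "((\<lambda>s. snd d (c s)) has_derivative (\<lambda>h. transition ?e d (c t) (h *\<^sub>R U (c t)))) (at t)"
    by (rule has_derivative_transform_within_open[OF 1 o]) (use t e M in auto)
  moreover have "transition ?e d (c t) (h *\<^sub>R U (c t)) = h *\<^sub>R to_chart M d (c t) (U (c t))" for h
    using linear_scale[OF to_chart_linear[OF M d t(2)]] by (simp add: to_chart_transition)
  ultimately show ?thesis by (simp add: has_vector_derivative_def)
qed

lemma field_rep_smooth:
  assumes M: "smooth_atlas M" and U: "smooth_field_on M (points M) M (\<lambda>x. x) U" and d: "d \<in> Atlas M"
  shows "smooth_on (snd d ` fst d) (\<lambda>x. to_chart M d (chart_inv d x) (U (chart_inv d x)))"
  using smooth_fun_chart[OF smooth_field_on_chart[OF U d] d] chart_subset[OF M d]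
  by (simp add: Int_absorb1)

text \<open>The times at which the curves agree form a closed set because the manifold is Hausdorff,
  an open one by local uniqueness in a chart, and they contain 0; the overlap of the two intervals
  is connected.\<close>

lemma integral_curve_unique:
  assumes M: "smooth_manifold M" and U: "smooth_field_on M (points M) M (\<lambda>x. x) U"
    and I: "open I" "connected I" "0 \<in> I" "t \<in> I" "integral_curve M U I c"
    and J: "open J" "connected J" "0 \<in> J" "t \<in> J" "integral_curve M U J c'"
    and eq: "c 0 = c' 0"
  shows "c t = c' t"
proof -
  note A = smooth_manifold_atlas[OF M]
  let ?K = "I \<inter> J"
  have Ko: "open ?K" using I J by auto
  have Kc: "connected ?K" "is_interval ?K"
    using I J by (metis is_interval_Int is_interval_connected_1)+
  have contc: "continuous_map (top_of_set ?K) (Topo M) c" "continuous_map (top_of_set ?K) (Topo M) c'"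
    using I(5) J(5) continuous_map_from_subtopology_mono unfolding integral_curve_def
    by (metis Int_lower1, metis Int_lower2)
  define E where "E = {s \<in> ?K. c s = c' s}"
  have haus: "Hausdorff_space (Topo M)" using M by (simp add: smooth_manifold_def)
  have "closedin (top_of_set ?K) {s \<in> topspace (top_of_set ?K). c s = c' s}"
    by (rule closedin_continuous_maps_eq[OF haus contc])
  then have closed: "closedin (top_of_set ?K) E" by (simp add: E_def)
  have "\<exists>T. open T \<and> s \<in> T \<and> T \<subseteq> E" if s: "s \<in> E" for s
  proof -
    have sK: "s \<in> ?K" "c s = c' s" using s by (auto simp: E_def)
    have "c s \<in> points M" using contc(1) sK(1) by (auto simp: continuous_map_def points_def)
    then obtain d where d: "d \<in> Atlas M" "c s \<in> fst d" using chart_exists[OF A] by blast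
    define Y where "Y = (\<lambda>x. to_chart M d (chart_inv d x) (U (chart_inv d x)))"
    obtain r L where rL: "0 < r" "0 \<le> L" "cball (snd d (c s)) r \<subseteq> snd d ` fst d"
      and lip: "\<And>x y. x \<in> cball (snd d (c s)) r \<Longrightarrow> y \<in> cball (snd d (c s)) r \<Longrightarrow> norm (Y x - Y y) \<le> L * norm (x - y)"
      using smooth_on_locally_lipschitz[OF field_rep_smooth[OF A U d(1), folded Y_def]
          chart_open_image'[OF A d(1) chart_openin[OF A d(1)] order_refl]] d(2) by blast
    define V where "V = fst d \<inter> snd d -` ball (snd d (c s)) r"
    have V: "openin (Topo M) V" unfolding V_def by (rule chart_preimage[OF A d(1)]) simp
    have o: "open {u \<in> ?K. c u \<in> V}" "open {u \<in> ?K. c' u \<in> V}"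
      using openin_continuous_map_preimage[OF contc(1) V] openin_continuous_map_preimage[OF contc(2) V]
        openin_open_trans[OF _ Ko] by auto
    then have "open ({u \<in> ?K. c u \<in> V} \<inter> {u \<in> ?K. c' u \<in> V})" by (rule open_Int)
    moreover have "s \<in> {u \<in> ?K. c u \<in> V} \<inter> {u \<in> ?K. c' u \<in> V}"
      using sK d rL by (auto simp: V_def)
    ultimately obtain e where e: "0 < e" "ball s e \<subseteq> {u \<in> ?K. c u \<in> V} \<inter> {u \<in> ?K. c' u \<in> V}"
      using open_contains_ball by meson
    have "ball s e \<subseteq> E"
    proof
      fix u assume u: "u \<in> ball s e"
      have "snd d (c u) = snd d (c' u)"
      proof (rule ode_unique_local[of "ball s e" s u L "\<lambda>u. snd d (c u)" "\<lambda>u. snd d (c' u)"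
            "\<lambda>u. Y (snd d (c u))" "\<lambda>u. Y (snd d (c' u))"])
        show "is_interval (ball s e)" by (simp add: is_interval_ball_real)
        fix v assume v: "v \<in> ball s e"
        then have v': "v \<in> I" "v \<in> J" "c v \<in> fst d" "c' v \<in> fst d"
          "snd d (c v) \<in> ball (snd d (c s)) r" "snd d (c' v) \<in> ball (snd d (c s)) r"
          using e(2) by (auto simp: V_def)
        show "((\<lambda>u. snd d (c u)) has_vector_derivative Y (snd d (c v))) (at v)"
          using integral_curve_chart[OF A I(1,5) d(1) v'(1,3)] A d v' by (simp add: Y_def)
        show "((\<lambda>u. snd d (c' u)) has_vector_derivative Y (snd d (c' v))) (at v)"
          using integral_curve_chart[OF A J(1,5) d(1) v'(2,4)] A d v' by (simp add: Y_def)
        show "norm (Y (snd d (c v)) - Y (snd d (c' v))) \<le> L * norm (snd d (c v) - snd d (c' v))"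
          by (rule lip) (use v' in auto)
      qed (use e u rL sK in auto)
      moreover have "c u \<in> fst d" "c' u \<in> fst d" "u \<in> ?K" using e(2) u by (auto simp: V_def)
      ultimately show "u \<in> E" using chart_inj[OF A d(1)] by (auto simp: E_def dest: inj_onD)
    qed
    then show ?thesis using e by (intro exI[of _ "ball s e"]) auto
  qed
  then have "open E" by (subst open_subopen) blast
  then have "openin (top_of_set ?K) E" by (intro open_subset) (auto simp: E_def)
  moreover have "0 \<in> E" using I J eq by (auto simp: E_def)
  ultimately have "E = ?K" using closed Kc(1) unfolding connected_clopen by blast
  then show ?thesis using I J by (auto simp: E_def)
qed

text \<open>Solve in one chart and pull back. At other times the velocity may refer to another
  chosen chart, hence the transition Jacobian in the final computation.\<close>

lemma integral_curve_exists:
  assumes M: "smooth_manifold M" and U: "smooth_field_on M (points M) M (\<lambda>x. x) U" and p: "p \<in> points M"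
  obtains h c where "0 < h" "integral_curve M U {-h<..<h} c" "c 0 = p"
proof -
  note A = smooth_manifold_atlas[OF M]
  obtain d where d: "d \<in> Atlas M" "p \<in> fst d" using chart_exists[OF A p] .
  define Y where "Y = (\<lambda>x. to_chart M d (chart_inv d x) (U (chart_inv d x)))"
  obtain r L where rL: "0 < r" "0 \<le> L" "cball (snd d p) r \<subseteq> snd d ` fst d"
    and lip: "\<And>x y. x \<in> cball (snd d p) r \<Longrightarrow> y \<in> cball (snd d p) r \<Longrightarrow> norm (Y x - Y y) \<le> L * norm (x - y)"
    using smooth_on_locally_lipschitz[OF field_rep_smooth[OF A U d(1), folded Y_def]
        chart_open_image'[OF A d(1) chart_openin[OF A d(1)] order_refl]] d(2) by blast
  obtain h x where h: "0 < h" and x: "x 0 = snd d p" "\<And>t. t \<in> {-h<..<h} \<Longrightarrow> x t \<in> cball (snd d p) r"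
    "\<And>t. t \<in> {-h<..<h} \<Longrightarrow> (x has_vector_derivative Y (x t)) (at t)"
    using picard_lindelof[OF rL(1,2) lip] by metis
  define c where "c t = chart_inv d (x t)" for t
  have xd: "x t \<in> snd d ` fst d" if "t \<in> {-h<..<h}" for t using x(2)[OF that] rL by auto
  have cd: "c t \<in> fst d" "snd d (c t) = x t" if "t \<in> {-h<..<h}" for t
    using xd[OF that] A d by (auto simp: c_def)
  have contx: "continuous_on {-h<..<h} x"
    by (rule continuous_on_vector_derivative) (use x(3) has_vector_derivative_at_within in blast)
  have "integral_curve M U {-h<..<h} c"
    unfolding integral_curve_def
  proof (intro conjI ballI)
    show "continuous_map (top_of_set {-h<..<h}) (Topo M) c"
      unfolding continuous_map_def
    proof (intro conjI allI impI)
      show "c \<in> topspace (top_of_set {-h<..<h}) \<rightarrow> topspace (Topo M)"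
        using cd chart_subset[OF A d(1)] by (auto simp: points_def)
      fix V assume V: "openin (Topo M) V"
      have "open ({-h<..<h} \<inter> x -` (snd d ` (fst d \<inter> V)))"
        by (rule continuous_open_preimage[OF contx open_greaterThanLessThan chart_open_image[OF A d(1) V]])
      moreover have "{-h<..<h} \<inter> x -` (snd d ` (fst d \<inter> V)) = {t \<in> {-h<..<h}. c t \<in> V}"
        using cd A d by (auto simp: c_def) (metis greaterThanLessThan_iff cd(1) cd(2) c_def IntI image_eqI)
      ultimately show "openin (top_of_set {-h<..<h}) {t \<in> topspace (top_of_set {-h<..<h}). c t \<in> V}"
        by (auto intro: open_subset)
    qed
    fix t assume t: "t \<in> {-h<..<h}"
    let ?e = "chart_at M (c t)"
    have e: "?e \<in> Atlas M" "c t \<in> fst ?e" using chart_at[OF A] chart_subset[OF A d(1)] cd(1)[OF t] by auto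
    have "((\<lambda>s. snd ?e (chart_inv d (x s))) has_derivative (\<lambda>k. transition d ?e (c t) (k *\<^sub>R Y (x t)))) (at t)"
      using transition_has_derivative[OF A d(1) e(1) cd(1)[OF t] e(2)] cd(2)[OF t] x(3)[OF t]
      by (intro has_derivative_compose[of x _ t UNIV "\<lambda>y. snd ?e (chart_inv d y)"])
         (auto simp: has_vector_derivative_def)
    moreover have "transition d ?e (c t) (k *\<^sub>R Y (x t)) = k *\<^sub>R U (c t)" for k
    proof -
      have "transition d ?e (c t) (Y (x t)) = to_chart M ?e (c t) (U (c t))"
        using transition_to_chart[OF A d(1) cd(1)[OF t] e] by (simp add: Y_def c_def)
      also have "\<dots> = U (c t)" using to_chart_at[OF A] chart_subset[OF A d(1)] cd(1)[OF t] by auto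
      finally show ?thesis
        using linear_scale[OF transition_linear[OF A d(1) e(1) cd(1)[OF t] e(2)]] by simp
    qed
    ultimately show "((coord M (c t) \<circ> c) has_vector_derivative U (c t)) (at t)"
      by (simp add: has_vector_derivative_def coord_def comp_def c_def)
  qed
  moreover have "c 0 = p" using x(1) A d by (simp add: c_def)
  ultimately show thesis using that h by blast
qed

text \<open>\<open>flow\<close> is a definite description over all integral curves. By uniqueness it
  coincides for small t with the local curve through p, and this germ determines the velocity at 0,
  for incomplete fields too.\<close>

lemma velocity_flow:
  assumes M: "smooth_manifold M" and U: "smooth_field_on M (points M) M (\<lambda>x. x) U" and p: "p \<in> points M"
  shows "velocity M (\<lambda>t. flow M U t p) 0 = U p"
proof -
  obtain h c where h: "0 < h" and c: "integral_curve M U {-h<..<h} c" "c 0 = p"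
    using integral_curve_exists[OF M U p] by blast
  have flow: "flow M U t p = c t" if t: "t \<in> {-h<..<h}" for t
    unfolding flow_def
  proof (rule the_equality)
    show "\<exists>I c'. open I \<and> connected I \<and> 0 \<in> I \<and> t \<in> I \<and> integral_curve M U I c' \<and> c' 0 = p \<and> c' t = c t"
      using h c t by (intro exI[of _ "{-h<..<h}"] exI[of _ c]) auto
    fix q assume "\<exists>I c'. open I \<and> connected I \<and> 0 \<in> I \<and> t \<in> I \<and> integral_curve M U I c' \<and> c' 0 = p \<and> c' t = q"
    then obtain I c' where I: "open I" "connected I" "0 \<in> I" "t \<in> I" "integral_curve M U I c'" "c' 0 = p" "c' t = q"
      by blast
    have "c' t = c t"
      by (rule integral_curve_unique[OF M U I(1-5), of "{-h<..<h}"]) (use h c t I in auto)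
    then show "q = c t" using I by simp
  qed
  have "((coord M (c 0) \<circ> c) has_vector_derivative U (c 0)) (at 0)"
    using c(1) h by (simp add: integral_curve_def)
  then have "((coord M p \<circ> (\<lambda>t. flow M U t p)) has_vector_derivative U p) (at 0)"
    unfolding c(2)
    by (rule has_vector_derivative_transform_within_open[of _ _ _ "{-h<..<h}"]) (use h flow in auto)
  moreover have "flow M U 0 p = p" using flow[of 0] h c by simp
  ultimately show ?thesis by (simp add: velocity_def vector_derivative_at)
qed

section \<open>Transformation of volume densities and the measure of a volume form\<close>

section \<open>Alternating forms and determinants\<close>

text \<open>Arguments are indexed by a type instead of positions in a list as in
  \<open>alternating_form\<close>; this matches the index type of \<open>det\<close>.\<close>

definition alternating_map :: "(('n \<Rightarrow> 'v::real_vector) \<Rightarrow> real) \<Rightarrow> bool" where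
  "alternating_map W \<longleftrightarrow> (\<forall>v i. linear (\<lambda>x. W (v(i := x)))) \<and>
     (\<forall>v i j. i \<noteq> j \<longrightarrow> v i = v j \<longrightarrow> W v = 0)"

lemma alternating_mapD:
  assumes "alternating_map W"
  shows "linear (\<lambda>x. W (v(i := x)))" and "i \<noteq> j \<Longrightarrow> v i = v j \<Longrightarrow> W v = 0"
    and "W (v(i := x + y)) = W (v(i := x)) + W (v(i := y))"
    and "W (v(i := c *\<^sub>R x)) = c * W (v(i := x))"
proof -
  show lin: "linear (\<lambda>x. W (v(i := x)))" and "i \<noteq> j \<Longrightarrow> v i = v j \<Longrightarrow> W v = 0"
    using assms by (auto simp: alternating_map_def)
  show "W (v(i := x + y)) = W (v(i := x)) + W (v(i := y))"
    and "W (v(i := c *\<^sub>R x)) = c * W (v(i := x))"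
    using linear_add[OF lin] linear_scale[OF lin] by simp_all
qed

text \<open>With \<open>v i + v j\<close> in both slots the value is 0. After expansion the two
  terms with a repeated vector vanish, so the two mixed terms are opposite.\<close>

lemma alternating_map_swap:
  assumes W: "alternating_map W" and ij: "i \<noteq> j"
  shows "W (\<lambda>k. v (Transposition.transpose i j k)) = - W v"
proof -
  note D = alternating_mapD[OF W]
  let ?s = "v i + v j"
  have "W (v(i := ?s, j := ?s)) = 0" by (rule D(2)[OF ij]) (use ij in simp)
  then have "W (v(i := v i, j := ?s)) + W (v(i := v j, j := ?s)) = 0"
    using D(3)[of "v(j := ?s)" i "v i" "v j"] ij by (simp add: fun_upd_twist)
  moreover have "W (v(i := v i, j := ?s)) = W (v(i := v i, j := v i)) + W (v(i := v i, j := v j))"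
    by (rule D(3))
  moreover have "W (v(i := v j, j := ?s)) = W (v(i := v j, j := v i)) + W (v(i := v j, j := v j))"
    by (rule D(3))
  moreover have "W (v(i := v i, j := v i)) = 0" "W (v(i := v j, j := v j)) = 0"
    by (rule D(2)[OF ij]; use ij in simp)+
  moreover have "v(i := v j, j := v i) = (\<lambda>k. v (Transposition.transpose i j k))"
    by (auto simp: transpose_def)
  ultimately show ?thesis by simp
qed

lemma alternating_map_scale:
  fixes v :: "'n::finite \<Rightarrow> 'v::real_vector"
  assumes W: "alternating_map W"
  shows "W (\<lambda>j. c j *\<^sub>R v j) = (\<Prod>j\<in>UNIV. c j) * W v"
proof -
  have "W (\<lambda>j. if j \<in> S then c j *\<^sub>R v j else v j) = (\<Prod>j\<in>S. c j) * W v" if "finite S" for S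
    using that
  proof (induction S rule: finite_induct)
    case (insert k S)
    let ?w = "\<lambda>j. if j \<in> S then c j *\<^sub>R v j else v j"
    have "(\<lambda>j. if j \<in> insert k S then c j *\<^sub>R v j else v j) = ?w(k := c k *\<^sub>R v k)" by auto
    moreover have "?w(k := v k) = ?w" using insert by auto
    ultimately have "W (\<lambda>j. if j \<in> insert k S then c j *\<^sub>R v j else v j) = c k * W ?w"
      using alternating_mapD(4)[OF W, of ?w k "c k" "v k"] by simp
    then show ?case using insert by simp
  qed simp
  from this[of UNIV] show ?thesis by simp
qed

text \<open>Putting the vanishing combination into slot m leaves only the term of
  \<open>v m\<close>, as the others repeat a vector.\<close>

lemma alternating_map_dependent:
  fixes v :: "'n::finite \<Rightarrow> 'v::real_vector"
  assumes W: "alternating_map W" and c: "(\<Sum>j\<in>UNIV. c j *\<^sub>R v j) = 0" "c m \<noteq> 0"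
  shows "W v = 0"
proof -
  note lin = alternating_mapD(1)[OF W, of v m]
  have "0 = W (v(m := (\<Sum>j\<in>UNIV. c j *\<^sub>R v j)))" using linear_0[OF lin] c by simp
  also have "\<dots> = (\<Sum>j\<in>UNIV. c j * W (v(m := v j)))"
    by (simp add: linear_sum[OF lin] alternating_mapD(4)[OF W])
  also have "\<dots> = (\<Sum>j\<in>{m}. c j * W (v(m := v j)))"
    by (rule sum.mono_neutral_right) (auto intro!: alternating_mapD(2)[OF W, of m])
  also have "\<dots> = c m * W v" by simp
  finally show ?thesis using c by simp
qed

text \<open>Induction over elementary linear maps, with W generalised because the composition step
  applies the hypothesis for g to the form that first maps its arguments by f. Absolute values
  suffice for densities and absorb the sign of a transposition.\<close>

lemma alternating_map_det:
  fixes W :: "('n::finite \<Rightarrow> real^'n) \<Rightarrow> real"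
  assumes "linear f" "alternating_map W"
  shows "\<bar>W (\<lambda>i. f (axis i 1))\<bar> = \<bar>det (matrix f)\<bar> * \<bar>W (\<lambda>i. axis i 1)\<bar>"
proof -
  let ?P = "\<lambda>f :: real^'n \<Rightarrow> real^'n. \<forall>W. alternating_map W \<longrightarrow>
      \<bar>W (\<lambda>i. f (axis i 1))\<bar> = \<bar>det (matrix f)\<bar> * \<bar>W (\<lambda>i. axis i 1)\<bar>"
  have "?P f"
  proof (rule induct_linear_elementary[OF assms(1)]; intro allI impI)
    fix f g :: "real^'n \<Rightarrow> real^'n" and W :: "('n \<Rightarrow> real^'n) \<Rightarrow> real"
    assume f: "linear f" "?P f" and g: "linear g" "?P g" and W: "alternating_map W"
    have "alternating_map (\<lambda>v. W (\<lambda>i. f (v i)))"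
      unfolding alternating_map_def
    proof (intro conjI allI impI)
      fix v :: "'n \<Rightarrow> real^'n" and i
      have "(\<lambda>x. W (\<lambda>j. f ((v(i := x)) j))) = (\<lambda>x. W ((\<lambda>j. f (v j))(i := x))) \<circ> f"
        by (auto simp: fun_eq_iff intro!: arg_cong[of _ _ W])
      then show "linear (\<lambda>x. W (\<lambda>j. f ((v(i := x)) j)))"
        using linear_compose[OF f(1) alternating_mapD(1)[OF W]] by simp
    next
      fix v :: "'n \<Rightarrow> real^'n" and i j :: 'n assume "i \<noteq> j" "v i = v j"
      then show "W (\<lambda>i. f (v i)) = 0" using alternating_mapD(2)[OF W, of i j] by simp
    qed
    then have "\<bar>W (\<lambda>i. f (g (axis i 1)))\<bar> = \<bar>det (matrix g)\<bar> * \<bar>W (\<lambda>i. f (axis i 1))\<bar>"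
      using g(2) by blast
    then show "\<bar>W (\<lambda>i. (f \<circ> g) (axis i 1))\<bar> = \<bar>det (matrix (f \<circ> g))\<bar> * \<bar>W (\<lambda>i. axis i 1)\<bar>"
      using f g W by (simp add: matrix_compose det_mul abs_mult)
  next
    fix f :: "real^'n \<Rightarrow> real^'n" and i and W :: "('n \<Rightarrow> real^'n) \<Rightarrow> real"
    assume f: "linear f" "\<And>x. f x $ i = 0" and W: "alternating_map W"
    \<comment> \<open>Both sides are going to be 0: the range lies in a coordinate hyperplane, so f
      is not surjective, hence not injective.\<close>
    have ninj: "\<not> inj f"
      using f by (metis (full_types) linear_injective_imp_surjective one_neq_zero surjE vec_component)
    then obtain x where x: "f x = 0" "x \<noteq> 0" using linear_inj_iff_eq_0[OF f(1)] by blast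
    have "(\<Sum>j\<in>UNIV. (x $ j) *\<^sub>R axis j 1) = x"
      using basis_expansion[of x] by (simp add: scalar_mult_eq_scaleR)
    then have "(\<Sum>j\<in>UNIV. (x $ j) *\<^sub>R f (axis j 1)) = f x"
      by (metis (no_types, lifting) f(1) linear_scale linear_sum sum.cong)
    moreover obtain m where "x $ m \<noteq> 0" using x(2) by (auto simp: vec_eq_iff)
    ultimately have "W (\<lambda>i. f (axis i 1)) = 0"
      using alternating_map_dependent[OF W, of "\<lambda>j. x $ j" "\<lambda>j. f (axis j 1)"] x by simp
    moreover have "det (matrix f) = 0" using ninj det_nz_iff_inj[OF f(1)] by blast
    ultimately show "\<bar>W (\<lambda>i. f (axis i 1))\<bar> = \<bar>det (matrix f)\<bar> * \<bar>W (\<lambda>i. axis i 1)\<bar>" by simp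
  next
    fix c and W :: "('n \<Rightarrow> real^'n) \<Rightarrow> real" assume W: "alternating_map W"
    let ?f = "\<lambda>x :: real^'n. \<chi> i. c i * x $ i"
    have "?f (axis j 1) = c j *\<^sub>R axis j 1" for j by (simp add: vec_eq_iff axis_def)
    then have "W (\<lambda>i. ?f (axis i 1)) = (\<Prod>j\<in>UNIV. c j) * W (\<lambda>i. axis i 1)"
      using alternating_map_scale[OF W, of c "\<lambda>i. axis i 1"] by simp
    moreover have "det (matrix ?f) = (\<Prod>j\<in>UNIV. c j)"
      by (subst det_diagonal) (auto simp: matrix_def axis_def)
    ultimately show "\<bar>W (\<lambda>i. ?f (axis i 1))\<bar> = \<bar>det (matrix ?f)\<bar> * \<bar>W (\<lambda>i. axis i 1)\<bar>"
      by (simp add: abs_mult)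
  next
    fix m n :: 'n and W :: "('n \<Rightarrow> real^'n) \<Rightarrow> real" assume mn: "m \<noteq> n" and W: "alternating_map W"
    let ?f = "\<lambda>x :: real^'n. \<chi> i. x $ Transposition.transpose m n i"
    have "?f (axis j 1) = axis (Transposition.transpose m n j) 1" for j
      by (auto simp: vec_eq_iff axis_def transpose_def)
    then have "W (\<lambda>i. ?f (axis i 1)) = - W (\<lambda>i. axis i 1)"
      using alternating_map_swap[OF W mn, of "\<lambda>i. axis i 1"] by simp
    moreover have "\<bar>det (matrix ?f)\<bar> = 1"
    proof -
      have "matrix ?f = (\<chi> i. mat 1 $ (Transposition.transpose m n i))"
        by (simp add: vec_eq_iff matrix_def axis_def mat_def)
      then show ?thesis by (simp add: det_permute_rows permutes_swap_id sign_swap_id abs_mult)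
    qed
    ultimately show "\<bar>W (\<lambda>i. ?f (axis i 1))\<bar> = \<bar>det (matrix ?f)\<bar> * \<bar>W (\<lambda>i. axis i 1)\<bar>" by simp
  next
    fix m n :: 'n and W :: "('n \<Rightarrow> real^'n) \<Rightarrow> real" assume mn: "m \<noteq> n" and W: "alternating_map W"
    let ?f = "\<lambda>x :: real^'n. \<chi> i. if i = m then x $ m + x $ n else x $ i"
    have "(\<lambda>j. ?f (axis j 1)) = (\<lambda>j. axis j 1)(n := axis n 1 + axis m 1)"
      using mn by (auto simp: vec_eq_iff axis_def fun_eq_iff)
    moreover have "(\<lambda>j. axis j 1)(n := axis n 1) = (\<lambda>j. axis j 1 :: real^'n)" by auto
    ultimately have "W (\<lambda>i. ?f (axis i 1)) = W (\<lambda>i. axis i 1) + W ((\<lambda>i. axis i 1)(n := axis m 1))"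
      using alternating_mapD(3)[OF W, of "\<lambda>i. axis i 1" n "axis n 1" "axis m 1"] by simp
    moreover have "W ((\<lambda>i. axis i 1)(n := axis m 1)) = 0"
      by (rule alternating_mapD(2)[OF W mn]) (use mn in simp)
    moreover have "det (matrix ?f) = 1"
    proof -
      have "matrix ?f = (\<chi> k. if k = m then row m (mat 1) + 1 *s row n (mat 1) else row k (mat 1))"
        using mn by (auto simp: vec_eq_iff matrix_def axis_def mat_def row_def)
      then show ?thesis using det_row_operation[OF mn, of "mat 1" 1] by simp
    qed
    ultimately show "\<bar>W (\<lambda>i. ?f (axis i 1))\<bar> = \<bar>det (matrix ?f)\<bar> * \<bar>W (\<lambda>i. axis i 1)\<bar>" by simp
  qed
  then show ?thesis using assms(2) by blast
qed

section \<open>Change of variables for nonnegative integrals\<close>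

lemma continuous_on_borel_vimage:
  fixes k :: "'a::topological_space \<Rightarrow> 'b::topological_space"
  assumes "continuous_on S k" "S \<in> sets borel" "X \<in> sets borel"
  shows "S \<inter> k -` X \<in> sets borel"
proof -
  have "k -` X \<inter> space (restrict_space borel S) \<in> sets (restrict_space borel S)"
    by (rule measurable_sets[OF borel_measurable_continuous_on_restrict[OF assms(1)] assms(3)])
  then show ?thesis
    using assms(2) by (simp add: sets_restrict_space_iff space_restrict_space Int_commute)
qed

lemma ennreal_indicator_mult: "ennreal (indicator X x * c) = ennreal c * indicator X x"
  by (simp add: indicator_def)

text \<open>The integrals may be infinite, whereas
  \<open>has_absolute_integral_change_of_variables\<close> concerns absolutely integrable functions.
  It is applied on an increasing sequence of sets on which everything is bounded, and both sides
  pass to the limit as measures.\<close>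

lemma nn_integral_change_of_variables:
  fixes g h :: "real^'n::{finite,wellorder} \<Rightarrow> real^'n::_" and r f :: "real^'n::_ \<Rightarrow> real"
  assumes S: "open S" "open (g ` S)" and der: "\<And>x. x \<in> S \<Longrightarrow> (g has_derivative g' x) (at x)"
    and h: "\<And>x. x \<in> S \<Longrightarrow> h (g x) = x" "continuous_on (g ` S) h"
    and f: "continuous_on (g ` S) f" "\<And>y. y \<in> g ` S \<Longrightarrow> 0 \<le> f y"
    and r: "continuous_on S r" "\<And>x. x \<in> S \<Longrightarrow> r x = \<bar>det (matrix (g' x))\<bar> * f (g x)"
    and A: "A \<in> sets borel" "A \<subseteq> S"
  shows "(\<integral>\<^sup>+x. ennreal (r x) * indicator A x \<partial>lborel) = (\<integral>\<^sup>+y. ennreal (f y) * indicator (g ` A) y \<partial>lborel)"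
proof -
  have contg: "continuous_on S g"
    using der by (intro continuous_at_imp_continuous_on) (auto intro: has_derivative_continuous)
  have inj: "inj_on g S" using h(1) by (metis inj_onI)
  have img: "g ` X \<in> sets borel" if "X \<in> sets borel" "X \<subseteq> S" for X
  proof -
    have "g ` X = g ` S \<inter> h -` X" using that h(1) by (auto simp: image_iff)
    then show ?thesis using continuous_on_borel_vimage[OF h(2) _ that(1)] S by simp
  qed
  \<comment> \<open>On \<open>B m\<close> the norm of \<open>g x\<close> and the density
    \<open>f (g x)\<close> are at most m, so the image has finite measure and f is integrable on
    it.\<close>
  define B where "B m = A \<inter> (S \<inter> (\<lambda>x. max (norm (g x)) (f (g x))) -` {..real m})" for m
  have "continuous_on S (\<lambda>x. max (norm (g x)) (f (g x)))"
    by (intro continuous_on_max continuous_on_norm contg continuous_on_compose2[OF f(1) contg]) auto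
  then have "S \<inter> (\<lambda>x. max (norm (g x)) (f (g x))) -` {..real m} \<in> sets borel" for m
    by (rule continuous_on_borel_vimage) (use S in auto)
  then have B: "B m \<in> sets borel" "B m \<subseteq> S" for m
    unfolding B_def using A by (auto intro!: sets.Int[OF A(1)])
  have eqB: "(\<integral>\<^sup>+x. ennreal (r x) * indicator (B m) x \<partial>lborel) =
      (\<integral>\<^sup>+y. ennreal (f y) * indicator (g ` B m) y \<partial>lborel)" for m
  proof -
    have gB: "g ` B m \<in> sets borel" "g ` B m \<subseteq> g ` S" using img[OF B] B(2)[of m] by auto
    have lm: "g ` B m \<in> lmeasurable"
      by (rule bounded_set_imp_lmeasurable) (use gB in \<open>auto simp: B_def intro!: boundedI[of _ "real m"]\<close>)
    have "f absolutely_integrable_on (g ` B m)"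
    proof (rule measurable_bounded_by_integrable_imp_absolutely_integrable)
      show "g ` B m \<in> sets lebesgue" using lm by blast
      then show "f \<in> borel_measurable (lebesgue_on (g ` B m))"
        by (intro continuous_imp_measurable_on_sets_lebesgue continuous_on_subset[OF f(1) gB(2)])
      show "(\<lambda>x. real m) integrable_on g ` B m" by (rule integrable_on_const[OF lm])
      show "norm (f x) \<le> real m" if "x \<in> g ` B m" for x
        using that f(2) by (auto simp: B_def)
    qed
    \<comment> \<open>The change of variables theorem is applied to vector-valued integrands, so the
      scalar one is viewed as a vector in \<open>real ^ 1\<close>.\<close>
    then have v: "(\<lambda>y. vec (f y) :: real^1) absolutely_integrable_on (g ` B m)"
      by (simp add: absolutely_integrable_on_1_iff)
    have "((\<lambda>x. \<bar>det (matrix (g' x))\<bar> *\<^sub>R (vec (f (g x)) :: real^1)) absolutely_integrable_on (B m) \<and>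
           integral (B m) (\<lambda>x. \<bar>det (matrix (g' x))\<bar> *\<^sub>R (vec (f (g x)) :: real^1)) = integral (g ` B m) (\<lambda>y. vec (f y)))"
    proof (subst has_absolute_integral_change_of_variables[where g = g])
      show "B m \<in> sets lebesgue" using B by simp
      show "(g has_derivative g' x) (at x within B m)" if "x \<in> B m" for x
        using der B(2) that by (blast intro: has_derivative_at_withinI)
      show "inj_on g (B m)" using inj B(2) by (rule inj_on_subset)
    qed (use v in simp)
    then have "(\<lambda>x. \<bar>det (matrix (g' x))\<bar> * f (g x)) absolutely_integrable_on (B m)"
      and "integral (B m) (\<lambda>x. \<bar>det (matrix (g' x))\<bar> * f (g x)) = integral (g ` B m) f"
      by (auto simp: absolutely_integrable_on_1_iff integral_on_1_eq vec_eq_iff)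
    then have "((\<lambda>x. \<bar>det (matrix (g' x))\<bar> * f (g x)) has_integral integral (g ` B m) f) (B m)"
      using integrable_integral set_lebesgue_integral_eq_integral(1) by metis
    then have rI: "(r has_integral integral (g ` B m) f) (B m)"
      by (rule has_integral_eq[rotated]) (metis r(2) B(2) subsetD)
    have r0: "0 \<le> r x" if "x \<in> B m" for x
      using r(2)[of x] f(2)[of "g x"] subsetD[OF B(2) that] by simp
    have "integral\<^sup>N lborel (\<lambda>x. indicator (B m) x * r x) = integral (g ` B m) f"
      by (rule nn_integral_has_integral_lebesgue[OF r0 rI])
    moreover have fI: "(f has_integral integral (g ` B m) f) (g ` B m)"
      using \<open>f absolutely_integrable_on (g ` B m)\<close> integrable_integral set_lebesgue_integral_eq_integral(1) by metis
    have "integral\<^sup>N lborel (\<lambda>x. indicator (g ` B m) x * f x) = integral (g ` B m) f"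
      by (rule nn_integral_has_integral_lebesgue[OF f(2)[OF subsetD[OF gB(2)]] fI])
    ultimately show ?thesis by (simp add: ennreal_indicator_mult)
  qed
  \<comment> \<open>Reading the integrals as measures of A and of its image turns the limit into
    continuity from below. The indicators make the densities Borel functions on the whole
    space.\<close>
  define N1 where "N1 = density lborel (\<lambda>x. ennreal (indicator S x *\<^sub>R r x))"
  define N2 where "N2 = density lborel (\<lambda>y. ennreal (indicator (g ` S) y *\<^sub>R f y))"
  have mr: "(\<lambda>x. ennreal (indicator S x *\<^sub>R r x)) \<in> borel_measurable lborel"
    using borel_measurable_continuous_on_indicator[OF _ r(1)] S by simp
  have mf: "(\<lambda>y. ennreal (indicator (g ` S) y *\<^sub>R f y)) \<in> borel_measurable lborel"
    using borel_measurable_continuous_on_indicator[OF _ f(1)] S by simp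
  have N1: "emeasure N1 X = (\<integral>\<^sup>+x. ennreal (r x) * indicator X x \<partial>lborel)" if "X \<in> sets borel" "X \<subseteq> S" for X
    unfolding N1_def using that by (subst emeasure_density[OF mr]) (auto intro!: nn_integral_cong simp: indicator_def)
  have N2: "emeasure N2 X = (\<integral>\<^sup>+x. ennreal (f x) * indicator X x \<partial>lborel)" if "X \<in> sets borel" "X \<subseteq> g ` S" for X
    unfolding N2_def using that by (subst emeasure_density[OF mf]) (auto intro!: nn_integral_cong simp: indicator_def)
  have UB: "A = (\<Union>m. B m)"
  proof
    show "A \<subseteq> (\<Union>m. B m)"
    proof
      fix x assume x: "x \<in> A"
      obtain m where "max (norm (g x)) (f (g x)) \<le> real m" using real_arch_simple by blast
      then show "x \<in> (\<Union>m. B m)" using x A by (auto simp: B_def)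
    qed
  qed (auto simp: B_def)
  have inc: "incseq B" by (auto simp: B_def incseq_def intro: order_trans)
  have "emeasure N1 A = (SUP m. emeasure N1 (B m))"
    unfolding UB by (rule SUP_emeasure_incseq[symmetric]) (use B inc in \<open>auto simp: N1_def\<close>)
  also have "\<dots> = (SUP m. emeasure N2 (g ` B m))"
    using N1[OF B] N2[OF img[OF B] image_mono[OF B(2)]] eqB by simp
  also have "\<dots> = emeasure N2 (\<Union>m. g ` B m)"
    by (rule SUP_emeasure_incseq) (use img[OF B] inc in \<open>auto simp: N2_def incseq_def intro!: image_mono\<close>)
  also have "(\<Union>m. g ` B m) = g ` A" unfolding UB by blast
  finally show ?thesis using N1[OF A] N2[OF img[OF A] image_mono[OF A(2)]] by simp
qed

section \<open>Coordinates on model spaces\<close>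

lemma model_basis:
  "distinct (model_basis :: 'e::fin_dim list)" "independent (set (model_basis :: 'e list))"
  "span (set (model_basis :: 'e list)) = UNIV"
proof -
  obtain B :: "'e set" where B: "finite B" "span B = UNIV" using finite_spanning_set by blast
  obtain B' where B': "B' \<subseteq> B" "independent B'" "B \<subseteq> span B'"
    using maximal_independent_subset[of B] by blast
  have "span B' = UNIV" using B B' by (metis span_minimal subspace_span top.extremum_uniqueI)
  moreover obtain bs where "set bs = B'" "distinct bs"
    using finite_distinct_list finite_subset[OF B'(1) B(1)] by metis
  ultimately have "\<exists>bs :: 'e list. distinct bs \<and> independent (set bs) \<and> span (set bs) = UNIV"
    using B' by blast
  from someI_ex[OF this]
  show "distinct (model_basis :: 'e list)" "independent (set (model_basis :: 'e list))"
    "span (set (model_basis :: 'e list)) = UNIV" by (auto simp: model_basis_def)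
qed

lemma length_model_basis: "length (model_basis :: 'e::fin_dim list) = dim (UNIV :: 'e set)"
  using model_basis[where 'e = 'e] dim_span_eq_card_independent[of "set (model_basis :: 'e list)"]
  by (simp add: distinct_card)

text \<open>The change of variables theorem of the library refers to \<open>real ^ 'n\<close>, so the dimension of
  a model space is turned into an index type. The disjunct \<open>i = 0\<close> makes the type inhabited in
  dimension zero, where the index type is of no use.\<close>

typedef (overloaded) ('e::fin_dim) model_index =
  "{i :: nat. i < length (model_basis :: 'e list) \<or> i = 0}"
  by auto

instance model_index :: (fin_dim) finite
proof
  have "finite {i :: nat. i < length (model_basis :: 'a list) \<or> i = 0}" by simp
  then show "finite (UNIV :: 'a model_index set)"
    by (metis (mono_tags, lifting) Abs_model_index_cases UNIV_eq_I finite_imageI image_eqI finite_subset subset_UNIV)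
qed

instantiation model_index :: (fin_dim) wellorder
begin

definition less_eq_model_index :: "'a model_index \<Rightarrow> 'a model_index \<Rightarrow> bool" where
  "less_eq_model_index i j \<longleftrightarrow> Rep_model_index i \<le> Rep_model_index j"

definition less_model_index :: "'a model_index \<Rightarrow> 'a model_index \<Rightarrow> bool" where
  "less_model_index i j \<longleftrightarrow> Rep_model_index i < Rep_model_index j"

instance
proof
  fix P and a :: "'a model_index"
  assume step: "\<And>x :: 'a model_index. (\<And>y. y < x \<Longrightarrow> P y) \<Longrightarrow> P x"
  show "P a"
  proof (induction a rule: measure_induct_rule[where f = Rep_model_index])
    case (less x)
    show ?case by (rule step) (rule less.IH, simp add: less_model_index_def)
  qed
qed (auto simp: less_eq_model_index_def less_model_index_def Rep_model_index_inject)

end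

text \<open>Identifies a coordinate space with the model space by the same basis that enters
  \<open>model_lebesgue\<close> and \<open>chart_density\<close>.\<close>

definition model_coords :: "(real, 'e::fin_dim model_index) vec \<Rightarrow> 'e" where
  "model_coords v = (\<Sum>i\<in>UNIV. v $ i *\<^sub>R model_basis ! Rep_model_index i)"

context
  assumes pos: "model_basis \<noteq> ([] :: 'e::fin_dim list)"
begin

text \<open>Positive dimension is essential: only then is the inhabiting element 0 an index of the
  basis anyway.\<close>

lemma Rep_model_index_bij:
  "bij_betw Rep_model_index (UNIV :: 'e model_index set) {..<length (model_basis :: 'e list)}"
proof -
  have "{i :: nat. i < length (model_basis :: 'e list) \<or> i = 0} = {..<length (model_basis :: 'e list)}"
    using pos by auto
  then show ?thesis
    using type_definition.Rep_range[OF type_definition_model_index[where 'e = 'e]]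
    by (auto simp: bij_betw_def Rep_model_index_inject inj_on_def)
qed

lemma Rep_model_index_less: "Rep_model_index (i :: 'e model_index) < length (model_basis :: 'e list)"
  using Rep_model_index_bij by (auto simp: bij_betw_def)

lemma Rep_Abs_model_index:
  "i < length (model_basis :: 'e list) \<Longrightarrow> Rep_model_index (Abs_model_index i :: 'e model_index) = i"
  by (simp add: Abs_model_index_inverse)

lemma model_coords_linear: "linear (model_coords :: _ \<Rightarrow> 'e)"
  by (rule linearI) (simp_all add: model_coords_def scaleR_add_left sum.distrib scaleR_sum_right)

lemma model_coords_axis: "model_coords (axis i 1) = (model_basis ! Rep_model_index i :: 'e)"
proof -
  have "model_coords (axis i 1) = (\<Sum>j\<in>UNIV. if j = i then (model_basis ! Rep_model_index j :: 'e) else 0)"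
    unfolding model_coords_def by (rule sum.cong) (auto simp: axis_def)
  then show ?thesis by simp
qed

lemma model_coords_bij: "bij (model_coords :: _ \<Rightarrow> 'e)"
proof -
  let ?b = "\<lambda>i :: 'e model_index. (model_basis ! Rep_model_index i :: 'e)"
  have "bij_betw (\<lambda>i. model_basis ! i) {..<length (model_basis :: 'e list)} (set (model_basis :: 'e list))"
    using model_basis(1)[where 'e = 'e] by (auto simp: bij_betw_nth)
  from bij_betw_trans[OF Rep_model_index_bij this]
  have b: "bij_betw ?b UNIV (set model_basis)" by (simp add: comp_def)
  have inj: "inj (model_coords :: _ \<Rightarrow> 'e)"
    unfolding linear_injective_0[OF model_coords_linear]
  proof (intro allI impI)
    fix v :: "(real, 'e model_index) vec" assume v: "model_coords v = 0"
    have inv_b: "inv_into UNIV ?b (?b i) = i" for i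
      by (rule inv_into_f_f[OF bij_betw_imp_inj_on[OF b]]) simp
    have "v $ i = 0" for i
    proof -
      have "(\<Sum>x\<in>set (model_basis :: 'e list). v $ (inv_into UNIV ?b x) *\<^sub>R x) = (\<Sum>i\<in>UNIV. v $ (inv_into UNIV ?b (?b i)) *\<^sub>R ?b i)"
        by (rule sum.reindex_bij_betw[OF b, symmetric])
      also have "\<dots> = 0" using v by (simp only: inv_b model_coords_def)
      finally have "\<forall>x\<in>set (model_basis :: 'e list). v $ (inv_into UNIV ?b x) = 0"
        using independentD[OF model_basis(2)[where 'e = 'e] finite_set subset_refl,
            where u = "\<lambda>x. v $ (inv_into UNIV ?b x)"] by blast
      moreover have "?b i \<in> set model_basis" using b by (auto simp: bij_betw_def)
      ultimately have "v $ (inv_into UNIV ?b (?b i)) = 0" by blast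
      then show ?thesis by (simp only: inv_b)
    qed
    then show "v = 0" by (simp add: vec_eq_iff)
  qed
  have "span (set (model_basis :: 'e list)) \<subseteq> range model_coords"
  proof (rule span_minimal)
    show "set (model_basis :: 'e list) \<subseteq> range model_coords"
    proof
      fix x :: 'e assume "x \<in> set model_basis"
      then obtain i where "x = ?b i" using b by (auto simp: bij_betw_def)
      then show "x \<in> range model_coords" using model_coords_axis by (metis rangeI)
    qed
    show "subspace (range (model_coords :: _ \<Rightarrow> 'e))"
      by (rule linear_subspace_image[OF model_coords_linear subspace_UNIV])
  qed
  then have "surj (model_coords :: _ \<Rightarrow> 'e)" using model_basis(3)[where 'e = 'e] by auto
  with inj show ?thesis by (simp add: bij_def)
qed

lemma model_coords_inv [simp]:
  "model_coords (inv_into UNIV model_coords x) = (x :: 'e)" "inv_into UNIV model_coords (model_coords v :: 'e) = v"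
  using model_coords_bij by (auto simp: bij_def surj_f_inv_f inv_f_f)

lemma model_coords_inv_linear: "linear (inv_into UNIV (model_coords :: _ \<Rightarrow> 'e))"
  by (rule linearI) (metis linear_add[OF model_coords_linear] model_coords_inv,
      metis linear_scale[OF model_coords_linear] model_coords_inv)

text \<open>\<open>lborel\<close> is characterised by its values on boxes. Relabelled along the
  enumeration of the basis, a box becomes a product of intervals, whose measure under the product of
  the real lines is the product of the side lengths.\<close>

lemma model_lebesgue_eq: "model_lebesgue = distr lborel borel (model_coords :: _ \<Rightarrow> 'e)"
proof -
  let ?k = "length (model_basis :: 'e list)"
  let ?PM = "\<Pi>\<^sub>M i\<in>{..<?k}. (lborel :: real measure)"
  let ?v = "\<lambda>x. (\<chi> j. x (Rep_model_index j)) :: (real, 'e model_index) vec"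
  interpret product_sigma_finite "\<lambda>i::nat. lborel :: real measure" ..
  have mv: "?v \<in> measurable ?PM borel"
  proof (subst borel_measurable_euclidean_space, intro ballI)
    fix b :: "(real, 'e model_index) vec" assume "b \<in> Basis"
    then obtain j where "b = axis j 1" by (auto simp: Basis_vec_def)
    then have "(\<lambda>x. ?v x \<bullet> b) = (\<lambda>x. x (Rep_model_index j))" by (simp add: inner_axis)
    moreover have "(\<lambda>x. x (Rep_model_index j)) \<in> measurable ?PM lborel"
      by (rule measurable_component_singleton) (simp add: Rep_model_index_less)
    ultimately show "(\<lambda>x. ?v x \<bullet> b) \<in> borel_measurable ?PM" by simp
  qed
  have "lborel = distr ?PM borel ?v"
  proof (rule lborel_eqI)
    fix l u :: "(real, 'e model_index) vec" assume le: "\<And>b. b \<in> Basis \<Longrightarrow> l \<bullet> b \<le> u \<bullet> b"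
    let ?ix = "\<lambda>i. Abs_model_index i :: 'e model_index"
    have lu: "l $ j \<le> u $ j" for j using le[of "axis j 1"] by (simp add: inner_axis)
    have "?v -` box l u \<inter> space ?PM = (\<Pi>\<^sub>E i\<in>{..<?k}. {l $ ?ix i<..<u $ ?ix i})"
    proof (intro equalityI subsetI)
      fix x assume x: "x \<in> ?v -` box l u \<inter> space ?PM"
      then have "l $ j < x (Rep_model_index j) \<and> x (Rep_model_index j) < u $ j" for j
        by (simp add: mem_box_cart)
      then have "l $ ?ix i < x i \<and> x i < u $ ?ix i" if "i < ?k" for i using Rep_Abs_model_index[OF that] by metis
      then show "x \<in> (\<Pi>\<^sub>E i\<in>{..<?k}. {l $ ?ix i<..<u $ ?ix i})" using x by (auto simp: space_PiM PiE_iff)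
    next
      fix x assume x: "x \<in> (\<Pi>\<^sub>E i\<in>{..<?k}. {l $ ?ix i<..<u $ ?ix i})"
      then have "l $ ?ix i < x i \<and> x i < u $ ?ix i" if "i < ?k" for i using that by (auto simp: PiE_iff)
      from this[OF Rep_model_index_less]
      have "l $ j < x (Rep_model_index j) \<and> x (Rep_model_index j) < u $ j" for j
        by (simp add: Rep_model_index_inverse)
      then show "x \<in> ?v -` box l u \<inter> space ?PM" using x by (auto simp: space_PiM PiE_iff mem_box_cart)
    qed
    then have "emeasure (distr ?PM borel ?v) (box l u) = emeasure ?PM (\<Pi>\<^sub>E i\<in>{..<?k}. {l $ ?ix i<..<u $ ?ix i})"
      by (simp add: emeasure_distr[OF mv])
    also have "\<dots> = (\<Prod>i<?k. ennreal (u $ ?ix i - l $ ?ix i))"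
      by (subst emeasure_PiM) (auto simp: lu intro!: prod.cong)
    also have "\<dots> = (\<Prod>j\<in>(UNIV :: 'e model_index set). ennreal (u $ ?ix (Rep_model_index j) - l $ ?ix (Rep_model_index j)))"
      by (rule prod.reindex_bij_betw[OF Rep_model_index_bij, of "\<lambda>i. ennreal (u $ ?ix i - l $ ?ix i)", symmetric])
    also have "\<dots> = ennreal (\<Prod>j\<in>UNIV. u $ j - l $ j)"
      using lu by (simp add: Rep_model_index_inverse prod_ennreal)
    also have "(\<Prod>j\<in>UNIV. u $ j - l $ j) = (\<Prod>b\<in>Basis. (u - l) \<bullet> b)"
    proof -
      have B: "Basis = range (\<lambda>j. axis j 1 :: (real, 'e model_index) vec)" by (auto simp: Basis_vec_def)
      have inj: "inj (\<lambda>j. axis j 1 :: (real, 'e model_index) vec)" by (simp add: inj_on_def axis_eq_axis)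
      have "(\<Prod>b\<in>Basis. (u - l) \<bullet> b) = prod ((\<lambda>b. (u - l) \<bullet> b) \<circ> (\<lambda>j. axis j 1)) UNIV"
        unfolding B by (rule prod.reindex[OF inj])
      then show ?thesis by (simp add: inner_axis)
    qed
    finally show "emeasure (distr ?PM borel ?v) (box l u) = ennreal (\<Prod>b\<in>Basis. (u - l) \<bullet> b)" .
  qed simp
  then have "distr lborel borel (model_coords :: _ \<Rightarrow> 'e) = distr (distr ?PM borel ?v) borel model_coords" by simp
  also have "\<dots> = distr ?PM borel (model_coords \<circ> ?v)"
    by (rule distr_distr[OF _ mv]) (rule borel_measurable_continuous_onI[OF linear_continuous_on[OF fin_dim_linear_bounded[OF model_coords_linear]]])
  also have "model_coords (?v x) = (\<Sum>i<?k. x i *\<^sub>R (model_basis ! i :: 'e))" for x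
    unfolding model_coords_def using sum.reindex_bij_betw[OF Rep_model_index_bij, of "\<lambda>i. x i *\<^sub>R (model_basis ! i :: 'e)"]
    by simp
  then have "distr ?PM borel (model_coords \<circ> ?v) = model_lebesgue"
    by (simp add: model_lebesgue_def comp_def)
  finally show ?thesis by simp
qed

lemma nn_integral_model_lebesgue:
  assumes "(\<lambda>x. ennreal (f x) * indicator B x) \<in> borel_measurable borel"
  shows "(\<integral>\<^sup>+x. ennreal (f x) * indicator B x \<partial>model_lebesgue) =
    (\<integral>\<^sup>+v. ennreal (f (model_coords v)) * indicator (inv_into UNIV model_coords ` (B :: 'e set)) v \<partial>lborel)"
proof -
  have "(model_coords :: _ \<Rightarrow> 'e) \<in> measurable lborel borel"
    using borel_measurable_continuous_onI[OF linear_continuous_on[OF fin_dim_linear_bounded[OF model_coords_linear]]] by simp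
  then have "(\<integral>\<^sup>+x. ennreal (f x) * indicator B x \<partial>model_lebesgue) =
    (\<integral>\<^sup>+v. ennreal (f (model_coords v)) * indicator B (model_coords v) \<partial>lborel)"
    unfolding model_lebesgue_eq by (rule nn_integral_distr) (simp add: assms)
  moreover have "indicator B (model_coords v) = (indicator (inv_into UNIV model_coords ` (B :: 'e set)) v :: ennreal)" for v
  proof -
    have "model_coords v \<in> B \<longleftrightarrow> v \<in> inv_into UNIV model_coords ` (B :: 'e set)"
      using model_coords_inv by (metis image_iff)
    then show ?thesis by (simp add: indicator_def)
  qed
  ultimately show ?thesis by simp
qed

end

section \<open>The measure of a volume form\<close>

locale volume_manifold =
  fixes S :: "('a, 'e::fin_dim) mfd" and vol :: "'a \<Rightarrow> 'e list \<Rightarrow> real"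
  assumes manifold: "smooth_manifold S" and vol: "volume_form S vol"
begin

lemma atlas: "smooth_atlas S" by (rule smooth_manifold_atlas[OF manifold])

definition Borel :: "'a measure" where
  "Borel = sigma (points S) {U. openin (Topo S) U}"

lemma opens_Pow: "{U. openin (Topo S) U} \<subseteq> Pow (points S)"
  using openin_subset by (auto simp: points_def)

lemma space_Borel [simp]: "space Borel = points S"
  and sets_Borel: "sets Borel = sigma_sets (points S) {U. openin (Topo S) U}"
  using opens_Pow by (simp_all add: Borel_def)

lemma open_Borel: "openin (Topo S) U \<Longrightarrow> U \<in> sets Borel"
  by (auto simp: sets_Borel)

lemma open_image: "c \<in> Atlas S \<Longrightarrow> open (snd c ` fst c)"
  using chart_open_image'[OF atlas _ chart_openin[OF atlas]] by blast

lemma chart_inv_measurable: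
  assumes c: "c \<in> Atlas S"
  shows "chart_inv c \<in> measurable (restrict_space borel (snd c ` fst c)) Borel"
  unfolding Borel_def
proof (rule measurable_sigma_sets[where A = "{U. openin (Topo S) U}"])
  show "chart_inv c \<in> space (restrict_space borel (snd c ` fst c)) \<rightarrow> points S"
    using atlas c chart_subset[OF atlas c] by (auto simp: space_restrict_space)
  fix U assume "U \<in> {U. openin (Topo S) U}"
  then have o: "open (snd c ` (fst c \<inter> U))" using chart_open_image[OF atlas c] by simp
  have "chart_inv c -` U \<inter> space (restrict_space borel (snd c ` fst c)) = snd c ` (fst c \<inter> U)"
    using atlas c by (auto simp: space_restrict_space)
  then show "chart_inv c -` U \<inter> space (restrict_space borel (snd c ` fst c)) \<in> sets (restrict_space borel (snd c ` fst c))"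
    using o open_image[OF c] by (auto simp: sets_restrict_space_iff)
qed (auto simp: opens_Pow sets_Borel[unfolded Borel_def])

lemma chart_image_preimage:
  "c \<in> Atlas S \<Longrightarrow> B \<subseteq> fst c \<Longrightarrow> snd c ` B = chart_inv c -` B \<inter> snd c ` fst c"
  using atlas by (auto simp: image_iff)

lemma chart_image_borel:
  assumes c: "c \<in> Atlas S" and B: "B \<in> sets Borel" "B \<subseteq> fst c"
  shows "snd c ` B \<in> sets borel"
  using measurable_sets[OF chart_inv_measurable[OF c] B(1)] chart_image_preimage[OF c B(2)] open_image[OF c]
  by (simp add: space_restrict_space sets_restrict_space_iff)

lemma chart_density_continuous:
  assumes c: "c \<in> Atlas S"
  shows "continuous_on (snd c ` fst c) (chart_density S vol c)"
proof -
  have "\<forall>c\<in>Atlas S. \<forall>vs. length vs = dim (UNIV :: 'e set) \<longrightarrow>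
      smooth_on (snd c ` fst c) (\<lambda>x. vol (chart_inv c x) (map (from_chart S c (chart_inv c x)) vs))"
    using vol by (simp add: volume_form_def Let_def)
  from this[rule_format, OF c length_model_basis]
  show ?thesis unfolding chart_density_def[abs_def] Let_def
    by (intro continuous_intros smooth_on_continuous_on)
qed

lemma chart_density_measurable:
  assumes c: "c \<in> Atlas S" and B: "B \<in> sets borel" "B \<subseteq> snd c ` fst c"
  shows "(\<lambda>x. ennreal (chart_density S vol c x) * indicator B x) \<in> borel_measurable borel"
proof -
  have "(\<lambda>x. indicator (snd c ` fst c) x *\<^sub>R chart_density S vol c x) \<in> borel_measurable borel"
    by (rule borel_measurable_continuous_on_indicator[OF _ chart_density_continuous[OF c]])
       (use open_image[OF c] in simp)
  then have "(\<lambda>x. ennreal (indicator (snd c ` fst c) x *\<^sub>R chart_density S vol c x) * indicator B x) \<in> borel_measurable borel"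
    using B(1) by measurable
  moreover have "ennreal (indicator (snd c ` fst c) x *\<^sub>R chart_density S vol c x) * indicator B x =
      ennreal (chart_density S vol c x) * indicator B x" for x
    using B(2) by (auto simp: indicator_def)
  ultimately show ?thesis by simp
qed

text \<open>The model space is a single point, so a chart covers at most one point s of the
  manifold, and either density is the absolute value of \<open>vol s []\<close>.\<close>

lemma chart_integral_dim0:
  assumes c: "c \<in> Atlas S" and d: "d \<in> Atlas S" and B: "B \<subseteq> fst c" "B \<subseteq> fst d"
    and nil: "model_basis = ([] :: 'e list)"
  shows "(\<integral>\<^sup>+x. ennreal (chart_density S vol c x) * indicator (snd c ` B) x \<partial>model_lebesgue) =
    (\<integral>\<^sup>+x. ennreal (chart_density S vol d x) * indicator (snd d ` B) x \<partial>model_lebesgue)"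
proof -
  have "(UNIV :: 'e set) = {0}" using model_basis(3)[where 'e = 'e] nil by simp
  then have all: "x = y" for x y :: 'e by (metis UNIV_I singletonD)
  have "ennreal (chart_density S vol c x) * indicator (snd c ` B) x =
      ennreal (chart_density S vol d x) * indicator (snd d ` B) x" for x
  proof (cases "B = {}")
    case False
    then obtain s where s: "s \<in> B" by blast
    have "chart_inv c (snd c s) = s" "chart_inv d (snd d s) = s" using s B atlas c d by auto
    then have "chart_inv c x = s" "chart_inv d x = s" using all by metis+
    moreover have "x \<in> snd c ` B" "x \<in> snd d ` B" using s all by blast+
    ultimately show ?thesis by (simp add: chart_density_def nil)
  qed simp
  then show ?thesis by simp
qed

text \<open>Transformation rule of the density. It is used with F the map \<open>from_chart\<close>
  of one chart and T the Jacobian from another chart to it; their composition is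
  \<open>from_chart\<close> of the other chart.\<close>

lemma vol_det:
  assumes pos: "model_basis \<noteq> ([] :: 'e list)" and s: "s \<in> points S"
    and F: "linear F" and T: "linear (T :: 'e \<Rightarrow> 'e)"
  shows "\<bar>vol s (map (\<lambda>x. F (T x)) model_basis)\<bar> =
    \<bar>det (matrix (\<lambda>v. inv_into UNIV model_coords (T (model_coords v))))\<bar> * \<bar>vol s (map F model_basis)\<bar>"
proof -
  let ?k = "length (model_basis :: 'e list)"
  let ?ix = "\<lambda>i. Abs_model_index i :: 'e model_index"
  let ?C = "inv_into UNIV (model_coords :: _ \<Rightarrow> 'e)"
  \<comment> \<open>Feeds vectors in coordinates, indexed by \<open>model_index\<close>, into the
    list argument of the volume form after applying F.\<close>
  define L where "L v = map (\<lambda>i. F (model_coords (v (?ix i)))) [0..<?k]" for v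
  have alt: "alternating_form ?k (vol s)"
    using vol s unfolding volume_form_def Let_def length_model_basis by blast
  have len: "length (L v) = ?k" for v by (simp add: L_def)
  have "alternating_map (\<lambda>v. vol s (L v))"
    unfolding alternating_map_def
  proof (intro conjI allI impI)
    fix v :: "'e model_index \<Rightarrow> (real, 'e model_index) vec" and i :: "'e model_index"
    have idx: "Rep_model_index i = j \<longleftrightarrow> Abs_model_index j = i" if "j < ?k" for j
      using Rep_Abs_model_index[OF pos that] Rep_model_index_inverse[of i] by auto
    have "L (v(i := x)) = (L v)[Rep_model_index i := F (model_coords x)]" for x
      by (rule nth_equalityI) (auto simp: L_def nth_list_update idx Rep_Abs_model_index[OF pos])
    then have "(\<lambda>x. vol s (L (v(i := x)))) = (\<lambda>y. vol s ((L v)[Rep_model_index i := y])) \<circ> (F \<circ> model_coords)"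
      by (simp add: fun_eq_iff)
    moreover have "linear (\<lambda>y. vol s ((L v)[Rep_model_index i := y]))"
      using alt len[of v] Rep_model_index_less[OF pos, of i] by (simp add: alternating_form_def)
    ultimately show "linear (\<lambda>x. vol s (L (v(i := x))))"
      using linear_compose[OF linear_compose[OF model_coords_linear[OF pos] F]] by simp
  next
    fix v :: "'e model_index \<Rightarrow> (real, 'e model_index) vec" and i j :: "'e model_index"
    assume ij: "i \<noteq> j" "v i = v j"
    have "L v ! Rep_model_index i = L v ! Rep_model_index j"
      using ij by (simp add: L_def Rep_model_index_less[OF pos] Rep_model_index_inverse)
    moreover have "Rep_model_index i \<noteq> Rep_model_index j" using ij by (simp add: Rep_model_index_inject)
    ultimately have "\<not> distinct (L v)"
      using nth_eq_iff_index_eq[of "L v" "Rep_model_index i" "Rep_model_index j"]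
      by (auto simp: len Rep_model_index_less[OF pos])
    then show "vol s (L v) = 0" using alt len unfolding alternating_form_def by blast
  qed
  moreover have lin: "linear (\<lambda>v. ?C (T (model_coords v)))"
    using linear_compose[OF linear_compose[OF model_coords_linear[OF pos] T] model_coords_inv_linear[OF pos]]
    by (simp add: comp_def)
  ultimately have "\<bar>vol s (L (\<lambda>i. ?C (T (model_coords (axis i 1)))))\<bar> =
      \<bar>det (matrix (\<lambda>v. ?C (T (model_coords v))))\<bar> * \<bar>vol s (L (\<lambda>i. axis i 1))\<bar>"
    using alternating_map_det[OF lin, of "\<lambda>v. vol s (L v)"] by simp
  moreover have "L (\<lambda>i. ?C (T (model_coords (axis i 1)))) = map (\<lambda>x. F (T x)) model_basis"
    by (rule nth_equalityI)
       (auto simp: L_def model_coords_axis[OF pos] model_coords_inv[OF pos] Rep_Abs_model_index[OF pos])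
  moreover have "L (\<lambda>i. axis i 1) = map F model_basis"
    by (rule nth_equalityI) (auto simp: L_def model_coords_axis[OF pos] Rep_Abs_model_index[OF pos])
  ultimately show ?thesis by simp
qed

text \<open>Change of variables for the transition map, written in basis coordinates as g with
  inverse h; the relation between the two densities is \<open>vol_det\<close>.\<close>

lemma chart_integral_agree:
  assumes c: "c \<in> Atlas S" and d: "d \<in> Atlas S" and B: "B \<in> sets Borel" "B \<subseteq> fst c" "B \<subseteq> fst d"
  shows "(\<integral>\<^sup>+x. ennreal (chart_density S vol c x) * indicator (snd c ` B) x \<partial>model_lebesgue) =
    (\<integral>\<^sup>+x. ennreal (chart_density S vol d x) * indicator (snd d ` B) x \<partial>model_lebesgue)"
proof (cases "model_basis = ([] :: 'e list)")
  case True
  then show ?thesis by (rule chart_integral_dim0[OF c d B(2,3)])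
next
  case pos: False
  note A = atlas
  let ?L = "model_coords :: _ \<Rightarrow> 'e"
  let ?C = "inv_into UNIV ?L"
  note LC [simp] = model_coords_inv[OF pos]
  define D where "D = fst c \<inter> fst d"
  have Do: "openin (Topo S) D" unfolding D_def by (intro openin_Int chart_openin A c d)
  define U where "U = ?C ` snd c ` D"
  define g where "g v = ?C (snd d (chart_inv c (?L v)))" for v
  define h where "h v = ?C (snd c (chart_inv d (?L v)))" for v
  define g' where "g' v w = ?C (transition c d (chart_inv c (?L v)) (?L w))" for v w
  have contL: "continuous_on X ?L" and contC: "continuous_on Y ?C" for X Y
    by (intro linear_continuous_on fin_dim_linear_bounded model_coords_linear[OF pos] model_coords_inv_linear[OF pos])+
  have openC: "open (?C ` X)" if "open X" for X
  proof -
    have "?C ` X = ?L -` X" by (force simp: image_iff intro: LC(2)[symmetric])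
    then show ?thesis using open_vimage[OF that contL] by simp
  qed
  have gU: "g ` U = ?C ` snd d ` D" using A c by (force simp: U_def g_def D_def image_iff)
  have [simp]: "chart_inv c (snd c s) = s" if "s \<in> D" for s using that A c by (simp add: D_def)
  have [simp]: "chart_inv d (snd d s) = s" if "s \<in> D" for s using that A d by (simp add: D_def)
  have oc: "open (snd c ` D)" "open (snd d ` D)"
    using chart_open_image'[OF A c Do] chart_open_image'[OF A d Do] by (auto simp: D_def)
  have dens: "chart_density S vol c (?L v) = \<bar>det (matrix (g' v))\<bar> * chart_density S vol d (?L (g v))"
    if v: "v \<in> U" for v
  proof -
    obtain s where s: "s \<in> D" "v = ?C (snd c s)" using v by (auto simp: U_def)
    then have s': "s \<in> fst c" "s \<in> fst d" "s \<in> points S" using chart_subset[OF A c] by (auto simp: D_def)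
    have "\<bar>vol s (map (\<lambda>x. from_chart S d s (transition c d s x)) model_basis)\<bar> =
        \<bar>det (matrix (\<lambda>v. ?C (transition c d s (?L v))))\<bar> * \<bar>vol s (map (from_chart S d s) model_basis)\<bar>"
      by (rule vol_det[OF pos s'(3) from_chart_linear[OF A d s'(2)] transition_linear[OF A c d s'(1,2)]])
    moreover have "(\<lambda>x. from_chart S d s (transition c d s x)) = from_chart S c s"
      using from_chart_transition_eq[OF A c s'(1) d s'(2)] by auto
    ultimately show ?thesis using s by (simp add: chart_density_def g'_def[abs_def] g_def)
  qed
  have Bc: "snd c ` B \<in> sets borel" "snd c ` B \<subseteq> snd c ` fst c" and Bd: "snd d ` B \<in> sets borel" "snd d ` B \<subseteq> snd d ` fst d"
    using chart_image_borel[OF c B(1,2)] chart_image_borel[OF d B(1,3)] B by auto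
  have "(\<integral>\<^sup>+v. ennreal (chart_density S vol c (?L v)) * indicator (?C ` snd c ` B) v \<partial>lborel) =
      (\<integral>\<^sup>+v. ennreal (chart_density S vol d (?L v)) * indicator (g ` (?C ` snd c ` B)) v \<partial>lborel)"
  proof (rule nn_integral_change_of_variables[where S = U and g' = g' and h = h])
    show "open U" "open (g ` U)" unfolding gU unfolding U_def by (intro openC oc)+
    show "(g has_derivative g' v) (at v)" if v: "v \<in> U" for v
    proof -
      obtain s where s: "s \<in> D" "v = ?C (snd c s)" using v by (auto simp: U_def)
      then have s': "s \<in> fst c" "s \<in> fst d" by (auto simp: D_def)
      have L': "(?L has_derivative ?L) (at v)" and C': "(?C has_derivative ?C) (at x)" for x
        by (intro bounded_linear_imp_has_derivative fin_dim_linear_bounded model_coords_linear[OF pos] model_coords_inv_linear[OF pos])+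
      have "((\<lambda>x. snd d (chart_inv c x)) has_derivative transition c d s) (at (?L v))"
        using transition_has_derivative[OF A c d s'] s by simp
      from has_derivative_compose[OF has_derivative_compose[OF L' this] C']
      show ?thesis using s by (simp add: g_def[abs_def] g'_def[abs_def])
    qed
    show "h (g v) = v" if "v \<in> U" for v using that by (auto simp: U_def h_def g_def)
    have trd: "continuous_on (snd d ` D) (\<lambda>x. snd c (chart_inv d x))"
      using smooth_on_continuous_on[OF transition_smooth[OF A d c]] by (simp add: D_def Int_commute)
    show "continuous_on (g ` U) h" unfolding gU h_def[abs_def]
      by (rule continuous_on_compose2[OF contC continuous_on_compose2[OF trd contL]]) auto
    show "continuous_on (g ` U) (\<lambda>v. chart_density S vol d (?L v))" unfolding gU
      by (rule continuous_on_compose2[OF chart_density_continuous[OF d] contL]) (auto simp: D_def)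
    show "continuous_on U (\<lambda>v. chart_density S vol c (?L v))" unfolding U_def
      by (rule continuous_on_compose2[OF chart_density_continuous[OF c] contL]) (auto simp: D_def)
    show "0 \<le> chart_density S vol d (?L y)" for y by (simp add: chart_density_def Let_def)
    show "?C ` snd c ` B \<subseteq> U" using B by (auto simp: U_def D_def)
    have "?C ` snd c ` B = UNIV \<inter> ?L -` (snd c ` B)"
      by (force simp: image_iff intro: LC(2)[symmetric])
    then show "?C ` snd c ` B \<in> sets borel"
      using continuous_on_borel_vimage[OF contL _ Bc(1), of UNIV] by simp
  qed (rule dens)
  moreover have "g ` (?C ` snd c ` B) = ?C ` snd d ` B"
    using A c B by (force simp: g_def image_iff)
  ultimately show ?thesis
    using nn_integral_model_lebesgue[OF pos chart_density_measurable[OF c Bc]]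
      nn_integral_model_lebesgue[OF pos chart_density_measurable[OF d Bd]] by simp
qed

definition chart_measure :: "('a, 'e) chart \<Rightarrow> 'a measure" where
  "chart_measure c = distr (density (restrict_space model_lebesgue (snd c ` fst c))
     (\<lambda>x. ennreal (chart_density S vol c x))) Borel (chart_inv c)"

lemma emeasure_chart_measure:
  assumes c: "c \<in> Atlas S" and B: "B \<in> sets Borel" "B \<subseteq> fst c"
  shows "emeasure (chart_measure c) B =
    (\<integral>\<^sup>+x. ennreal (chart_density S vol c x) * indicator (snd c ` B) x \<partial>model_lebesgue)"
proof -
  have sets_ml: "sets (model_lebesgue :: 'e measure) = sets borel" "space (model_lebesgue :: 'e measure) = UNIV"
    by (simp_all add: model_lebesgue_def)
  have sr: "sets (restrict_space model_lebesgue X) = sets (restrict_space borel X)" for X :: "'e set"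
    by (simp add: sets_restrict_space sets_ml)
  let ?R = "restrict_space model_lebesgue (snd c ` fst c)"
  have m: "chart_inv c \<in> measurable (density ?R f) Borel" for f
    using chart_inv_measurable[OF c] by (subst measurable_cong_sets[OF _ refl]) (simp_all add: sr)
  have md: "(\<lambda>x. ennreal (chart_density S vol c x)) \<in> borel_measurable ?R"
    using borel_measurable_continuous_on_restrict[OF chart_density_continuous[OF c]]
    by (subst measurable_cong_sets[OF sr refl]) measurable
  have img: "snd c ` B \<in> sets borel" "snd c ` B \<subseteq> snd c ` fst c"
    using chart_image_borel[OF c B] B by auto
  have o: "snd c ` fst c \<in> sets borel" using open_image[OF c] by simp
  have "emeasure (chart_measure c) B = emeasure (density ?R (\<lambda>x. ennreal (chart_density S vol c x))) (snd c ` B)"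
    unfolding chart_measure_def
    by (subst emeasure_distr[OF m B(1)])
       (simp add: space_restrict_space sets_ml chart_image_preimage[OF c B(2), symmetric])
  also have "\<dots> = (\<integral>\<^sup>+x. ennreal (chart_density S vol c x) * indicator (snd c ` B) x \<partial>?R)"
    by (rule emeasure_density[OF md]) (use img o in \<open>simp add: sr sets_restrict_space_iff\<close>)
  also have "\<dots> = (\<integral>\<^sup>+x. ennreal (chart_density S vol c x) * indicator (snd c ` B) x * indicator (snd c ` fst c) x \<partial>model_lebesgue)"
    by (rule nn_integral_restrict_space) (simp add: sets_ml o)
  also have "\<dots> = (\<integral>\<^sup>+x. ennreal (chart_density S vol c x) * indicator (snd c ` B) x \<partial>model_lebesgue)"
    using img(2) by (intro nn_integral_cong) (auto simp: indicator_def)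
  finally show ?thesis .
qed

lemma sets_chart_measure [simp]: "sets (chart_measure c) = sets Borel"
  by (simp add: chart_measure_def)

text \<open>The Lindelof property gives countably many charts, and subtracting the earlier domains
  makes the pieces disjoint. \<open>c i\<close> is required to be a chart only where
  \<open>E i\<close> is nonempty, because the atlas of an empty manifold may be empty.\<close>

lemma countable_chart_partition:
  obtains E :: "nat \<Rightarrow> 'a set" and c :: "nat \<Rightarrow> ('a, 'e) chart"
  where "\<And>i. E i \<in> sets Borel" "\<And>i. E i \<noteq> {} \<Longrightarrow> c i \<in> Atlas S" "\<And>i. E i \<subseteq> fst (c i)"
    "disjoint_family E" "(\<Union>i. E i) = points S"
proof -
  have U: "(\<Union>c\<in>Atlas S. fst c) = points S" using atlas by (simp add: smooth_atlas_def)
  have "Lindelof_space (Topo S)"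
    using manifold by (intro second_countable_imp_Lindelof_space) (simp add: smooth_manifold_def)
  then have "\<exists>\<V>. countable \<V> \<and> \<V> \<subseteq> fst ` Atlas S \<and> topspace (Topo S) \<subseteq> \<Union>\<V>"
    unfolding Lindelof_space_alt using U chart_openin[OF atlas] by (auto simp: points_def)
  then obtain \<V> where V: "countable \<V>" "\<V> \<subseteq> fst ` Atlas S" "points S \<subseteq> \<Union>\<V>" by (auto simp: points_def)
  show thesis
  proof (cases "\<V> = {}")
    case True
    then have "points S = {}" using V by simp
    then show thesis by (intro that[of "\<lambda>_. {}"]) (auto simp: disjoint_family_on_def)
  next
    case False
    define D where "D = from_nat_into \<V>"
    have D: "range D = \<V>" using False V(1) by (simp add: D_def range_from_nat_into)
    then have "\<forall>i. \<exists>c. c \<in> Atlas S \<and> fst c = D i" using V(2) by (metis (no_types, lifting) imageE rangeI subsetD)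
    then obtain c where c: "\<And>i. c i \<in> Atlas S" "\<And>i. fst (c i) = D i" by metis
    have Do: "D i \<in> sets Borel" for i using open_Borel[OF chart_openin[OF atlas c(1)]] c(2) by metis
    show thesis
    proof (rule that[of "disjointed D" c])
      show "disjointed D i \<in> sets Borel" for i
        using sets.range_disjointed_sets[of D Borel] Do by auto
      show "disjointed D i \<subseteq> fst (c i)" for i using disjointed_subset[of D i] c by simp
      have "\<Union>\<V> \<subseteq> points S" using V(2) U by blast
      then show "(\<Union>i. disjointed D i) = points S" using D V(3) by (simp add: UN_disjointed_eq)
    qed (use c disjoint_family_disjointed in auto)
  qed
qed

definition is_volume_measure :: "'a measure \<Rightarrow> bool" where
  "is_volume_measure \<nu> \<longleftrightarrow> space \<nu> = points S \<and> sets \<nu> = sigma_sets (points S) {U. openin (Topo S) U} \<and>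
     (\<forall>c\<in>Atlas S. \<forall>B\<in>sets \<nu>. B \<subseteq> fst c \<longrightarrow>
        emeasure \<nu> B = (\<integral>\<^sup>+x\<in>snd c ` B. ennreal (chart_density S vol c x) \<partial>model_lebesgue))"

text \<open>Existence: on each piece of a countable partition take the measure of its chart, and
  sum; that another chart gives the same value is \<open>chart_integral_agree\<close>. Uniqueness: a
  set splits over the partition, and the value on every part is prescribed by a chart.\<close>

lemma volume_measure_exists: "\<exists>!\<nu>. is_volume_measure \<nu>"
proof -
  obtain E :: "nat \<Rightarrow> 'a set" and c :: "nat \<Rightarrow> ('a, 'e) chart"
    where E: "\<And>i. E i \<in> sets Borel" "\<And>i. E i \<noteq> {} \<Longrightarrow> c i \<in> Atlas S" "\<And>i. E i \<subseteq> fst (c i)"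
      "disjoint_family E" "(\<Union>i. E i) = points S"
    using countable_chart_partition by blast
  define m where "m B = (\<Sum>i. emeasure (chart_measure (c i)) (B \<inter> E i))" for B
  have split: "emeasure N B = (\<Sum>i. emeasure N (B \<inter> E i))" if "sets N = sets Borel" "B \<in> sets Borel" for N B
  proof -
    have "B \<subseteq> points S" using that(2) sets.sets_into_space by fastforce
    then have "B = (\<Union>i. B \<inter> E i)" using E(5) by blast
    moreover have "(\<Sum>i. emeasure N (B \<inter> E i)) = emeasure N (\<Union>i. B \<inter> E i)"
      using that E(1) by (intro suminf_emeasure disjoint_family_subset[OF E(4)]) auto
    ultimately show ?thesis by simp
  qed
  define \<nu> where "\<nu> = measure_of (points S) (sets Borel) m"
  have s\<nu>: "sets \<nu> = sets Borel" "space \<nu> = points S"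
    using sets.space_closed[of Borel] sets.sigma_sets_eq[of Borel] by (simp_all add: \<nu>_def space_measure_of_conv)
  have em: "emeasure \<nu> B = m B" if "B \<in> sets Borel" for B
  proof (rule emeasure_measure_of[OF \<nu>_def])
    show "sets Borel \<subseteq> Pow (points S)" using sets.space_closed[of Borel] by simp
    show "positive (sets \<nu>) m" by (simp add: positive_def m_def)
    show "countably_additive (sets \<nu>) m"
      unfolding countably_additive_def s\<nu>
    proof (intro allI impI)
      fix A :: "nat \<Rightarrow> 'a set" assume A: "range A \<subseteq> sets Borel" "disjoint_family A"
      \<comment> \<open>Writing the outer sum as an integral over the counting measure allows the
        two sums to be interchanged.\<close>
      have "(\<Sum>j. m (A j)) = (\<integral>\<^sup>+j. (\<Sum>i. emeasure (chart_measure (c i)) (A j \<inter> E i)) \<partial>count_space UNIV)"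
        by (simp add: nn_integral_count_space_nat m_def)
      also have "\<dots> = (\<Sum>i. \<integral>\<^sup>+j. emeasure (chart_measure (c i)) (A j \<inter> E i) \<partial>count_space UNIV)"
        by (rule nn_integral_suminf) simp
      also have "\<dots> = (\<Sum>i. \<Sum>j. emeasure (chart_measure (c i)) (A j \<inter> E i))"
        by (simp add: nn_integral_count_space_nat)
      also have "\<dots> = (\<Sum>i. emeasure (chart_measure (c i)) (\<Union>j. A j \<inter> E i))"
        using A E(1) by (intro suminf_cong suminf_emeasure disjoint_family_subset[OF A(2)]) auto
      also have "\<dots> = m (\<Union>j. A j)" by (simp add: m_def)
      finally show "(\<Sum>j. m (A j)) = m (\<Union>j. A j)" .
    qed
    show "B \<in> sets \<nu>" using that s\<nu> by simp
  qed
  have "is_volume_measure \<nu>"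
    unfolding is_volume_measure_def s\<nu>
  proof (intro conjI ballI impI)
    show "sets Borel = sigma_sets (points S) {U. openin (Topo S) U}" by (rule sets_Borel)
    fix d B assume d: "d \<in> Atlas S" and B: "B \<in> sets Borel" "B \<subseteq> fst d"
    have "emeasure (chart_measure (c i)) (B \<inter> E i) = emeasure (chart_measure d) (B \<inter> E i)" for i
    proof (cases "E i = {}")
      case False
      note ci = E(2)[OF False]
      have BE: "B \<inter> E i \<in> sets Borel" "B \<inter> E i \<subseteq> fst (c i)" "B \<inter> E i \<subseteq> fst d"
        using B E(1,3) by auto
      show ?thesis
        using chart_integral_agree[OF ci d BE] emeasure_chart_measure[OF ci BE(1,2)] emeasure_chart_measure[OF d BE(1,3)]
        by simp
    qed simp
    then have "emeasure \<nu> B = emeasure (chart_measure d) B"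
      using em[OF B(1)] split[of "chart_measure d" B] B(1) by (simp add: m_def)
    then show "emeasure \<nu> B = (\<integral>\<^sup>+x\<in>snd d ` B. ennreal (chart_density S vol d x) \<partial>model_lebesgue)"
      using emeasure_chart_measure[OF d B] by simp
  qed simp
  moreover have "\<nu>' = \<nu>''" if v: "is_volume_measure \<nu>'" "is_volume_measure \<nu>''" for \<nu>' \<nu>''
  proof (rule measure_eqI)
    show "sets \<nu>' = sets \<nu>''" using v by (simp add: is_volume_measure_def)
    fix B assume "B \<in> sets \<nu>'"
    then have B: "B \<in> sets Borel" using v by (simp add: is_volume_measure_def sets_Borel)
    have "emeasure \<nu>' (B \<inter> E i) = emeasure \<nu>'' (B \<inter> E i)" for i
    proof (cases "E i = {}")
      case False
      have "B \<inter> E i \<in> sets Borel" "B \<inter> E i \<subseteq> fst (c i)" using B E(1,3) by auto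
      then show ?thesis using v E(2)[OF False] unfolding is_volume_measure_def sets_Borel by simp
    qed simp
    then show "emeasure \<nu>' B = emeasure \<nu>'' B"
      using split[of \<nu>' B] split[of \<nu>'' B] B v by (simp add: is_volume_measure_def sets_Borel)
  qed
  ultimately show ?thesis by blast
qed

end

text \<open>The description defining \<open>volume_measure\<close> has a unique solution, so its
  space is known. Integrands then need to be compared only at points of the base, each of which is
  the projection of a point of the bundle.\<close>

lemma space_volume_measure:
  assumes "smooth_manifold S" "volume_form S vol"
  shows "space (volume_measure S vol) = points S"
proof -
  interpret volume_manifold S vol by unfold_locales fact+
  have "is_volume_measure (volume_measure S vol)"
    using theI'[OF volume_measure_exists] by (simp add: volume_measure_def is_volume_measure_def)
  then show ?thesis by (simp add: is_volume_measure_def)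
qed

section \<open>Principal bundles, their tangent maps, and adjoint and coadjoint classes\<close>

section \<open>Principal bundles\<close>

locale principal =
  fixes G :: "('g, 'o::fin_dim) lie_group"
    and P :: "('p, 'ep::fin_dim, 'm, 'em::fin_dim, 'g) fibre_bundle"
  assumes is_principal: "principal_bundle G P"
begin

abbreviation "TP \<equiv> total_space P"
abbreviation "BP \<equiv> base_space P"
abbreviation "GM \<equiv> group_mfd G"

lemma manifolds: "smooth_manifold TP" "smooth_manifold BP" "smooth_manifold GM"
  and group: "group G" and carrier: "carrier G = points GM"
  using is_principal by (auto simp: principal_bundle_def lie_group_def)

lemma atlases: "smooth_atlas TP" "smooth_atlas BP" "smooth_atlas GM"
  using manifolds by (simp_all add: smooth_manifold_atlas)

interpretation Gr: group G by (rule group)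

lemma action: "smooth_two_var TP GM TP (\<lambda>(p, g). act P g p)"
  using is_principal atlases by unfold_locales (simp_all add: principal_bundle_def)

lemma multiplication: "smooth_two_var GM GM GM (\<lambda>(g, h). g \<otimes>\<^bsub>G\<^esub> h)"
  using is_principal atlases by unfold_locales (simp_all add: principal_bundle_def lie_group_def)

lemma inverse_smooth: "smooth_map_on GM (points GM) GM (\<lambda>g. inv\<^bsub>G\<^esub> g)"
  using is_principal atlases by (intro smooth_map_imp_on) (simp_all add: principal_bundle_def lie_group_def)

lemma proj_smooth: "smooth_map_on TP (points TP) BP (proj P)"
  using is_principal atlases by (intro smooth_map_imp_on) (simp_all add: principal_bundle_def)

lemma proj_points: "p \<in> points TP \<Longrightarrow> proj P p \<in> points BP"
  by (rule smooth_map_on_points[OF proj_smooth])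

lemma act_smooth: "g \<in> carrier G \<Longrightarrow> smooth_map_on TP (points TP) TP (act P g)"
  using smooth_two_var.smooth_F1[OF action, of g] by (simp add: carrier)

lemma orbit_smooth: "p \<in> points TP \<Longrightarrow> smooth_map_on GM (points GM) TP (\<lambda>g. act P g p)"
  using smooth_two_var.smooth_F2[OF action, of p] by simp

lemma act_points: "g \<in> carrier G \<Longrightarrow> p \<in> points TP \<Longrightarrow> act P g p \<in> points TP"
  by (rule smooth_map_on_points[OF act_smooth])

lemma act_one: "p \<in> points TP \<Longrightarrow> act P \<one>\<^bsub>G\<^esub> p = p"
  and proj_act: "p \<in> points TP \<Longrightarrow> g \<in> carrier G \<Longrightarrow> proj P (act P g p) = proj P p"
  and act_mult: "p \<in> points TP \<Longrightarrow> g \<in> carrier G \<Longrightarrow> h \<in> carrier G \<Longrightarrow>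
        act P (g \<otimes>\<^bsub>G\<^esub> h) p = act P h (act P g p)"
  using is_principal by (auto simp: principal_bundle_def)

lemma one_points [simp]: "\<one>\<^bsub>G\<^esub> \<in> points GM"
  using Gr.one_closed by (simp add: carrier)

definition fibres_over :: "'m set \<Rightarrow> 'p set" where
  "fibres_over V = {p \<in> points TP. proj P p \<in> V}"

lemma fibres_over_openin: "openin (Topo BP) V \<Longrightarrow> openin (Topo TP) (fibres_over V)"
  using smooth_map_on_preimage[OF atlases(1,2) proj_smooth]
  by (simp add: fibres_over_def Int_def vimage_def)

text \<open>Injectivity of the trivialization gives the fourth claim; the section of the fifth is
  the preimage of the pairs whose group component is the unit.\<close>

lemma local_trivializationD:
  assumes "local_trivialization G P V \<tau>"
  shows "openin (Topo BP) V" "smooth_map_on TP (fibres_over V) GM \<tau>"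
    "\<And>p g. p \<in> fibres_over V \<Longrightarrow> g \<in> carrier G \<Longrightarrow> \<tau> (act P g p) = \<tau> p \<otimes>\<^bsub>G\<^esub> g"
    "\<And>p q. p \<in> fibres_over V \<Longrightarrow> q \<in> fibres_over V \<Longrightarrow> proj P p = proj P q \<Longrightarrow> \<tau> p = \<tau> q \<Longrightarrow> p = q"
    "\<exists>s. smooth_map_on BP V TP s \<and> (\<forall>y\<in>V. proj P (s y) = y)"
proof -
  let ?X = "fibres_over V" and ?f = "\<lambda>p. (proj P p, \<tau> p)"
  have V: "openin (Topo BP) V"
    and diff: "diffeo (open_submfd TP ?X) (prod_mfd (open_submfd BP V) GM) ?f"
    and eq: "\<And>p g. p \<in> ?X \<Longrightarrow> g \<in> carrier G \<Longrightarrow> \<tau> (act P g p) = \<tau> p \<otimes>\<^bsub>G\<^esub> g"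
    using assms by (auto simp: local_trivialization_def fibres_over_def)
  note X = fibres_over_openin[OF V]
  have Vs: "V \<subseteq> points BP" using openin_subset[OF V] by (simp add: points_def)
  have Xs: "?X \<subseteq> points TP" by (auto simp: fibres_over_def)
  have pX: "points (open_submfd TP ?X) = ?X" using Xs by (auto simp: points_open_submfd)
  have pV: "points (prod_mfd (open_submfd BP V) GM) = V \<times> carrier G"
    using Vs by (auto simp: points_prod_mfd points_open_submfd carrier)
  note aX = smooth_atlas_open_submfd[OF atlases(1) X] and aV = smooth_atlas_open_submfd[OF atlases(2) V]
  note aVG = smooth_atlas_prod[OF aV atlases(3)]
  define \<Psi> where "\<Psi> = inv_into ?X ?f"
  have bij: "bij_betw ?f ?X (V \<times> carrier G)"
    and sf: "smooth_map (open_submfd TP ?X) (prod_mfd (open_submfd BP V) GM) ?f"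
    and s\<Psi>: "smooth_map (prod_mfd (open_submfd BP V) GM) (open_submfd TP ?X) \<Psi>"
    using diff unfolding diffeo_def pX pV \<Psi>_def by auto
  show "openin (Topo BP) V" by (rule V)
  show "smooth_map_on TP ?X GM \<tau>"
    using smooth_map_on_prod_snd[OF aX aV atlases(3) smooth_map_imp_on[OF aX aVG sf]]
    unfolding pX by (rule smooth_map_on_from_open_submfd[OF atlases(1) X])
  show "\<tau> (act P g p) = \<tau> p \<otimes>\<^bsub>G\<^esub> g" if "p \<in> ?X" "g \<in> carrier G" for p g by (rule eq[OF that])
  show "p = q" if "p \<in> ?X" "q \<in> ?X" "proj P p = proj P q" "\<tau> p = \<tau> q" for p q
    using bij that by (auto simp: bij_betw_def dest!: inj_onD)
  let ?s = "\<lambda>y. \<Psi> (y, \<one>\<^bsub>G\<^esub>)"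
  have "?f (?s y) = (y, \<one>\<^bsub>G\<^esub>)" if "y \<in> V" for y
    unfolding \<Psi>_def by (rule f_inv_into_f) (use bij that in \<open>auto simp: bij_betw_def\<close>)
  moreover have "smooth_map_on BP V TP ?s"
  proof -
    have pt: "points (open_submfd BP V) = V" using Vs by (auto simp: points_open_submfd)
    have "smooth_map_on (open_submfd BP V) V (prod_mfd (open_submfd BP V) GM) (\<lambda>y. (y, \<one>\<^bsub>G\<^esub>))"
      by (intro smooth_map_on_Pair[OF aV] smooth_map_on_id[OF aV] smooth_map_on_const)
         (use pt in \<open>auto simp: openin_open_submfd[OF V] V\<close>)
    then have "smooth_map_on (open_submfd BP V) V (open_submfd TP ?X) ?s"
      by (rule smooth_map_on_compose'[OF aV aVG _ smooth_map_imp_on[OF aVG aX s\<Psi>]]) (use pV in auto)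
    then show ?thesis
      by (intro smooth_map_on_into_open_submfd[OF smooth_map_on_from_open_submfd[OF atlases(2) V]])
  qed
  ultimately show "\<exists>s. smooth_map_on BP V TP s \<and> (\<forall>y\<in>V. proj P (s y) = y)" by blast
qed

lemma trivialization_exists:
  assumes "x \<in> points BP"
  obtains V \<tau> where "x \<in> V" "local_trivialization G P V \<tau>"
  using assms is_principal unfolding principal_bundle_def by blast

text \<open>Equivariance moves the group component of p to that of q, and points of one fibre with
  equal group components coincide.\<close>

lemma trivialization_transition:
  assumes "local_trivialization G P V \<tau>" "p \<in> fibres_over V" "q \<in> fibres_over V" "proj P p = proj P q"
  shows "\<tau> p \<in> carrier G" and "act P (inv\<^bsub>G\<^esub> (\<tau> p) \<otimes>\<^bsub>G\<^esub> \<tau> q) p = q"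
proof -
  note t = local_trivializationD(2-4)[OF assms(1)]
  have c: "\<tau> p \<in> carrier G" "\<tau> q \<in> carrier G"
    using smooth_map_on_points[OF t(1)] assms(2,3) by (auto simp: carrier)
  then show "\<tau> p \<in> carrier G" by simp
  let ?g = "inv\<^bsub>G\<^esub> (\<tau> p) \<otimes>\<^bsub>G\<^esub> \<tau> q"
  have g: "?g \<in> carrier G" using c by simp
  have p: "p \<in> points TP" using assms(2) by (simp add: fibres_over_def)
  have "\<tau> p \<otimes>\<^bsub>G\<^esub> ?g = \<tau> q" using c by (simp add: Gr.m_assoc[symmetric])
  then show "act P ?g p = q"
    using t(2)[OF assms(2) g] p g assms(2,3,4) proj_act act_points
    by (intro t(3)) (auto simp: fibres_over_def)
qed

text \<open>Freeness and transitivity on fibres are not axioms of \<open>principal_bundle\<close>;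
  both come from a trivialization, in which the action is right multiplication in the group.\<close>

lemma act_free:
  assumes "p \<in> points TP" "g \<in> carrier G" "h \<in> carrier G" "act P g p = act P h p"
  shows "g = h"
proof -
  obtain V \<tau> where V: "proj P p \<in> V" "local_trivialization G P V \<tau>"
    using trivialization_exists[OF proj_points[OF assms(1)]] by blast
  have pV: "p \<in> fibres_over V" using assms(1) V(1) by (simp add: fibres_over_def)
  note local_trivializationD(3)[OF V(2)]
  then have "\<tau> p \<otimes>\<^bsub>G\<^esub> g = \<tau> p \<otimes>\<^bsub>G\<^esub> h" using assms pV by metis
  then show ?thesis using trivialization_transition(1)[OF V(2) pV pV] assms by simp
qed

lemma fibre_transitive:
  assumes "p \<in> points TP" "q \<in> points TP" "proj P p = proj P q"
  obtains g where "g \<in> carrier G" "q = act P g p"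
proof -
  obtain V \<tau> where V: "proj P p \<in> V" "local_trivialization G P V \<tau>"
    using trivialization_exists[OF proj_points[OF assms(1)]] by blast
  have pV: "p \<in> fibres_over V" "q \<in> fibres_over V" using assms V(1) by (simp_all add: fibres_over_def)
  from trivialization_transition[OF V(2) pV assms(3)] trivialization_transition(1)[OF V(2) pV(2,2) refl]
  show thesis by (intro that[of "inv\<^bsub>G\<^esub> (\<tau> p) \<otimes>\<^bsub>G\<^esub> \<tau> q"]) auto
qed

lemma section_at:
  assumes x: "x \<in> points BP"
  obtains V f where "openin (Topo BP) V" "x \<in> V" "smooth_map_on BP V TP f" "\<And>y. y \<in> V \<Longrightarrow> proj P (f y) = y"
proof -
  obtain V \<tau> where V: "x \<in> V" "local_trivialization G P V \<tau>" using trivialization_exists[OF x] by blast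
  with local_trivializationD(1,5)[OF V(2)] that show thesis by blast
qed

lemma proj_surj:
  assumes "x \<in> points BP"
  obtains p where "p \<in> points TP" "proj P p = x"
proof -
  obtain V f where f: "x \<in> V" "smooth_map_on BP V TP f" "\<And>y. y \<in> V \<Longrightarrow> proj P (f y) = y"
    using section_at[OF assms] by metis
  show thesis by (rule that[OF smooth_map_on_points[OF f(2,1)] f(3)[OF f(1)]])
qed

text \<open>Acting by a constant group element moves a local section so that it passes through
  p.\<close>

lemma section_through:
  assumes p: "p \<in> points TP"
  obtains V f where "openin (Topo BP) V" "proj P p \<in> V" "smooth_map_on BP V TP f"
    "\<And>y. y \<in> V \<Longrightarrow> proj P (f y) = y" "f (proj P p) = p"
proof -
  obtain V f where f: "openin (Topo BP) V" "proj P p \<in> V" "smooth_map_on BP V TP f"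
    "\<And>y. y \<in> V \<Longrightarrow> proj P (f y) = y" using section_at[OF proj_points[OF p]] by metis
  note fp = smooth_map_on_points[OF f(3)]
  obtain g where g: "g \<in> carrier G" "p = act P g (f (proj P p))"
    using fibre_transitive[OF fp[OF f(2)] p] f(4)[OF f(2)] by blast
  show thesis
  proof (rule that[OF f(1,2)])
    show "smooth_map_on BP V TP (\<lambda>y. act P g (f y))"
      by (rule smooth_map_on_compose'[OF atlases(2,1) f(3) act_smooth[OF g(1)]]) (use fp in auto)
    show "proj P (act P g (f y)) = y" if "y \<in> V" for y
      using proj_act[OF fp[OF that] g(1)] f(4)[OF that] by simp
  qed (use g in simp)
qed

text \<open>A local section identifies the bundle with a product; \<open>\<kappa>\<close> is the group component.\<close>

lemma section_group_component:
  assumes V: "openin (Topo BP) V" "x \<in> V" and f: "smooth_map_on BP V TP f" "\<And>y. y \<in> V \<Longrightarrow> proj P (f y) = y"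
  obtains W \<kappa> where "openin (Topo BP) W" "x \<in> W" "W \<subseteq> V" "smooth_map_on TP (fibres_over W) GM \<kappa>"
    "\<And>p. p \<in> fibres_over W \<Longrightarrow> act P (\<kappa> p) (f (proj P p)) = p"
    "\<And>y. y \<in> W \<Longrightarrow> \<kappa> (f y) = \<one>\<^bsub>G\<^esub>"
proof -
  have x: "x \<in> points BP" using V openin_subset[OF V(1)] by (auto simp: points_def)
  obtain V' \<tau> where V': "x \<in> V'" "local_trivialization G P V' \<tau>" using trivialization_exists[OF x] by blast
  note t = local_trivializationD(1,2)[OF V'(2)]
  let ?W = "V \<inter> V'"
  define \<kappa> where "\<kappa> p = inv\<^bsub>G\<^esub> (\<tau> (f (proj P p))) \<otimes>\<^bsub>G\<^esub> \<tau> p" for p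
  have W: "openin (Topo BP) ?W" using V t by auto
  have fW: "f y \<in> fibres_over V'" if "y \<in> ?W" for y
    using that f(2) smooth_map_on_points[OF f(1)] by (auto simp: fibres_over_def)
  have sub: "fibres_over ?W \<subseteq> fibres_over V'" by (auto simp: fibres_over_def)
  note oW = fibres_over_openin[OF W]
  have pr: "smooth_map_on TP (fibres_over ?W) BP (proj P)"
    by (rule smooth_map_on_subset[OF proj_smooth oW]) (auto simp: fibres_over_def)
  have fpr: "smooth_map_on TP (fibres_over ?W) TP (\<lambda>p. f (proj P p))"
    by (rule smooth_map_on_compose'[OF atlases(1,2) pr f(1)]) (auto simp: fibres_over_def)
  have \<tau>f: "smooth_map_on TP (fibres_over ?W) GM (\<lambda>p. \<tau> (f (proj P p)))"
    by (rule smooth_map_on_compose'[OF atlases(1,1) fpr t(2)]) (use fW in \<open>auto simp: fibres_over_def\<close>)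
  have inv: "smooth_map_on TP (fibres_over ?W) GM (\<lambda>p. inv\<^bsub>G\<^esub> (\<tau> (f (proj P p))))"
    by (rule smooth_map_on_compose'[OF atlases(1,3) \<tau>f inverse_smooth])
       (use smooth_map_on_points[OF \<tau>f] in auto)
  show thesis
  proof (rule that[OF W])
    show "smooth_map_on TP (fibres_over ?W) GM \<kappa>"
      using smooth_two_var.smooth_F[OF multiplication atlases(1) inv smooth_map_on_subset[OF t(2) oW sub]]
      by (simp add: \<kappa>_def[abs_def])
    show "act P (\<kappa> p) (f (proj P p)) = p" if p: "p \<in> fibres_over ?W" for p
      unfolding \<kappa>_def
      by (rule trivialization_transition(2)[OF V'(2)]) (use p sub fW f(2) in \<open>auto simp: fibres_over_def\<close>)
    show "\<kappa> (f y) = \<one>\<^bsub>G\<^esub>" if "y \<in> ?W" for y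
      using trivialization_transition(1)[OF V'(2) fW[OF that] fW[OF that] refl] f(2) that by (simp add: \<kappa>_def)
  qed (use V V' in auto)
qed

section \<open>Tangent maps of the action and of the projection\<close>

lemma T_act_linear: "p \<in> points TP \<Longrightarrow> g \<in> carrier G \<Longrightarrow> linear (T_act P g p)"
  unfolding T_act_def by (rule tangent_map_linear[OF atlases(1,1) act_smooth])

lemma T_proj_linear: "p \<in> points TP \<Longrightarrow> linear (T_proj P p)"
  unfolding T_proj_def by (rule tangent_map_linear[OF atlases(1,2) proj_smooth])

lemma generator_linear: "p \<in> points TP \<Longrightarrow> linear (\<lambda>\<xi>. generator G P \<xi> p)"
  unfolding generator_def
  using tangent_map_linear[OF atlases(3,1) orbit_smooth one_points] by simp

lemma T_proj_act:
  assumes "p \<in> points TP" "g \<in> carrier G"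
  shows "T_proj P (act P g p) (T_act P g p v) = T_proj P p v"
proof -
  have "tangent_map TP BP (\<lambda>x. proj P (act P g x)) p v = T_proj P (act P g p) (T_act P g p v)"
    unfolding T_proj_def T_act_def
    by (rule tangent_map_compose[OF atlases(1,1,2) act_smooth proj_smooth]) (use assms act_points in auto)
  moreover have "tangent_map TP BP (\<lambda>x. proj P (act P g x)) p = T_proj P p"
    unfolding T_proj_def
    by (rule tangent_map_cong[OF atlases(1) points_openin assms(1)]) (use assms proj_act in auto)
  ultimately show ?thesis by simp
qed

lemma T_proj_generator:
  assumes "p \<in> points TP"
  shows "T_proj P p (generator G P \<xi> p) = 0"
proof -
  have "tangent_map GM BP (\<lambda>g. proj P (act P g p)) \<one>\<^bsub>G\<^esub> \<xi> = T_proj P (act P \<one>\<^bsub>G\<^esub> p) (generator G P \<xi> p)"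
    unfolding T_proj_def generator_def
    by (rule tangent_map_compose[OF atlases(3,1,2) orbit_smooth proj_smooth]) (use assms act_one in auto)
  moreover have "tangent_map GM BP (\<lambda>g. proj P (act P g p)) \<one>\<^bsub>G\<^esub> = tangent_map GM BP (\<lambda>g. proj P p) \<one>\<^bsub>G\<^esub>"
    by (rule tangent_map_cong[OF atlases(3) points_openin]) (use assms proj_act in \<open>auto simp: carrier\<close>)
  ultimately show ?thesis using assms by (simp add: tangent_map_const act_one)
qed

lemma conj_smooth:
  assumes g: "g \<in> carrier G"
  shows "smooth_map_on GM (points GM) GM (\<lambda>h. g \<otimes>\<^bsub>G\<^esub> h \<otimes>\<^bsub>G\<^esub> inv\<^bsub>G\<^esub> g)"
proof -
  have "smooth_map_on GM (points GM) GM (\<lambda>h. g \<otimes>\<^bsub>G\<^esub> h)"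
    using smooth_two_var.smooth_F2[OF multiplication, of g] g by (simp add: carrier)
  from smooth_two_var.smooth_F[OF multiplication atlases(3) this smooth_map_on_const[OF points_openin, of "inv\<^bsub>G\<^esub> g"]]
  show ?thesis using Gr.inv_closed[OF g] by (simp add: carrier)
qed

lemma Ad_linear: "g \<in> carrier G \<Longrightarrow> linear (Ad G g)"
  unfolding Ad_def by (rule tangent_map_linear[OF atlases(3,3) conj_smooth one_points])

lemma Ad_one: "Ad G \<one>\<^bsub>G\<^esub> \<xi> = \<xi>"
proof -
  have "tangent_map GM GM (\<lambda>h. \<one>\<^bsub>G\<^esub> \<otimes>\<^bsub>G\<^esub> h \<otimes>\<^bsub>G\<^esub> inv\<^bsub>G\<^esub> \<one>\<^bsub>G\<^esub>) \<one>\<^bsub>G\<^esub> = tangent_map GM GM (\<lambda>h. h) \<one>\<^bsub>G\<^esub>"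
    by (rule tangent_map_cong[OF atlases(3) points_openin one_points]) (simp add: carrier[symmetric])
  then show ?thesis unfolding Ad_def using tangent_map_id[OF atlases(3) one_points] by simp
qed

lemma Ad_mult:
  assumes g: "g \<in> carrier G" and h: "h \<in> carrier G"
  shows "Ad G (g \<otimes>\<^bsub>G\<^esub> h) \<xi> = Ad G g (Ad G h \<xi>)"
proof -
  let ?c = "\<lambda>g h. g \<otimes>\<^bsub>G\<^esub> h \<otimes>\<^bsub>G\<^esub> inv\<^bsub>G\<^esub> g"
  have "tangent_map GM GM (?c (g \<otimes>\<^bsub>G\<^esub> h)) \<one>\<^bsub>G\<^esub> \<xi> = tangent_map GM GM (\<lambda>x. ?c g (?c h x)) \<one>\<^bsub>G\<^esub> \<xi>"
    by (rule fun_cong[OF tangent_map_cong[OF atlases(3) points_openin one_points]])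
       (use g h in \<open>auto simp: carrier[symmetric] Gr.inv_mult_group Gr.m_assoc\<close>)
  also have "\<dots> = tangent_map GM GM (?c g) (?c h \<one>\<^bsub>G\<^esub>) (tangent_map GM GM (?c h) \<one>\<^bsub>G\<^esub> \<xi>)"
    by (rule tangent_map_compose[OF atlases(3,3,3) conj_smooth[OF h] conj_smooth[OF g]])
       (use h in \<open>auto simp: carrier[symmetric]\<close>)
  finally show ?thesis using h by (simp add: Ad_def)
qed

lemma Ad_inv: "g \<in> carrier G \<Longrightarrow> Ad G g (Ad G (inv\<^bsub>G\<^esub> g) \<xi>) = \<xi>"
  using Ad_mult[of g "inv\<^bsub>G\<^esub> g" \<xi>] by (simp add: Ad_one)

text \<open>Acting by g and then by h is the same as acting by \<open>g h g^-1\<close> and then by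
  g. The claim is the derivative of this identity at the unit.\<close>

lemma generator_act:
  assumes p: "p \<in> points TP" and g: "g \<in> carrier G"
  shows "generator G P \<xi> (act P g p) = T_act P g p (generator G P (Ad G g \<xi>) p)"
proof -
  let ?c = "\<lambda>h. g \<otimes>\<^bsub>G\<^esub> h \<otimes>\<^bsub>G\<^esub> inv\<^bsub>G\<^esub> g"
  have o: "smooth_map_on GM (points GM) TP (\<lambda>h. act P (?c h) p)"
    by (rule smooth_map_on_compose'[OF atlases(3,3) conj_smooth[OF g] orbit_smooth[OF p]])
       (use smooth_map_on_points[OF conj_smooth[OF g]] in auto)
  have "tangent_map GM TP (\<lambda>h. act P h (act P g p)) \<one>\<^bsub>G\<^esub> \<xi> = tangent_map GM TP (\<lambda>h. act P g (act P (?c h) p)) \<one>\<^bsub>G\<^esub> \<xi>"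
  proof (rule fun_cong[OF tangent_map_cong[OF atlases(3) points_openin one_points]])
    fix h assume "h \<in> points GM"
    then have h: "h \<in> carrier G" by (simp add: carrier)
    have "?c h \<otimes>\<^bsub>G\<^esub> g = g \<otimes>\<^bsub>G\<^esub> h" using g h by (simp add: Gr.m_assoc)
    then show "act P h (act P g p) = act P g (act P (?c h) p)"
      using act_mult[OF p, of "?c h" g] act_mult[OF p g h] g h by simp
  qed
  also have "\<dots> = tangent_map TP TP (act P g) (act P (?c \<one>\<^bsub>G\<^esub>) p) (tangent_map GM TP (\<lambda>h. act P (?c h) p) \<one>\<^bsub>G\<^esub> \<xi>)"
    by (rule tangent_map_compose[OF atlases(3,1,1) o act_smooth[OF g]])
       (use g p act_one in \<open>auto simp: carrier[symmetric]\<close>)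
  also have "tangent_map GM TP (\<lambda>h. act P (?c h) p) \<one>\<^bsub>G\<^esub> \<xi> =
      tangent_map GM TP (\<lambda>h. act P h p) (?c \<one>\<^bsub>G\<^esub>) (tangent_map GM GM ?c \<one>\<^bsub>G\<^esub> \<xi>)"
    by (rule tangent_map_compose[OF atlases(3,3,1) conj_smooth[OF g] orbit_smooth[OF p]])
       (use g in \<open>auto simp: carrier[symmetric]\<close>)
  finally show ?thesis using g p by (simp add: generator_def T_act_def Ad_def act_one)
qed

lemma T_proj_section:
  assumes V: "openin (Topo BP) V" "y \<in> V" and f: "smooth_map_on BP V TP f" "\<And>y. y \<in> V \<Longrightarrow> proj P (f y) = y"
  shows "T_proj P (f y) (tangent_map BP TP f y v) = v"
proof -
  have y: "y \<in> points BP" using V openin_subset[OF V(1)] by (auto simp: points_def)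
  have "tangent_map BP BP (\<lambda>y. proj P (f y)) y v = T_proj P (f y) (tangent_map BP TP f y v)"
    unfolding T_proj_def
    by (rule tangent_map_compose[OF atlases(2,1,2) f(1) proj_smooth V(2) smooth_map_on_points[OF f(1) V(2)]])
  moreover have "tangent_map BP BP (\<lambda>y. proj P (f y)) y = tangent_map BP BP (\<lambda>y. y) y"
    by (rule tangent_map_cong[OF atlases(2) V]) (rule f(2))
  ultimately show ?thesis using tangent_map_id[OF atlases(2) y] by simp
qed

text \<open>Differentiating \<open>p = \<kappa>(p) \<cdot> f(\<pi>(p))\<close> exhibits every vertical vector as a generator.\<close>

lemma T_proj_kernel:
  assumes p: "p \<in> points TP" and w: "T_proj P p w = 0"
  obtains \<xi> where "w = generator G P \<xi> p"
proof -
  obtain V f where f: "openin (Topo BP) V" "proj P p \<in> V" "smooth_map_on BP V TP f"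
    "\<And>y. y \<in> V \<Longrightarrow> proj P (f y) = y" "f (proj P p) = p" using section_through[OF p] by metis
  obtain W \<kappa> where W: "openin (Topo BP) W" "proj P p \<in> W" "W \<subseteq> V" "smooth_map_on TP (fibres_over W) GM \<kappa>"
    "\<And>p. p \<in> fibres_over W \<Longrightarrow> act P (\<kappa> p) (f (proj P p)) = p" "\<And>y. y \<in> W \<Longrightarrow> \<kappa> (f y) = \<one>\<^bsub>G\<^esub>"
    using section_group_component[OF f(1,2,3,4)] by metis
  have pW: "p \<in> fibres_over W" using p W by (simp add: fibres_over_def)
  note oW = fibres_over_openin[OF W(1)]
  have pr: "smooth_map_on TP (fibres_over W) BP (proj P)"
    by (rule smooth_map_on_subset[OF proj_smooth oW]) (auto simp: fibres_over_def)
  have fpr: "smooth_map_on TP (fibres_over W) TP (\<lambda>p. f (proj P p))"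
    by (rule smooth_map_on_compose'[OF atlases(1,2) pr f(3)]) (use W(3) in \<open>auto simp: fibres_over_def\<close>)
  have \<kappa>p: "\<kappa> p = \<one>\<^bsub>G\<^esub>" using W(6)[OF W(2)] f(5) by simp
  have "tangent_map TP TP (\<lambda>x. f (proj P x)) p w = tangent_map BP TP f (proj P p) (tangent_map TP BP (proj P) p w)"
    by (rule tangent_map_compose[OF atlases(1,2,1) proj_smooth f(3) p f(2)])
  then have 0: "tangent_map TP TP (\<lambda>x. f (proj P x)) p w = 0"
    using w linear_0[OF tangent_map_linear[OF atlases(2,1) f(3,2)]] by (simp add: T_proj_def)
  have "w = tangent_map TP TP (\<lambda>x. x) p w" using tangent_map_id[OF atlases(1) p] by simp
  also have "\<dots> = tangent_map TP TP (\<lambda>x. act P (\<kappa> x) (f (proj P x))) p w"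
    by (rule fun_cong[OF tangent_map_cong[OF atlases(1) oW pW]]) (simp add: W(5))
  \<comment> \<open>Product rule for the action; the moving base point \<open>f (proj P x)\<close>
    contributes nothing, since its derivative along the vertical vector w is 0.\<close>
  also have "\<dots> = tangent_map TP TP (act P \<one>\<^bsub>G\<^esub>) p 0 + tangent_map GM TP (\<lambda>g. act P g p) \<one>\<^bsub>G\<^esub> (tangent_map TP GM \<kappa> p w)"
    using smooth_two_var.tangent_two_var[OF action atlases(1) fpr W(4) pW, of w] f(5) \<kappa>p 0 by simp
  also have "tangent_map TP TP (act P \<one>\<^bsub>G\<^esub>) p 0 = 0"
    using linear_0[OF T_act_linear[OF p Gr.one_closed]] by (simp add: T_act_def)
  finally show thesis using that[of "tangent_map TP GM \<kappa> p w"] by (simp add: generator_def)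
qed

section \<open>Adjoint and coadjoint classes\<close>

lemma Ad_class_self: "p \<in> points TP \<Longrightarrow> (p, \<xi>) \<in> Ad_class G P p \<xi>"
  unfolding Ad_class_def by (auto intro!: exI[of _ "\<one>\<^bsub>G\<^esub>"] simp: act_one Ad_one)

text \<open>By freeness a class contains exactly one pair over each point of its fibre, so it is the
  graph of an equivariant function.\<close>

lemma Ad_class_act_iff:
  assumes "p \<in> points TP" "g \<in> carrier G"
  shows "(act P g p, \<eta>) \<in> Ad_class G P p \<xi> \<longleftrightarrow> \<eta> = Ad G (inv\<^bsub>G\<^esub> g) \<xi>"
  using assms act_free[OF assms(1)] unfolding Ad_class_def by blast

lemma Ad_class_self_iff: "p \<in> points TP \<Longrightarrow> (p, \<eta>) \<in> Ad_class G P p \<xi> \<longleftrightarrow> \<eta> = \<xi>"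
  using Ad_class_act_iff[of p "\<one>\<^bsub>G\<^esub>"] by (simp add: act_one Ad_one)

text \<open>Both sides are the same orbit: every k in the group is g times some h.\<close>

lemma Ad_class_act:
  assumes p: "p \<in> points TP" and g: "g \<in> carrier G"
  shows "Ad_class G P (act P g p) (Ad G (inv\<^bsub>G\<^esub> g) \<xi>) = Ad_class G P p \<xi>"
proof -
  have 1: "(act P h (act P g p), Ad G (inv\<^bsub>G\<^esub> h) (Ad G (inv\<^bsub>G\<^esub> g) \<xi>)) =
      (act P (g \<otimes>\<^bsub>G\<^esub> h) p, Ad G (inv\<^bsub>G\<^esub> (g \<otimes>\<^bsub>G\<^esub> h)) \<xi>)" if "h \<in> carrier G" for h
    using p g that by (simp add: act_mult Gr.inv_mult_group Ad_mult)
  have "\<exists>h. h \<in> carrier G \<and> k = g \<otimes>\<^bsub>G\<^esub> h" if "k \<in> carrier G" for k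
    using g that by (intro exI[of _ "inv\<^bsub>G\<^esub> g \<otimes>\<^bsub>G\<^esub> k"]) (simp add: Gr.m_assoc[symmetric])
  then show ?thesis
    unfolding Ad_class_def using 1 g
    by (intro equalityI subsetI; clarsimp) (metis Gr.m_closed, metis)
qed

lemma coAd_class_act:
  assumes p: "p \<in> points TP" and g: "g \<in> carrier G"
  shows "coAd_class G P (act P g p) (\<lambda>\<xi>. \<mu> (Ad G g \<xi>)) = coAd_class G P p \<mu>"
proof -
  have 1: "(act P h (act P g p), \<lambda>\<xi>. \<mu> (Ad G g (Ad G h \<xi>))) =
      (act P (g \<otimes>\<^bsub>G\<^esub> h) p, \<lambda>\<xi>. \<mu> (Ad G (g \<otimes>\<^bsub>G\<^esub> h) \<xi>))" if "h \<in> carrier G" for h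
    using p g that by (simp add: act_mult Ad_mult)
  have "\<exists>h. h \<in> carrier G \<and> k = g \<otimes>\<^bsub>G\<^esub> h" if "k \<in> carrier G" for k
    using g that by (intro exI[of _ "inv\<^bsub>G\<^esub> g \<otimes>\<^bsub>G\<^esub> k"]) (simp add: Gr.m_assoc[symmetric])
  then show ?thesis
    unfolding coAd_class_def using 1 g
    by (intro equalityI subsetI; clarsimp) (metis Gr.m_closed, metis)
qed

text \<open>Another representative composes the covector with \<open>Ad G g\<close> and applies the
  inverse of that map to the vector, and the two cancel.\<close>

lemma fibre_pairing_class:
  assumes p: "p \<in> points TP"
  shows "fibre_pairing (coAd_class G P p \<mu>) (Ad_class G P p \<xi>) = \<mu> \<xi>"
  unfolding fibre_pairing_def
proof (rule the_equality)
  have "(p, \<mu>) \<in> coAd_class G P p \<mu>"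
    unfolding coAd_class_def by (auto intro!: exI[of _ "\<one>\<^bsub>G\<^esub>"] simp: act_one[OF p] Ad_one)
  then show "\<exists>q \<nu> \<eta>. (q, \<nu>) \<in> coAd_class G P p \<mu> \<and> (q, \<eta>) \<in> Ad_class G P p \<xi> \<and> \<mu> \<xi> = \<nu> \<eta>"
    using Ad_class_self[OF p] by blast
  fix r assume "\<exists>q \<nu> \<eta>. (q, \<nu>) \<in> coAd_class G P p \<mu> \<and> (q, \<eta>) \<in> Ad_class G P p \<xi> \<and> r = \<nu> \<eta>"
  then obtain g \<eta> where g: "g \<in> carrier G" "(act P g p, \<eta>) \<in> Ad_class G P p \<xi>" "r = \<mu> (Ad G g \<eta>)"
    by (auto simp: coAd_class_def)
  then have "\<eta> = Ad G (inv\<^bsub>G\<^esub> g) \<xi>" using Ad_class_act_iff[OF p g(1)] by simp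
  then show "r = \<mu> \<xi>" using g by (simp add: Ad_inv)
qed

lemma fibre_combination_class:
  assumes p: "p \<in> points TP"
  shows "fibre_combination a (Ad_class G P p \<xi>) b (Ad_class G P p \<eta>) = Ad_class G P p (a *\<^sub>R \<xi> + b *\<^sub>R \<eta>)"
proof -
  have lin: "Ad G (inv\<^bsub>G\<^esub> g) (a *\<^sub>R \<xi> + b *\<^sub>R \<eta>) = a *\<^sub>R Ad G (inv\<^bsub>G\<^esub> g) \<xi> + b *\<^sub>R Ad G (inv\<^bsub>G\<^esub> g) \<eta>"
    if "g \<in> carrier G" for g
    using Ad_linear[OF Gr.inv_closed[OF that]] by (simp add: linear_add linear_scale)
  have "x \<in> fibre_combination a (Ad_class G P p \<xi>) b (Ad_class G P p \<eta>) \<longleftrightarrow>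
      (\<exists>g\<in>carrier G. x = (act P g p, a *\<^sub>R Ad G (inv\<^bsub>G\<^esub> g) \<xi> + b *\<^sub>R Ad G (inv\<^bsub>G\<^esub> g) \<eta>))" for x
  proof
    assume "x \<in> fibre_combination a (Ad_class G P p \<xi>) b (Ad_class G P p \<eta>)"
    then obtain g \<eta>' where g: "g \<in> carrier G" "x = (act P g p, a *\<^sub>R Ad G (inv\<^bsub>G\<^esub> g) \<xi> + b *\<^sub>R \<eta>')"
      "(act P g p, \<eta>') \<in> Ad_class G P p \<eta>"
      by (auto simp: fibre_combination_def Ad_class_def[of G P p \<xi>])
    then have "\<eta>' = Ad G (inv\<^bsub>G\<^esub> g) \<eta>" using Ad_class_act_iff[OF p g(1)] by simp
    then show "\<exists>g\<in>carrier G. x = (act P g p, a *\<^sub>R Ad G (inv\<^bsub>G\<^esub> g) \<xi> + b *\<^sub>R Ad G (inv\<^bsub>G\<^esub> g) \<eta>)"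
      using g by (intro bexI[of _ g]) auto
  next
    assume "\<exists>g\<in>carrier G. x = (act P g p, a *\<^sub>R Ad G (inv\<^bsub>G\<^esub> g) \<xi> + b *\<^sub>R Ad G (inv\<^bsub>G\<^esub> g) \<eta>)"
    then obtain g where g: "g \<in> carrier G" "x = (act P g p, a *\<^sub>R Ad G (inv\<^bsub>G\<^esub> g) \<xi> + b *\<^sub>R Ad G (inv\<^bsub>G\<^esub> g) \<eta>)"
      by blast
    then show "x \<in> fibre_combination a (Ad_class G P p \<xi>) b (Ad_class G P p \<eta>)"
      unfolding fibre_combination_def using Ad_class_act_iff[OF p g(1)] by blast
  qed
  moreover have "x \<in> Ad_class G P p (a *\<^sub>R \<xi> + b *\<^sub>R \<eta>) \<longleftrightarrow>
      (\<exists>g\<in>carrier G. x = (act P g p, a *\<^sub>R Ad G (inv\<^bsub>G\<^esub> g) \<xi> + b *\<^sub>R Ad G (inv\<^bsub>G\<^esub> g) \<eta>))" for x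
    unfolding Ad_class_def using lin by auto
  ultimately show ?thesis by blast
qed

end

section \<open>Principal connections and the splitting of equivariant vector fields\<close>

section \<open>Principal connections\<close>

lemma smooth_atlas_vector_space: "smooth_atlas (vector_space_mfd :: ('e::fin_dim, 'e) mfd)"
proof -
  have "chart_inv (UNIV, \<lambda>x. x) = (\<lambda>x :: 'e. x)"
    using inv_into_f_f[OF inj_on_id, of _ UNIV] by (auto simp: chart_inv_def id_def)
  then show ?thesis by (simp add: smooth_atlas_def vector_space_mfd_def points_def)
qed

lemma smooth_map_on_vector_space:
  assumes "smooth_map_on N W (vector_space_mfd :: ('e::fin_dim, 'e) mfd) \<eta>"
  shows "smooth_fun N W \<eta>"
  using smooth_map_on_chart[OF assms, of "(UNIV, \<lambda>x. x)"] by (simp add: vector_space_mfd_def)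

text \<open>The Lie algebra is the model space at the unit, so a Lie algebra valued function is a
  field along the constant map to the unit. Generators with varying parameter thereby fall under
  \<open>smooth_field_partial\<close>.\<close>

lemma smooth_field_on_const_point:
  assumes N: "smooth_atlas N" and M: "smooth_atlas M" and \<eta>: "smooth_fun N W \<eta>" and k: "k \<in> points M"
  shows "smooth_field_on N W M (\<lambda>_. k) \<eta>"
  unfolding smooth_field_on_def
proof (intro conjI ballI)
  show "smooth_map_on N W M (\<lambda>_. k)" by (rule smooth_map_on_const[OF smooth_fun_openin[OF \<eta>] k])
  fix d assume d: "d \<in> Atlas M"
  show "smooth_fun N (W \<inter> (\<lambda>_. k) -` fst d) (\<lambda>q. to_chart M d k (\<eta> q))"
  proof (cases "k \<in> fst d")
    case True
    then show ?thesis
      using smooth_fun_linear[OF N fin_dim_linear_bounded[OF to_chart_linear[OF M d]] \<eta>] by simp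
  next
    case False
    \<comment> \<open>The domain is empty, so smoothness holds vacuously.\<close>
    then show ?thesis by (auto simp: smooth_fun_def intro: smooth_on_local)
  qed
qed

locale connection = principal G P
  for G :: "('g, 'o::fin_dim) lie_group"
    and P :: "('p, 'ep::fin_dim, 'm, 'em::fin_dim, 'g) fibre_bundle" +
  fixes A :: "'p \<Rightarrow> 'ep \<Rightarrow> 'o"
  assumes conn: "principal_connection G P A"
begin

lemma A_smooth: "smooth_form_along TP TP (\<lambda>p. p) A"
  and A_act: "p \<in> points TP \<Longrightarrow> g \<in> carrier G \<Longrightarrow> A (act P g p) (T_act P g p v) = Ad G (inv\<^bsub>G\<^esub> g) (A p v)"
  and A_generator: "p \<in> points TP \<Longrightarrow> A p (generator G P \<xi> p) = \<xi>"
  using conn by (auto simp: principal_connection_def)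

lemma A_linear: "p \<in> points TP \<Longrightarrow> linear (A p)"
  using A_smooth by (simp add: smooth_form_along_def)

text \<open>A vertical vector is a generator, and the connection returns its parameter.\<close>

lemma horizontal_vertical_cancel:
  assumes p: "p \<in> points TP" and w: "T_proj P p w = 0" "A p w = 0"
  shows "w = 0"
proof -
  obtain \<xi> where \<xi>: "w = generator G P \<xi> p" using T_proj_kernel[OF p w(1)] .
  then have "\<xi> = 0" using w(2) A_generator[OF p] by simp
  then show ?thesis using \<xi> linear_0[OF generator_linear[OF p]] by simp
qed

lemma tangent_vector_eqI:
  assumes p: "p \<in> points TP" and w: "T_proj P p w = T_proj P p w'" "A p w = A p w'"
  shows "w = w'"
  using horizontal_vertical_cancel[OF p, of "w - w'"] w
  by (simp add: linear_diff[OF T_proj_linear[OF p]] linear_diff[OF A_linear[OF p]])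

lemma Hor_eqI:
  assumes p: "p \<in> points TP" and w: "A p w = 0" "T_proj P p w = v"
  shows "Hor P A p v = w"
  unfolding Hor_def by (rule the_equality) (use w tangent_vector_eqI[OF p] in auto)

text \<open>The tangent vector of a section projects to v, and subtracting the generator of its
  connection value makes it horizontal. The formula provides existence of the lift and, in
  \<open>aut_lift_smooth\<close>, its smoothness.\<close>

lemma Hor_section:
  assumes V: "openin (Topo BP) V" "y \<in> V" and f: "smooth_map_on BP V TP f" "\<And>y. y \<in> V \<Longrightarrow> proj P (f y) = y"
  shows "Hor P A (f y) v =
    tangent_map BP TP f y v + generator G P (- A (f y) (tangent_map BP TP f y v)) (f y)"
proof -
  note p = smooth_map_on_points[OF f(1) V(2)]
  show ?thesis
    by (rule Hor_eqI[OF p])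
       (simp_all add: linear_add[OF A_linear[OF p]] linear_add[OF T_proj_linear[OF p]] A_generator[OF p]
          T_proj_generator[OF p] T_proj_section[OF V f])
qed

lemma Hor:
  assumes p: "p \<in> points TP"
  shows "A p (Hor P A p v) = 0" and "T_proj P p (Hor P A p v) = v"
proof -
  obtain V f where f: "openin (Topo BP) V" "proj P p \<in> V" "smooth_map_on BP V TP f"
    "\<And>y. y \<in> V \<Longrightarrow> proj P (f y) = y" "f (proj P p) = p" using section_through[OF p] by metis
  show "A p (Hor P A p v) = 0" "T_proj P p (Hor P A p v) = v"
    using Hor_section[OF f(1-4), of v] T_proj_section[OF f(1-4), of v] f(5)
    by (simp_all add: linear_add[OF A_linear[OF p]] linear_add[OF T_proj_linear[OF p]] A_generator[OF p]
        T_proj_generator[OF p])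
qed

lemma Hor_linear:
  assumes p: "p \<in> points TP"
  shows "linear (Hor P A p)"
  by (rule linearI)
     (auto intro!: Hor_eqI[OF p] simp: Hor[OF p] linear_add[OF A_linear[OF p]] linear_add[OF T_proj_linear[OF p]]
        linear_scale[OF A_linear[OF p]] linear_scale[OF T_proj_linear[OF p]])

lemma Hor_act:
  assumes p: "p \<in> points TP" and g: "g \<in> carrier G"
  shows "Hor P A (act P g p) v = T_act P g p (Hor P A p v)"
proof (rule Hor_eqI[OF act_points[OF g p]])
  have "inv\<^bsub>G\<^esub> g \<in> carrier G" using group g by simp
  then show "A (act P g p) (T_act P g p (Hor P A p v)) = 0"
    by (simp add: A_act[OF p g] Hor[OF p] linear_0[OF Ad_linear])
  show "T_proj P (act P g p) (T_act P g p (Hor P A p v)) = v"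
    by (simp add: T_proj_act[OF p g] Hor[OF p])
qed

lemma horizontal_vertical_split:
  assumes p: "p \<in> points TP"
  shows "w = Hor P A p (T_proj P p w) + generator G P (A p w) p"
  by (rule tangent_vector_eqI[OF p])
     (simp_all add: linear_add[OF A_linear[OF p]] linear_add[OF T_proj_linear[OF p]] Hor[OF p]
        A_generator[OF p] T_proj_generator[OF p])

section \<open>Sections of the adjoint bundle and equivariant vector fields\<close>

text \<open>The equivariant function on the bundle that corresponds to a section: its restriction to
  a fibre has the class there as graph.\<close>

definition Ad_component :: "('m \<Rightarrow> ('p \<times> 'o) set) \<Rightarrow> 'p \<Rightarrow> 'o" where
  "Ad_component \<sigma> p = (THE \<xi>. (p, \<xi>) \<in> \<sigma> (proj P p))"

lemma Ad_component_eqI: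
  assumes p: "p \<in> points TP" and \<sigma>: "\<sigma> (proj P p) = Ad_class G P p \<xi>"
  shows "Ad_component \<sigma> p = \<xi>"
  unfolding Ad_component_def \<sigma> by (rule the_equality) (use Ad_class_self_iff[OF p] in auto)

lemma Ad_sectionD:
  assumes \<sigma>: "\<sigma> \<in> Ad_sections G P" and x: "x \<in> points BP"
  obtains V f \<eta> where "openin (Topo BP) V" "x \<in> V" "smooth_map_on BP V TP f" "smooth_fun BP V \<eta>"
    "\<And>y. y \<in> V \<Longrightarrow> proj P (f y) = y" "\<And>y. y \<in> V \<Longrightarrow> \<sigma> y = Ad_class G P (f y) (\<eta> y)"
proof -
  obtain V f \<eta> where V: "openin (Topo BP) V" "x \<in> V" and f: "smooth_map (open_submfd BP V) TP f"
    and \<eta>: "smooth_map (open_submfd BP V) vector_space_mfd \<eta>"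
    and eq: "\<And>y. y \<in> V \<Longrightarrow> proj P (f y) = y \<and> \<sigma> y = Ad_class G P (f y) (\<eta> y)"
    using \<sigma> x unfolding Ad_sections_def by blast
  have pt: "points (open_submfd BP V) = V"
    using openin_subset[OF V(1)] points_open_submfd[of BP V] by (auto simp: points_def)
  note a = smooth_atlas_open_submfd[OF atlases(2) V(1)]
  have "smooth_map_on BP V TP f"
    using smooth_map_on_from_open_submfd[OF atlases(2) V(1) smooth_map_imp_on[OF a atlases(1) f]] by (simp add: pt)
  moreover have "smooth_fun BP V \<eta>"
    using smooth_map_on_vector_space[OF smooth_map_on_from_open_submfd[OF atlases(2) V(1)
          smooth_map_imp_on[OF a smooth_atlas_vector_space \<eta>]]] by (simp add: pt)
  ultimately show thesis using that V eq by blast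
qed

lemma Ad_component:
  assumes \<sigma>: "\<sigma> \<in> Ad_sections G P" and p: "p \<in> points TP"
  shows "\<sigma> (proj P p) = Ad_class G P p (Ad_component \<sigma> p)"
proof -
  obtain V f \<eta> where V: "proj P p \<in> V" "smooth_map_on BP V TP f" "\<And>y. y \<in> V \<Longrightarrow> proj P (f y) = y"
    "\<And>y. y \<in> V \<Longrightarrow> \<sigma> y = Ad_class G P (f y) (\<eta> y)"
    using Ad_sectionD[OF \<sigma> proj_points[OF p]] by metis
  note fp = smooth_map_on_points[OF V(2,1)]
  obtain g where g: "g \<in> carrier G" "p = act P g (f (proj P p))"
    using fibre_transitive[OF fp p] V(3)[OF V(1)] by blast
  have "\<sigma> (proj P p) = Ad_class G P p (Ad G (inv\<^bsub>G\<^esub> g) (\<eta> (proj P p)))"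
    using V(4)[OF V(1)] Ad_class_act[OF fp g(1)] g(2) by simp
  then show ?thesis using Ad_component_eqI[OF p] by metis
qed

lemma Ad_component_act:
  assumes \<sigma>: "\<sigma> \<in> Ad_sections G P" and p: "p \<in> points TP" and g: "g \<in> carrier G"
  shows "Ad_component \<sigma> (act P g p) = Ad G (inv\<^bsub>G\<^esub> g) (Ad_component \<sigma> p)"
  by (rule Ad_component_eqI[OF act_points[OF g p]])
     (simp add: proj_act[OF p g] Ad_component[OF \<sigma> p] Ad_class_act[OF p g])

text \<open>The linear maps \<open>Ad\<close> fix 0, so the point chosen in the fibre is immaterial.
  The section serves to remove the vertical term from an integrand.\<close>

definition zero_section :: "'m \<Rightarrow> ('p \<times> 'o) set" where
  "zero_section = (\<lambda>x\<in>points BP. Ad_class G P (SOME p. p \<in> points TP \<and> proj P p = x) 0)"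

lemma zero_section_class:
  assumes p: "p \<in> points TP"
  shows "zero_section (proj P p) = Ad_class G P p 0"
proof -
  let ?q = "SOME q. q \<in> points TP \<and> proj P q = proj P p"
  have q: "?q \<in> points TP" "proj P ?q = proj P p"
    using someI[of "\<lambda>q. q \<in> points TP \<and> proj P q = proj P p" p] p by auto
  obtain g where g: "g \<in> carrier G" "p = act P g ?q" using fibre_transitive[OF q(1) p q(2)] .
  have "inv\<^bsub>G\<^esub> g \<in> carrier G" using group g by simp
  then have "Ad_class G P p 0 = Ad_class G P ?q 0"
    using Ad_class_act[OF q(1) g(1), of 0] linear_0[OF Ad_linear] g(2) by metis
  then show ?thesis using proj_points[OF p] by (simp add: zero_section_def)
qed

lemma zero_section: "zero_section \<in> Ad_sections G P"
  unfolding Ad_sections_def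
proof (intro CollectI conjI ballI)
  show "zero_section \<in> extensional (points BP)" by (simp add: zero_section_def)
  fix x assume "x \<in> points BP"
  then obtain V f where f: "openin (Topo BP) V" "x \<in> V" "smooth_map_on BP V TP f" "\<And>y. y \<in> V \<Longrightarrow> proj P (f y) = y"
    using section_at by metis
  note sm = smooth_map_open_submfdI[OF atlases(2)]
  have "smooth_map_on BP V vector_space_mfd (\<lambda>_. 0 :: 'o)"
    by (rule smooth_map_on_const[OF f(1)]) (simp add: vector_space_mfd_def points_def)
  then have "smooth_map (open_submfd BP V) vector_space_mfd (\<lambda>_. 0 :: 'o)"
    by (rule sm[OF smooth_atlas_vector_space])
  moreover have "smooth_map (open_submfd BP V) TP f" by (rule sm[OF atlases(1) f(3)])
  moreover have "zero_section y = Ad_class G P (f y) 0" if "y \<in> V" for y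
    using zero_section_class[OF smooth_map_on_points[OF f(3) that]] f(4)[OF that] by simp
  ultimately show "\<exists>V f \<eta>. openin (Topo BP) V \<and> x \<in> V \<and> smooth_map (open_submfd BP V) TP f \<and>
      smooth_map (open_submfd BP V) vector_space_mfd \<eta> \<and>
      (\<forall>y\<in>V. proj P (f y) = y \<and> zero_section y = Ad_class G P (f y) (\<eta> y))"
    using f by (intro exI[of _ V] exI[of _ f] exI[of _ "\<lambda>_. 0"]) auto
qed

text \<open>Preimage of \<open>(u, \<sigma>)\<close> under \<open>aut_iso\<close>: the projection
  sees only the horizontal summand, the connection only the vertical one.\<close>

definition aut_lift :: "('m \<Rightarrow> 'em) \<Rightarrow> ('m \<Rightarrow> ('p \<times> 'o) set) \<Rightarrow> 'p \<Rightarrow> 'ep" where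
  "aut_lift u \<sigma> = (\<lambda>p\<in>points TP. Hor P A p (u (proj P p)) + generator G P (Ad_component \<sigma> p) p)"

lemma aut_lift_act:
  assumes \<sigma>: "\<sigma> \<in> Ad_sections G P" and p: "p \<in> points TP" and g: "g \<in> carrier G"
  shows "aut_lift u \<sigma> (act P g p) = T_act P g p (aut_lift u \<sigma> p)"
proof -
  have "aut_lift u \<sigma> (act P g p) = Hor P A (act P g p) (u (proj P p)) +
      generator G P (Ad G (inv\<^bsub>G\<^esub> g) (Ad_component \<sigma> p)) (act P g p)"
    using act_points[OF g p] by (simp add: aut_lift_def proj_act[OF p g] Ad_component_act[OF \<sigma> p g])
  also have "\<dots> = T_act P g p (Hor P A p (u (proj P p))) + T_act P g p (generator G P (Ad_component \<sigma> p) p)"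
    by (simp add: Hor_act[OF p g] generator_act[OF p g] Ad_inv[OF g])
  also have "\<dots> = T_act P g p (aut_lift u \<sigma> p)"
    using p by (simp add: aut_lift_def linear_add[OF T_act_linear[OF p g]])
  finally show ?thesis .
qed

lemma vector_fields_smooth:
  assumes M: "smooth_atlas M" and "u \<in> vector_fields M"
  shows "smooth_field_on M (points M) M (\<lambda>x. x) u"
  using assms smooth_field_along_iff[OF M M smooth_map_on_id[OF M points_openin]] by (simp add: vector_fields_def)

lemma aut_lift_smooth:
  assumes u: "u \<in> vector_fields BP" and \<sigma>: "\<sigma> \<in> Ad_sections G P"
  shows "smooth_field_on TP (points TP) TP (\<lambda>p. p) (aut_lift u \<sigma>)"
proof (rule smooth_field_on_local[OF atlases(1,1) smooth_map_on_id[OF atlases(1) points_openin]])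
  fix p assume p: "p \<in> points TP"
  obtain V f \<eta> where V: "openin (Topo BP) V" "proj P p \<in> V" and f: "smooth_map_on BP V TP f"
    and \<eta>: "smooth_fun BP V \<eta>" and pf: "\<And>y. y \<in> V \<Longrightarrow> proj P (f y) = y"
    and \<sigma>f: "\<And>y. y \<in> V \<Longrightarrow> \<sigma> y = Ad_class G P (f y) (\<eta> y)"
    using Ad_sectionD[OF \<sigma> proj_points[OF p]] by metis
  note fp = smooth_map_on_points[OF f]
  obtain W \<kappa> where W: "openin (Topo BP) W" "proj P p \<in> W" "W \<subseteq> V"
    and \<kappa>: "smooth_map_on TP (fibres_over W) GM \<kappa>" "\<And>p. p \<in> fibres_over W \<Longrightarrow> act P (\<kappa> p) (f (proj P p)) = p"
    using section_group_component[OF V f pf] by metis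
  define X where "X y = tangent_map BP TP f y (u y)" for y
  \<comment> \<open>The value of the lift along the section f. The vertical correction of
    \<open>Hor_section\<close> and the component of \<open>\<sigma>\<close> are merged into one
    generator by linearity.\<close>
  define Z where "Z y = X y + generator G P (\<eta> y + - A (f y) (X y)) (f y)" for y
  have Vs: "V \<subseteq> points BP" using openin_subset[OF V(1)] by (simp add: points_def)
  have uV: "smooth_field_on BP V BP (\<lambda>y. y) u"
    by (rule smooth_field_on_subset[OF vector_fields_smooth[OF atlases(2) u] V(1) Vs])
  have X: "smooth_field_on BP V TP f X"
    unfolding X_def[abs_def] using smooth_field_on_tangent[OF atlases(2,2,1) uV f] by simp
  have "smooth_fun BP V (\<lambda>y. \<eta> y + - A (f y) (X y))"
    by (intro smooth_fun_add[OF atlases(2)] \<eta> smooth_fun_linear[OF atlases(2) bounded_linear_minus[OF bounded_linear_ident]]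
        smooth_form_apply[OF atlases(2,1) A_smooth X])
  then have "smooth_field_on BP V GM (\<lambda>_. \<one>\<^bsub>G\<^esub>) (\<lambda>y. \<eta> y + - A (f y) (X y))"
    by (rule smooth_field_on_const_point[OF atlases(2,3) _ one_points])
  from smooth_two_var.smooth_field_partial(2)[OF action atlases(2) f smooth_map_on_const[OF V(1) one_points] this]
  have "smooth_field_on BP V TP (\<lambda>y. act P \<one>\<^bsub>G\<^esub> (f y)) (\<lambda>y. generator G P (\<eta> y + - A (f y) (X y)) (f y))"
    by (simp add: generator_def)
  then have "smooth_field_on BP V TP f (\<lambda>y. generator G P (\<eta> y + - A (f y) (X y)) (f y))"
    by (subst (asm) smooth_field_on_cong[OF atlases(2), where f' = f]) (auto simp: act_one fp)
  then have Z: "smooth_field_on BP V TP f Z"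
    unfolding Z_def[abs_def] by (rule smooth_field_on_add[OF atlases(2,1) X])
  have lift_Z: "aut_lift u \<sigma> (f y) = Z y" if y: "y \<in> V" for y
  proof -
    have "Ad_component \<sigma> (f y) = \<eta> y"
      by (rule Ad_component_eqI[OF fp[OF y]]) (simp add: pf[OF y] \<sigma>f[OF y])
    then show ?thesis
      using fp[OF y] pf[OF y] Hor_section[OF V(1) y f pf, of "u y"] linear_add[OF generator_linear[OF fp[OF y]]]
      by (simp add: aut_lift_def Z_def X_def del: add_uminus_conv_diff)
  qed
  let ?W = "fibres_over W"
  note oW = fibres_over_openin[OF W(1)]
  have pr: "smooth_map_on TP ?W BP (proj P)"
    by (rule smooth_map_on_subset[OF proj_smooth oW]) (auto simp: fibres_over_def)
  have "?W \<inter> proj P -` V = ?W" using W(3) by (auto simp: fibres_over_def)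
  then have Zpr: "smooth_field_on TP ?W TP (\<lambda>p. f (proj P p)) (\<lambda>p. Z (proj P p))"
    using smooth_field_on_compose[OF atlases(1,2,1) pr Z] by simp
  \<comment> \<open>Every q over W is \<open>act P (\<kappa> q) (f (proj P q))\<close>, so by
    equivariance the lift at q is Z pushed forward by the action. The acting element varies with q,
    which is why the partial tangent map of the action is used.\<close>
  have "smooth_field_on TP ?W TP (\<lambda>p. act P (\<kappa> p) (f (proj P p)))
      (\<lambda>p. T_act P (\<kappa> p) (f (proj P p)) (Z (proj P p)))"
    using smooth_two_var.smooth_field_partial(1)[OF action atlases(1) smooth_field_on_map[OF Zpr] \<kappa>(1) Zpr]
    by (simp add: T_act_def)
  moreover have "T_act P (\<kappa> q) (f (proj P q)) (Z (proj P q)) = aut_lift u \<sigma> q" if q: "q \<in> ?W" for q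
  proof -
    have y: "proj P q \<in> V" using q W(3) by (auto simp: fibres_over_def)
    have "\<kappa> q \<in> carrier G" using smooth_map_on_points[OF \<kappa>(1) q] by (simp add: carrier)
    from aut_lift_act[OF \<sigma> fp[OF y] this] show ?thesis using \<kappa>(2)[OF q] lift_Z[OF y] by simp
  qed
  ultimately have "smooth_field_on TP ?W TP (\<lambda>p. p) (aut_lift u \<sigma>)"
    by (subst (asm) smooth_field_on_cong[OF atlases(1), where f' = "\<lambda>p. p" and V' = "aut_lift u \<sigma>"])
       (simp_all add: \<kappa>(2))
  then show "\<exists>W'. p \<in> W' \<and> W' \<subseteq> points TP \<and> smooth_field_on TP W' TP (\<lambda>p. p) (aut_lift u \<sigma>)"
    using p W(2) by (intro exI[of _ ?W]) (auto simp: fibres_over_def)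
qed

lemma aut_lift_aut:
  assumes "u \<in> vector_fields BP" "\<sigma> \<in> Ad_sections G P"
  shows "aut_lift u \<sigma> \<in> aut G P"
  using aut_lift_smooth[OF assms] aut_lift_act[OF assms(2)]
    smooth_field_along_iff[OF atlases(1,1) smooth_map_on_id[OF atlases(1) points_openin]]
  by (simp add: aut_def vector_fields_def aut_lift_def)

lemma aut_iso_fst:
  assumes U: "U \<in> aut G P" and p: "p \<in> points TP"
  shows "fst (aut_iso G P A U) (proj P p) = T_proj P p (U p)"
proof -
  have "(THE v. \<exists>q\<in>points TP. proj P q = proj P p \<and> v = T_proj P q (U q)) = T_proj P p (U p)"
  proof (rule the_equality)
    fix v assume "\<exists>q\<in>points TP. proj P q = proj P p \<and> v = T_proj P q (U q)"
    then obtain q where q: "q \<in> points TP" "proj P p = proj P q" "v = T_proj P q (U q)" by metis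
    obtain g where g: "g \<in> carrier G" "q = act P g p" using fibre_transitive[OF p q(1,2)] .
    then show "v = T_proj P p (U p)" using U p q(3) by (simp add: aut_def T_proj_act)
  qed (use p in blast)
  then show ?thesis using proj_points[OF p] by (simp add: aut_iso_def)
qed

lemma aut_iso_snd:
  assumes U: "U \<in> aut G P" and p: "p \<in> points TP"
  shows "snd (aut_iso G P A U) (proj P p) = Ad_class G P p (A p (U p))"
proof -
  have "(THE c. \<exists>q\<in>points TP. proj P q = proj P p \<and> c = Ad_class G P q (A q (U q))) = Ad_class G P p (A p (U p))"
  proof (rule the_equality)
    fix c assume "\<exists>q\<in>points TP. proj P q = proj P p \<and> c = Ad_class G P q (A q (U q))"
    then obtain q where q: "q \<in> points TP" "proj P p = proj P q" "c = Ad_class G P q (A q (U q))" by metis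
    obtain g where g: "g \<in> carrier G" "q = act P g p" using fibre_transitive[OF p q(1,2)] .
    then show "c = Ad_class G P p (A p (U p))"
      using U p q(3) by (simp add: aut_def A_act Ad_class_act)
  qed (use p in blast)
  then show ?thesis using proj_points[OF p] by (simp add: aut_iso_def)
qed

lemma aut_iso_lift:
  assumes u: "u \<in> vector_fields BP" and \<sigma>: "\<sigma> \<in> Ad_sections G P"
  shows "aut_iso G P A (aut_lift u \<sigma>) = (u, \<sigma>)"
proof (rule prod_eqI)
  note L = aut_lift_aut[OF u \<sigma>]
  have props: "T_proj P p (aut_lift u \<sigma> p) = u (proj P p)" "A p (aut_lift u \<sigma> p) = Ad_component \<sigma> p"
    if p: "p \<in> points TP" for p
    using p by (simp_all add: aut_lift_def linear_add[OF T_proj_linear[OF p]] linear_add[OF A_linear[OF p]]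
        Hor[OF p] A_generator[OF p] T_proj_generator[OF p])
  show "fst (aut_iso G P A (aut_lift u \<sigma>)) = fst (u, \<sigma>)"
  proof (rule extensionalityI[where A = "points BP"])
    fix x assume "x \<in> points BP"
    then obtain p where p: "p \<in> points TP" "proj P p = x" using proj_surj by metis
    then show "fst (aut_iso G P A (aut_lift u \<sigma>)) x = fst (u, \<sigma>) x"
      using aut_iso_fst[OF L p(1)] props[OF p(1)] by simp
  qed (use u in \<open>simp_all add: aut_iso_def vector_fields_def\<close>)
  show "snd (aut_iso G P A (aut_lift u \<sigma>)) = snd (u, \<sigma>)"
  proof (rule extensionalityI[where A = "points BP"])
    fix x assume "x \<in> points BP"
    then obtain p where p: "p \<in> points TP" "proj P p = x" using proj_surj by metis
    then show "snd (aut_iso G P A (aut_lift u \<sigma>)) x = snd (u, \<sigma>) x"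
      using aut_iso_snd[OF L p(1)] props[OF p(1)] Ad_component[OF \<sigma> p(1)] by simp
  qed (use \<sigma> in \<open>simp_all add: aut_iso_def Ad_sections_def\<close>)
qed

text \<open>\<open>inv_into\<close> picks some preimage. Its projection and its connection value are
  prescribed at every point, and together they determine the vector.\<close>

lemma aut_iso_inverse:
  assumes u: "u \<in> vector_fields BP" and \<sigma>: "\<sigma> \<in> Ad_sections G P"
  defines "U \<equiv> inv_into (aut G P) (aut_iso G P A) (u, \<sigma>)"
  shows "U \<in> aut G P"
    and "p \<in> points TP \<Longrightarrow> U p = Hor P A p (u (proj P p)) + generator G P (Ad_component \<sigma> p) p"
proof -
  have im: "(u, \<sigma>) \<in> aut_iso G P A ` aut G P"
    using aut_iso_lift[OF u \<sigma>] aut_lift_aut[OF u \<sigma>] by (metis imageI)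
  show U: "U \<in> aut G P" unfolding U_def by (rule inv_into_into[OF im])
  have iso: "aut_iso G P A U = (u, \<sigma>)" unfolding U_def by (rule f_inv_into_f[OF im])
  show "U p = Hor P A p (u (proj P p)) + generator G P (Ad_component \<sigma> p) p" if p: "p \<in> points TP"
  proof -
    have "T_proj P p (U p) = u (proj P p)" using aut_iso_fst[OF U p] iso by simp
    moreover have "A p (U p) = Ad_component \<sigma> p"
      using aut_iso_snd[OF U p] iso Ad_component_eqI[OF p, of \<sigma> "A p (U p)"] by simp
    ultimately show ?thesis using horizontal_vertical_split[OF p, of "U p"] by simp
  qed
qed

end

section \<open>Evaluation of the momentum map on the space of equivariant maps\<close>

section \<open>The momentum map\<close>

locale kaluza_klein = connection G P A + S: principal G PS
  for G :: "('g, 'o::fin_dim) lie_group"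
    and P :: "('p, 'ep::fin_dim, 'm, 'em::fin_dim, 'g) fibre_bundle"
    and A :: "'p \<Rightarrow> 'ep \<Rightarrow> 'o"
    and PS :: "('q, 'eq::fin_dim, 's, 'es::fin_dim, 'g) fibre_bundle" +
  fixes vol :: "'s \<Rightarrow> 'es list \<Rightarrow> real" and Q :: "'q \<Rightarrow> 'p" and \<alpha> :: "'q \<Rightarrow> 'ep \<Rightarrow> real"
  assumes vol: "volume_form (base_space PS) vol" and Q: "Q \<in> QKK G P PS" and \<alpha>: "\<alpha> \<in> cT_QKK G P PS vol Q"
begin

abbreviation "\<nu> \<equiv> volume_measure (base_space PS) vol"
abbreviation "bQ \<equiv> induced_map P PS Q"
abbreviation "hor \<equiv> horizontal_momentum P PS A Q \<alpha>"
abbreviation "vert s \<equiv> coAd_map G P Q (zeta_bar G P PS Q \<alpha> s)"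

lemma Q_smooth: "smooth_map_on S.TP (points S.TP) TP Q"
  using Q by (intro smooth_map_imp_on S.atlases atlases) (simp add: QKK_def)

lemma Q_points: "q \<in> points S.TP \<Longrightarrow> Q q \<in> points TP"
  by (rule smooth_map_on_points[OF Q_smooth])

lemma Q_act: "q \<in> points S.TP \<Longrightarrow> g \<in> carrier G \<Longrightarrow> Q (act PS g q) = act P g (Q q)"
  using Q by (simp add: QKK_def)

lemma \<alpha>_linear: "q \<in> points S.TP \<Longrightarrow> linear (\<alpha> q)"
  and \<alpha>_act: "q \<in> points S.TP \<Longrightarrow> g \<in> carrier G \<Longrightarrow> \<alpha> (act PS g q) (T_act P g (Q q) v) = \<alpha> q v"
  and \<alpha>_integrable: "V \<in> T_QKK G P PS Q \<Longrightarrow> integrable \<nu> (contraction PS \<alpha> V)"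
  using \<alpha> by (auto simp: cT_QKK_def smooth_form_along_def)

text \<open>The common reason why the descriptions over fibres of \<open>PS\<close> have the
  expected values: the group acts transitively on a fibre, so an invariant function is constant
  there.\<close>

lemma the_on_fibre:
  assumes q: "q \<in> points S.TP"
    and F: "\<And>g. g \<in> carrier G \<Longrightarrow> F (act PS g q) = F q"
  shows "(THE r. \<exists>q'\<in>points S.TP. proj PS q' = proj PS q \<and> r = F q') = F q"
proof (rule the_equality)
  fix r assume "\<exists>q'\<in>points S.TP. proj PS q' = proj PS q \<and> r = F q'"
  then obtain q' where q': "q' \<in> points S.TP" "proj PS q = proj PS q'" "r = F q'" by metis
  obtain g where "g \<in> carrier G" "q' = act PS g q" using S.fibre_transitive[OF q q'(1,2)] .
  then show "r = F q" using q'(3) F by simp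
qed (use q in blast)

lemma bQ:
  assumes q: "q \<in> points S.TP"
  shows "bQ (proj PS q) = proj P (Q q)"
proof -
  have "(THE x. \<exists>q'\<in>points S.TP. proj PS q' = proj PS q \<and> x = proj P (Q q')) = proj P (Q q)"
    by (rule the_on_fibre[OF q]) (simp add: Q_act[OF q] proj_act[OF Q_points[OF q]])
  then show ?thesis using S.proj_points[OF q] by (simp add: induced_map_def)
qed

lemma contraction:
  assumes V: "V \<in> T_QKK G P PS Q" and q: "q \<in> points S.TP"
  shows "contraction PS \<alpha> V (proj PS q) = \<alpha> q (V q)"
  unfolding contraction_def
  by (rule the_on_fibre[OF q]) (use V q in \<open>simp add: T_QKK_def \<alpha>_act\<close>)

lemma hor:
  assumes q: "q \<in> points S.TP"
  shows "hor (proj PS q) v = \<alpha> q (Hor P A (Q q) v)"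
  unfolding horizontal_momentum_def
  by (rule the_on_fibre[OF q]) (simp add: Q_act[OF q] Hor_act[OF Q_points[OF q]] \<alpha>_act[OF q])

lemma zeta: "zeta G P Q \<alpha> q \<xi> = \<alpha> q (generator G P \<xi> (Q q))"
  by (simp add: zeta_def momentum_map_def)

text \<open>Equivariance of the momentum map of the structure group, obtained from
  \<open>generator_act\<close> and the invariance of \<open>\<alpha>\<close>. It makes
  \<open>zeta_bar\<close> independent of the point in the fibre.\<close>

lemma zeta_act:
  assumes "q \<in> points S.TP" "g \<in> carrier G"
  shows "zeta G P Q \<alpha> (act PS g q) = (\<lambda>\<xi>. zeta G P Q \<alpha> q (Ad G g \<xi>))"
  using assms by (simp add: fun_eq_iff zeta Q_act generator_act[OF Q_points] \<alpha>_act)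

lemma zeta_bar:
  assumes q: "q \<in> points S.TP"
  shows "zeta_bar G P PS Q \<alpha> (proj PS q) = coAd_class G PS q (zeta G P Q \<alpha> q)"
  unfolding zeta_bar_def
  by (rule the_on_fibre[OF q]) (simp add: zeta_act[OF q] S.coAd_class_act[OF q])

text \<open>Since Q is equivariant, all representatives of a class are sent into one orbit.\<close>

lemma coAd_map_class:
  assumes q: "q \<in> points S.TP"
  shows "coAd_map G P Q (coAd_class G PS q \<mu>) = coAd_class G P (Q q) \<mu>"
  unfolding coAd_map_def
proof (rule the_equality)
  have eq: "coAd_class G P (Q q') \<mu>' = coAd_class G P (Q q) \<mu>" if "(q', \<mu>') \<in> coAd_class G PS q \<mu>" for q' \<mu>'
    using that coAd_class_act[OF Q_points[OF q]] by (auto simp: coAd_class_def[of G PS] Q_act[OF q])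
  have "(q, \<mu>) \<in> coAd_class G PS q \<mu>"
    unfolding coAd_class_def
    using group by (auto intro!: exI[of _ "\<one>\<^bsub>G\<^esub>"] simp: S.act_one[OF q] Ad_one group.is_monoid monoid.one_closed)
  then show "\<exists>(q', \<mu>')\<in>coAd_class G PS q \<mu>. coAd_class G P (Q q) \<mu> = coAd_class G P (Q q') \<mu>'"
    by (intro bexI[of _ "(q, \<mu>)"]) auto
  show "b = coAd_class G P (Q q) \<mu>" if "\<exists>(q', \<mu>')\<in>coAd_class G PS q \<mu>. b = coAd_class G P (Q q') \<mu>'" for b
    using that eq by auto
qed

text \<open>Links the pairing in the associated bundles to the value of \<open>\<alpha>\<close> on a
  generator, the form in which it occurs in the contraction.\<close>

lemma fibre_pairing_vert:
  assumes \<sigma>: "\<sigma> \<in> Ad_sections G P" and q: "q \<in> points S.TP"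
  shows "fibre_pairing (vert (proj PS q)) (\<sigma> (bQ (proj PS q))) = \<alpha> q (generator G P (Ad_component \<sigma> (Q q)) (Q q))"
  using fibre_pairing_class[OF Q_points[OF q]]
  by (simp add: zeta_bar[OF q] coAd_map_class[OF q] bQ[OF q] Ad_component[OF \<sigma> Q_points[OF q]] zeta)

lemma aut_smooth: "U \<in> aut G P \<Longrightarrow> smooth_field_on TP (points TP) TP (\<lambda>p. p) U"
  by (rule vector_fields_smooth[OF atlases(1)]) (simp add: aut_def)

lemma aut_generator:
  assumes U: "U \<in> aut G P"
  shows "aut_generator P PS U Q = (\<lambda>q\<in>points S.TP. U (Q q))"
proof -
  have "velocity TP (\<lambda>t. left_action PS (flow TP U t) Q q) 0 = U (Q q)" if q: "q \<in> points S.TP" for q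
    using velocity_flow[OF manifolds(1) aut_smooth[OF U] Q_points[OF q]] q
    by (simp add: left_action_def compose_def)
  then show ?thesis by (auto simp: aut_generator_def)
qed

text \<open>Membership in the tangent space gives access to the convergence contained in
  \<open>cT_QKK\<close>, and makes the contraction a function on the base.\<close>

lemma aut_generator_tangent:
  assumes U: "U \<in> aut G P"
  shows "aut_generator P PS U Q \<in> T_QKK G P PS Q"
proof -
  have "points S.TP \<inter> Q -` points TP = points S.TP" using Q_points by auto
  then have "smooth_field_on S.TP (points S.TP) TP Q (\<lambda>q. U (Q q))"
    using smooth_field_on_compose[OF S.atlases(1) atlases(1,1) Q_smooth aut_smooth[OF U]] by simp
  then have "smooth_field_on S.TP (points S.TP) TP Q (\<lambda>q\<in>points S.TP. U (Q q))"
    by (subst smooth_field_on_cong[OF S.atlases(1), where f' = Q and V' = "\<lambda>q. U (Q q)"]) auto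
  then have "smooth_field_along S.TP TP Q (\<lambda>q\<in>points S.TP. U (Q q))"
    by (simp add: smooth_field_along_iff[OF S.atlases(1) atlases(1) Q_smooth])
  then show ?thesis
    using U by (simp add: aut_generator[OF U] T_QKK_def S.act_points Q_act Q_points aut_def)
qed

lemma space_\<nu>: "space \<nu> = points S.BP"
  by (rule space_volume_measure[OF S.manifolds(2) vol])

lemma points_baseE:
  assumes "s \<in> space \<nu>"
  obtains q where "q \<in> points S.TP" "s = proj PS q"
  using assms S.proj_surj unfolding space_\<nu> by metis

lemma contraction_split:
  assumes u: "u \<in> vector_fields BP" and \<sigma>: "\<sigma> \<in> Ad_sections G P" and s: "s \<in> space \<nu>"
  shows "contraction PS \<alpha> (aut_generator P PS (inv_into (aut G P) (aut_iso G P A) (u, \<sigma>)) Q) s =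
    hor s (u (bQ s)) + fibre_pairing (vert s) (\<sigma> (bQ s))"
proof -
  note U = aut_iso_inverse[OF u \<sigma>]
  obtain q where q: "q \<in> points S.TP" "s = proj PS q" using points_baseE[OF s] .
  show ?thesis
    using contraction[OF aut_generator_tangent[OF U(1)] q(1)] q U(2)[OF Q_points[OF q(1)]]
      linear_add[OF \<alpha>_linear[OF q(1)]] fibre_pairing_vert[OF \<sigma> q(1)]
    by (simp add: aut_generator[OF U(1)] hor bQ)
qed

lemma integrable_split:
  assumes u: "u \<in> vector_fields BP" and \<sigma>: "\<sigma> \<in> Ad_sections G P"
  shows "integrable \<nu> (\<lambda>s. hor s (u (bQ s)) + fibre_pairing (vert s) (\<sigma> (bQ s)))"
  using \<alpha>_integrable[OF aut_generator_tangent[OF aut_iso_inverse(1)[OF u \<sigma>]]]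
  by (subst (asm) Bochner_Integration.integrable_cong[OF refl contraction_split[OF u \<sigma>]])

lemma integrable_hor:
  assumes u: "u \<in> vector_fields BP"
  shows "integrable \<nu> (\<lambda>s. hor s (u (bQ s)))"
proof -
  have "hor s (u (bQ s)) + fibre_pairing (vert s) (zero_section (bQ s)) = hor s (u (bQ s))" if s: "s \<in> space \<nu>" for s
  proof -
    obtain q where q: "q \<in> points S.TP" "s = proj PS q" using points_baseE[OF s] .
    note p = Q_points[OF q(1)]
    have "Ad_component zero_section (Q q) = 0" 
      by (rule Ad_component_eqI[where \<sigma> = zero_section, OF p zero_section_class[OF p]])
    then show ?thesis
      using q fibre_pairing_vert[OF zero_section q(1)] linear_0[OF generator_linear[OF p]] linear_0[OF \<alpha>_linear[OF q(1)]]
      by simp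
  qed
  then show ?thesis
    using integrable_split[OF u zero_section] Bochner_Integration.integrable_cong[OF refl] by (metis (no_types, lifting))
qed

lemma zero_vector_field: "(\<lambda>x\<in>points BP. 0) \<in> vector_fields BP"
proof -
  note id = smooth_map_on_id[OF atlases(2) points_openin]
  have "smooth_field_on BP (points BP) BP (\<lambda>x. x) (\<lambda>x\<in>points BP. 0)"
    by (subst smooth_field_on_cong[OF atlases(2), where f' = "\<lambda>x. x" and V' = "\<lambda>x. 0"])
       (auto intro: smooth_field_on_zero[OF atlases(2,2) id])
  then show ?thesis by (simp add: vector_fields_def smooth_field_along_iff[OF atlases(2,2) id])
qed

text \<open>The horizontal terms of the two integrands are the same and cancel.\<close>

lemma integrable_vert:
  assumes \<sigma>: "\<sigma> \<in> Ad_sections G P"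
  shows "integrable \<nu> (\<lambda>s. fibre_pairing (vert s) (\<sigma> (bQ s)))"
  using Bochner_Integration.integrable_diff[OF integrable_split[OF zero_vector_field \<sigma>] integrable_hor[OF zero_vector_field]]
  by simp

lemma momentum_split:
  assumes u: "u \<in> vector_fields BP" and \<sigma>: "\<sigma> \<in> Ad_sections G P"
  shows "J_L_split G P PS vol A Q \<alpha> (u, \<sigma>) =
    (\<integral>s. (hor s (u (bQ s)) + fibre_pairing (vert s) (\<sigma> (bQ s))) \<partial>\<nu>)"
  unfolding J_L_split_def J_L_def momentum_map_def KK_pairing_def
  by (rule Bochner_Integration.integral_cong[OF refl contraction_split[OF u \<sigma>]])

text \<open>Pointwise linearity is inherited from the horizontal lift and \<open>\<alpha>\<close>;
  additivity of the integral then uses convergence of the horizontal term alone.\<close>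

lemma hor_dual: "delta_integral (\<lambda>\<beta> v. \<beta> v) \<nu> bQ hor \<in> vector_field_dual BP"
  unfolding vector_field_dual_def delta_integral_def
proof (intro CollectI ballI allI)
  fix u v a b assume u: "u \<in> vector_fields BP" and v: "v \<in> vector_fields BP"
  have "(\<integral>s. hor s ((\<lambda>x\<in>points BP. a *\<^sub>R u x + b *\<^sub>R v x) (bQ s)) \<partial>\<nu>) =
      (\<integral>s. a * hor s (u (bQ s)) + b * hor s (v (bQ s)) \<partial>\<nu>)"
  proof (rule Bochner_Integration.integral_cong[OF refl])
    fix s assume "s \<in> space \<nu>"
    then obtain q where q: "q \<in> points S.TP" "s = proj PS q" using points_baseE by metis
    note p = Q_points[OF q(1)]
    show "hor s ((\<lambda>x\<in>points BP. a *\<^sub>R u x + b *\<^sub>R v x) (bQ s)) = a * hor s (u (bQ s)) + b * hor s (v (bQ s))"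
      using proj_points[OF p]
      by (simp add: q(2) hor[OF q(1)] bQ[OF q(1)] linear_add[OF Hor_linear[OF p]] linear_scale[OF Hor_linear[OF p]]
          linear_add[OF \<alpha>_linear[OF q(1)]] linear_scale[OF \<alpha>_linear[OF q(1)]])
  qed
  also have "\<dots> = a * (\<integral>s. hor s (u (bQ s)) \<partial>\<nu>) + b * (\<integral>s. hor s (v (bQ s)) \<partial>\<nu>)"
    using integrable_hor[OF u] integrable_hor[OF v] by simp
  finally show "(\<integral>s. hor s ((\<lambda>x\<in>points BP. a *\<^sub>R u x + b *\<^sub>R v x) (bQ s)) \<partial>\<nu>) =
      a * (\<integral>s. hor s (u (bQ s)) \<partial>\<nu>) + b * (\<integral>s. hor s (v (bQ s)) \<partial>\<nu>)" .
qed

text \<open>A combination of two classes over one point is the class of the combined components, so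
  linearity reduces to that of generators and \<open>\<alpha>\<close>.\<close>

lemma vert_dual: "delta_integral fibre_pairing \<nu> bQ (\<lambda>s. vert s) \<in> Ad_section_dual G P"
  unfolding Ad_section_dual_def delta_integral_def
proof (intro CollectI ballI allI)
  fix \<sigma> \<tau> a b assume \<sigma>: "\<sigma> \<in> Ad_sections G P" and \<tau>: "\<tau> \<in> Ad_sections G P"
  let ?c = "\<lambda>x\<in>points BP. fibre_combination a (\<sigma> x) b (\<tau> x)"
  have "(\<integral>s. fibre_pairing (vert s) (?c (bQ s)) \<partial>\<nu>) =
      (\<integral>s. a * fibre_pairing (vert s) (\<sigma> (bQ s)) + b * fibre_pairing (vert s) (\<tau> (bQ s)) \<partial>\<nu>)"
  proof (rule Bochner_Integration.integral_cong[OF refl])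
    fix s assume "s \<in> space \<nu>"
    then obtain q where q: "q \<in> points S.TP" "s = proj PS q" using points_baseE by metis
    note p = Q_points[OF q(1)]
    have "?c (bQ s) = Ad_class G P (Q q) (a *\<^sub>R Ad_component \<sigma> (Q q) + b *\<^sub>R Ad_component \<tau> (Q q))"
      using proj_points[OF p]
      by (simp add: q(2) bQ[OF q(1)] Ad_component[OF \<sigma> p] Ad_component[OF \<tau> p] fibre_combination_class[OF p])
    then show "fibre_pairing (vert s) (?c (bQ s)) =
        a * fibre_pairing (vert s) (\<sigma> (bQ s)) + b * fibre_pairing (vert s) (\<tau> (bQ s))"
      using fibre_pairing_vert[OF \<sigma> q(1)] fibre_pairing_vert[OF \<tau> q(1)] fibre_pairing_class[OF p]
      by (simp add: q(2) zeta_bar[OF q(1)] coAd_map_class[OF q(1)] zeta linear_add[OF generator_linear[OF p]]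
          linear_scale[OF generator_linear[OF p]] linear_add[OF \<alpha>_linear[OF q(1)]] linear_scale[OF \<alpha>_linear[OF q(1)]])
  qed
  also have "\<dots> = a * (\<integral>s. fibre_pairing (vert s) (\<sigma> (bQ s)) \<partial>\<nu>) + b * (\<integral>s. fibre_pairing (vert s) (\<tau> (bQ s)) \<partial>\<nu>)"
    using integrable_vert[OF \<sigma>] integrable_vert[OF \<tau>] by simp
  finally show "(\<integral>s. fibre_pairing (vert s) (?c (bQ s)) \<partial>\<nu>) =
      a * (\<integral>s. fibre_pairing (vert s) (\<sigma> (bQ s)) \<partial>\<nu>) + b * (\<integral>s. fibre_pairing (vert s) (\<tau> (bQ s)) \<partial>\<nu>)" .
qed

end

theorem proposition3p8:
  fixes G :: "('g, 'o::fin_dim) lie_group"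
    and P :: "('p, 'ep::fin_dim, 'm, 'em::fin_dim, 'g) fibre_bundle"
    and PS :: "('q, 'eq::fin_dim, 'm, 'es::fin_dim, 'g) fibre_bundle"
    and vol :: "'m \<Rightarrow> 'es list \<Rightarrow> real"
    and A :: "'p \<Rightarrow> 'ep \<Rightarrow> 'o"
    and Q :: "'q \<Rightarrow> 'p"
    and \<alpha> :: "'q \<Rightarrow> 'ep \<Rightarrow> real"
  assumes "principal_bundle G P"
    and "principal_bundle G PS"
    and "submanifold (base_space PS) (base_space P)"
    and "volume_form (base_space PS) vol"
    and "principal_connection G P A"
    and "Q \<in> QKK G P PS"
    and "\<alpha> \<in> cT_QKK G P PS vol Q"
  shows
    "let \<nu> = volume_measure (base_space PS) vol;
         bQ = induced_map P PS Q;
         J = J_L_split G P PS vol A Q \<alpha>;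
         hor = horizontal_momentum P PS A Q \<alpha>;
         vert = (\<lambda>s. coAd_map G P Q (zeta_bar G P PS Q \<alpha> s));
         J\<^sub>1 = delta_integral (\<lambda>\<beta> v. \<beta> v) \<nu> bQ hor;
         J\<^sub>2 = delta_integral fibre_pairing \<nu> bQ vert
     in J\<^sub>1 \<in> vector_field_dual (base_space P) \<and> J\<^sub>2 \<in> Ad_section_dual G P \<and>
        (\<forall>u\<in>vector_fields (base_space P). \<forall>\<sigma>\<in>Ad_sections G P.
           J (u, \<sigma>) = J\<^sub>1 u + J\<^sub>2 \<sigma> \<and>
           J (u, \<sigma>) = (\<integral>s. (hor s (u (bQ s)) + fibre_pairing (vert s) (\<sigma> (bQ s))) \<partial>\<nu>))"
proof -
  interpret kaluza_klein G P A PS vol Q \<alpha>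
    using assms by unfold_locales
  show ?thesis
    unfolding Let_def
  proof (intro conjI ballI hor_dual vert_dual)
    fix u \<sigma> assume u: "u \<in> vector_fields BP" and \<sigma>: "\<sigma> \<in> Ad_sections G P"
    show "J_L_split G P PS vol A Q \<alpha> (u, \<sigma>) =
        (\<integral>s. (hor s (u (bQ s)) + fibre_pairing (vert s) (\<sigma> (bQ s))) \<partial>\<nu>)"
      by (rule momentum_split[OF u \<sigma>])
    \<comment> \<open>Both summands are integrable by themselves, so the integral of the sum
      splits.\<close>
    then show "J_L_split G P PS vol A Q \<alpha> (u, \<sigma>) =
        delta_integral (\<lambda>\<beta> v. \<beta> v) \<nu> bQ hor u + delta_integral fibre_pairing \<nu> bQ (\<lambda>s. vert s) \<sigma>"
      using integrable_hor[OF u] integrable_vert[OF \<sigma>] by (simp add: delta_integral_def)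
  qed
qed

end
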